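(* For $\gamma\in[0,\infty)^d$ and $z\in\mathbf T^{(d)}$, the fractional powers $\mathcal{I}_{z,\gamma}$ and the modified fractional powers $\mathcal{J}_{z,\gamma}$ of the Hankel–Clifford transform are topological isomorphisms on $\mathcal{S}(\mathbb{R}^d_+)$ and they extend to isometries from $L^2(\mathbb{R}^d_+,t^\gamma dt)$ onto itself, with inverses $\mathcal{I}_{\bar z,\gamma}$ and $\mathcal{J}_{\bar z,\gamma}$ respectively. Moreover, for all $p,k\in\mathbb{N}_0^d$ and $f\in\mathcal{S}(\mathbb{R}^d_+)$, $$\left\|t^{(p+k+\gamma)/2}D^pf(t)\right\|_2=\left(\prod_{l=1}^d|1-z_l|^{-p_l+k_l}\right)\left\|t^{(p+k+\gamma)/2}D^k\mathcal{J}_{z,\gamma}f(t)\right\|_2 .$$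
   Context: $\mathbb{R}^d_+=(0,\infty)^d$, $\mathbb{N}_0=\{0,1,2,\dots\}$; $x^t=\prod_lx_l^{t_l}$; $\|\cdot\|_2$ is the norm of $L^2(\mathbb{R}^d_+)$; $L^2(\mathbb{R}^d_+,t^\gamma dt)$ has norm $\left(\int_{\mathbb{R}^d_+}|f(t)|^2t^\gamma dt\right)^{1/2}$. $\mathcal{S}(\mathbb{R}^d_+)$ is the Fréchet space of all $f\in C^\infty(\mathbb{R}^d_+)$ all of whose derivatives extend continuously to $[0,\infty)^d$ and with $\sup_{x\in\mathbb{R}^d_+}x^k|D^pf(x)|<\infty$ for all $k,p\in\mathbb{N}_0^d$ (these are the defining seminorms). $\mathbf T^{(d)}=\{z\in\mathbb{C}^d:\ |z_l|=1,\ z_l\ne1,\ l=1,\dots,d\}$ and $\bar z=(\bar z_1,\dots,\bar z_d)$. $I_\nu$ is the modified Bessel function of the first kind and $J_\nu$ the Bessel function of the first kind. For $f\in\mathcal{S}(\mathbb{R}^d_+)$, $$\mathcal{J}_{z,\gamma}f(t)=\left(\prod_{l=1}^d(1-z_l)^{-1}\right)\int_{\mathbb{R}^d_+}f(x)\prod_{l=1}^d(x_lt_lz_l)^{-\gamma_l/2}x_l^{\gamma_l}I_{\gamma_l}\left(\frac{2\sqrt{x_lt_lz_l}}{1-z_l}\right)dx,$$ $$\mathcal{I}_{z,\gamma}f(t)=\left(\prod_{l=1}^d(1-z_l)^{-1}e^{-\frac12\frac{1+z_l}{1-z_l}t_l}\right)\int_{\mathbb{R}^d_+}f(x)\prod_{l=1}^de^{-\frac12\frac{1+z_l}{1-z_l}x_l}(x_lt_lz_l)^{-\gamma_l/2}x_l^{\gamma_l}I_{\gamma_l}\left(\frac{2\sqrt{x_lt_lz_l}}{1-z_l}\right)dx.$$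 Branches: writing $z_l=e^{i\theta_l}$ with $\theta_l\in(-\pi,\pi]\setminus\{0\}$, one has $(x_lt_lz_l)^{-\gamma_l/2}=(x_lt_l)^{-\gamma_l/2}e^{-i\theta_l\gamma_l/2}$ and $2\sqrt{x_lt_lz_l}/(1-z_l)=i\sqrt{x_lt_l}/\sin(\theta_l/2)$, so that $(x_lt_lz_l)^{-\gamma_l/2}I_{\gamma_l}\left(\frac{2\sqrt{x_lt_lz_l}}{1-z_l}\right)=e^{-i\theta_l\gamma_l/2}(x_lt_l)^{-\gamma_l/2}e^{i\gamma_l\pi\,\mathrm{sgn}(\theta_l)/2}J_{\gamma_l}\left(\frac{\sqrt{x_lt_l}}{|\sin(\theta_l/2)|}\right)$. *)

theory Defs
  imports "HOL-Analysis.Analysis"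
begin

definition pos_orthant :: "(real ^ 'n) set" where
  "pos_orthant = {x. \<forall>l. 0 < x $ l}"

definition closed_orthant :: "(real ^ 'n) set" where
  "closed_orthant = {x. \<forall>l. 0 \<le> x $ l}"

definition monomial :: "real ^ 'n \<Rightarrow> real ^ 'n \<Rightarrow> real" where
  "monomial x t = (\<Prod>l\<in>UNIV. x $ l powr (t $ l))"

definition partial :: "'n \<Rightarrow> (real ^ 'n \<Rightarrow> complex) \<Rightarrow> real ^ 'n \<Rightarrow> complex" where
  "partial l f x = vector_derivative (\<lambda>s. f (x + s *\<^sub>R axis l 1)) (at 0)"

definition partial_exists :: "'n \<Rightarrow> (real ^ 'n \<Rightarrow> complex) \<Rightarrow> real ^ 'n \<Rightarrow> bool" where
  "partial_exists l f x \<longleftrightarrow> (\<lambda>s. f (x + s *\<^sub>R axis l 1)) differentiable (at 0)"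

abbreviation iterated_partial ::
    "'n list \<Rightarrow> (real ^ 'n \<Rightarrow> complex) \<Rightarrow> real ^ 'n \<Rightarrow> complex" where
  "iterated_partial ls f \<equiv> foldr partial ls f"

definition smooth_on_orthant :: "(real ^ 'n \<Rightarrow> complex) \<Rightarrow> bool" where
  "smooth_on_orthant f \<longleftrightarrow>
     (\<forall>ls. continuous_on pos_orthant (iterated_partial ls f) \<and>
           (\<forall>l. \<forall>x\<in>pos_orthant. partial_exists l (iterated_partial ls f) x))"

text \<open>
  The operator $D^p$ for a multi-index $p$.  The index type carries no order, so some
  sequence of differentiations with the multiplicities prescribed by $p$ is chosen; on the
  smooth functions the order of differentiation is immaterial.
\<close>
definition Dp :: "nat ^ 'n \<Rightarrow> (real ^ 'n \<Rightarrow> complex) \<Rightarrow> real ^ 'n \<Rightarrow> complex" where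
  "Dp p f = iterated_partial (SOME ls. \<forall>l. count_list ls l = p $ l) f"

text \<open>
  A function on the orthant is represented by the function on the whole space that vanishes
  outside the open orthant, so that equality of functions on the orthant is equality in HOL.
\<close>
definition orthant_schwartz :: "(real ^ 'n \<Rightarrow> complex) set" where
  "orthant_schwartz =
     {f. (\<forall>x. x \<notin> pos_orthant \<longrightarrow> f x = 0) \<and>
         smooth_on_orthant f \<and>
         (\<forall>p. \<exists>g. continuous_on closed_orthant g \<and> (\<forall>x\<in>pos_orthant. g x = Dp p f x)) \<and>
         (\<forall>k p. bdd_above
            ((\<lambda>x. monomial x (\<chi> l. real (k $ l)) * cmod (Dp p f x)) ` pos_orthant))}"

definition schwartz_seminorm ::
    "nat ^ 'n \<Rightarrow> nat ^ 'n \<Rightarrow> (real ^ 'n \<Rightarrow> complex) \<Rightarrow> real" where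
  "schwartz_seminorm k p f =
     (SUP x\<in>pos_orthant. monomial x (\<chi> l. real (k $ l)) * cmod (Dp p f x))"

definition schwartz_ball ::
    "nat ^ 'n \<Rightarrow> nat ^ 'n \<Rightarrow> (real ^ 'n \<Rightarrow> complex) \<Rightarrow> real \<Rightarrow> (real ^ 'n \<Rightarrow> complex) set" where
  "schwartz_ball k p f e =
     {g \<in> orthant_schwartz. schwartz_seminorm k p (\<lambda>x. g x - f x) < e}"

definition schwartz_topology :: "(real ^ 'n \<Rightarrow> complex) topology" where
  "schwartz_topology = topology_generated_by
     {schwartz_ball k p f e | k p f e. f \<in> orthant_schwartz \<and> 0 < e}"

definition linear_on_functions ::
    "('a \<Rightarrow> complex) set \<Rightarrow> (('a \<Rightarrow> complex) \<Rightarrow> 'a \<Rightarrow> complex) \<Rightarrow> bool" where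
  "linear_on_functions A T \<longleftrightarrow>
     (\<forall>f\<in>A. \<forall>g\<in>A. \<forall>a b. T (\<lambda>x. a * f x + b * g x) = (\<lambda>x. a * T f x + b * T g x))"

text \<open>
  Elements of $L^2(M)$ are represented by functions; equality in $L^2(M)$ is equality
  almost everywhere.
\<close>
definition L2_space :: "'a measure \<Rightarrow> ('a \<Rightarrow> complex) set" where
  "L2_space M = {f \<in> borel_measurable M. integrable M (\<lambda>x. (cmod (f x))\<^sup>2)}"

definition L2_norm :: "'a measure \<Rightarrow> ('a \<Rightarrow> complex) \<Rightarrow> real" where
  "L2_norm M f = sqrt (LINT x|M. (cmod (f x))\<^sup>2)"

definition weighted_measure :: "real ^ 'n \<Rightarrow> (real ^ 'n) measure" where
  "weighted_measure \<gamma> = density (lebesgue_on pos_orthant) (\<lambda>t. ennreal (monomial t \<gamma>))"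

text \<open>
  \<open>U\<close> induces a linear isometry from $L^2(M)$ onto itself which extends the operator \<open>T\<close>
  given on the subspace \<open>A\<close>.
\<close>
definition extends_to_L2_isometry ::
    "'a measure \<Rightarrow> ('a \<Rightarrow> complex) set \<Rightarrow> (('a \<Rightarrow> complex) \<Rightarrow> 'a \<Rightarrow> complex) \<Rightarrow>
     (('a \<Rightarrow> complex) \<Rightarrow> 'a \<Rightarrow> complex) \<Rightarrow> bool" where
  "extends_to_L2_isometry M A T U \<longleftrightarrow>
     A \<subseteq> L2_space M \<and>
     (\<forall>f\<in>A. AE x in M. U f x = T f x) \<and>
     (\<forall>f\<in>L2_space M. U f \<in> L2_space M) \<and>
     (\<forall>f\<in>L2_space M. \<forall>g\<in>L2_space M.
        (AE x in M. f x = g x) \<longrightarrow> (AE x in M. U f x = U g x)) \<and>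
     (\<forall>f\<in>L2_space M. \<forall>g\<in>L2_space M. \<forall>a b.
        AE x in M. U (\<lambda>y. a * f y + b * g y) x = a * U f x + b * U g x) \<and>
     (\<forall>f\<in>L2_space M. L2_norm M (U f) = L2_norm M f) \<and>
     (\<forall>g\<in>L2_space M. \<exists>f\<in>L2_space M. AE x in M. U f x = g x)"

definition L2_mutually_inverse ::
    "'a measure \<Rightarrow> (('a \<Rightarrow> complex) \<Rightarrow> 'a \<Rightarrow> complex) \<Rightarrow>
     (('a \<Rightarrow> complex) \<Rightarrow> 'a \<Rightarrow> complex) \<Rightarrow> bool" where
  "L2_mutually_inverse M U V \<longleftrightarrow>
     (\<forall>f\<in>L2_space M. (AE x in M. V (U f) x = f x) \<and> (AE x in M. U (V f) x = f x))"

definition punctured_torus :: "(complex ^ 'n) set" where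
  "punctured_torus = {z. \<forall>l. cmod (z $ l) = 1 \<and> z $ l \<noteq> 1}"

definition cnj_vec :: "complex ^ 'n \<Rightarrow> complex ^ 'n" where
  "cnj_vec z = (\<chi> l. cnj (z $ l))"

text \<open>The modified Bessel function of the first kind, with the principal branch of the power.\<close>
definition bessel_I :: "real \<Rightarrow> complex \<Rightarrow> complex" where
  "bessel_I \<nu> w =
     (w / 2) powr of_real \<nu> *
     (\<Sum>m. (w / 2) ^ (2 * m) / of_real (fact m * Gamma (real m + \<nu> + 1)))"

text \<open>
  The factor of the kernels belonging to one coordinate.  Both \<open>powr\<close> and \<open>csqrt\<close> are
  principal branches (argument in $(-\pi,\pi]$).  For $z = e^{i\theta}$ with
  $\theta \in (-\pi,\pi]$, $\theta \neq 0$, the argument of \<open>bessel_I\<close> is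
  $i\sqrt{xt}/\sin(\theta/2)$, and the value of \<open>bessel_I\<close> there is
  $e^{i\gamma\pi\,\mathrm{sgn}(\theta)/2} J_\gamma(\sqrt{xt}/|\sin(\theta/2)|)$.
\<close>
definition hankel_clifford_factor :: "complex \<Rightarrow> real \<Rightarrow> real \<Rightarrow> real \<Rightarrow> complex" where
  "hankel_clifford_factor z \<gamma> x t =
     (of_real (x * t) * z) powr of_real (- \<gamma> / 2) * of_real (x powr \<gamma>) *
     bessel_I \<gamma> (2 * csqrt (of_real (x * t) * z) / (1 - z))"

definition modified_power ::
    "complex ^ 'n \<Rightarrow> real ^ 'n \<Rightarrow> (real ^ 'n \<Rightarrow> complex) \<Rightarrow> real ^ 'n \<Rightarrow> complex" where
  "modified_power z \<gamma> f t =
     (if t \<in> pos_orthant then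
        (\<Prod>l\<in>UNIV. inverse (1 - z $ l)) *
        (LINT x|lebesgue_on pos_orthant.
           f x * (\<Prod>l\<in>UNIV. hankel_clifford_factor (z $ l) (\<gamma> $ l) (x $ l) (t $ l)))
      else 0)"

definition fractional_power ::
    "complex ^ 'n \<Rightarrow> real ^ 'n \<Rightarrow> (real ^ 'n \<Rightarrow> complex) \<Rightarrow> real ^ 'n \<Rightarrow> complex" where
  "fractional_power z \<gamma> f t =
     (if t \<in> pos_orthant then
        (\<Prod>l\<in>UNIV. inverse (1 - z $ l) *
           exp (- (1 / 2) * ((1 + z $ l) / (1 - z $ l)) * of_real (t $ l))) *
        (LINT x|lebesgue_on pos_orthant.
           f x * (\<Prod>l\<in>UNIV.
             exp (- (1 / 2) * ((1 + z $ l) / (1 - z $ l)) * of_real (x $ l)) *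
             hankel_clifford_factor (z $ l) (\<gamma> $ l) (x $ l) (t $ l)))
      else 0)"

end

theory Submission
  imports Defs "HOL-Library.Multiset"
begin

text \<open>
  Put $r_l = |1 - z_l|^{-2}$ and $C_\nu(u) = \sum_m (-u)^m / (m!\,\Gamma(m+\nu+1))$, an entire
  function.  Positive factors can be pulled out of the principal branches, so on Schwartz functions
  $\mathcal{J}_{z,\gamma}$ is a constant, depending on \<open>z\<close> and \<open>\<gamma>\<close> only, times the Hankel transform
  $H_\gamma f(t) = \int f(x) \prod_l x_l^{\gamma_l} C_{\gamma_l}(r_l x_l t_l)\, dx$
  (\<open>modified_power_hankel\<close>), and $\mathcal{I}_{z,\gamma}$ is $\mathcal{J}_{z,\gamma}$ preceded and
  followed by multiplication with one unimodular function \<open>chirp\<close>.  Everything is therefore a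
  statement about $H_\gamma$.

  From $C_\nu' = -C_{\nu+1}$ and $(u^{\nu+1} C_{\nu+1})' = u^\nu C_\nu$ one gets
  $\partial_l H_\gamma f = -r_l H_{\gamma+e_l} f$ and, integrating by parts,
  $H_\gamma f = -H_{\gamma+e_l}\, \partial_l f$; a second integration by parts turns multiplication
  of $H_\gamma f$ by $t_l$ into a differential operator applied to \<open>f\<close>.  Since $C_\nu$ is bounded on the
  half-line, every seminorm of $H_\gamma f$ is thus controlled by a weighted $L^1$ norm of derivatives
  of \<open>f\<close>, and $H_\gamma$ is continuous on the Schwartz space (\<open>continuous_op_hankel\<close>).

  The transform maps $e^{-b \cdot x}$ to a multiple of $e^{-(r/b) \cdot x}$, hence $H_\gamma^2$ is the
  constant $c = \prod_l r_l^{-\gamma_l-1}$ on exponentials.  It is symmetric for the weight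
  $x^\gamma$.  So $H_\gamma^2 f - c f$ is orthogonal to all exponentials, and these span a dense
  subspace of the weighted $L^2$ space, because in the variables $y_l = e^{-x_l}$ they are monomials
  and the Stone--Weierstrass theorem applies (\<open>expo_span_dense\<close>).  This is the inversion formula
  \<open>hankel_hankel\<close>; with symmetry it gives Parseval's identity \<open>hankel_parseval\<close>.  The constants in
  front of the transforms for \<open>z\<close> and its conjugate multiply to $c^{-1}$ (\<open>phase_cnj\<close>), so the operators
  for \<open>z\<close> and its conjugate are mutually inverse isometries of the Schwartz space, and such a pair
  extends to the completion (\<open>L2_isometry_pair_extension\<close>).

  For the identity between derivatives, $D^k H_\gamma f$ is up to sign $r^k H_{\gamma+k} f$, which in
  turn is up to sign $r^k H_{\gamma+k+p} D^p f$; Parseval's identity at the index $\gamma+k+p$ compares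
  its norm with that of $D^p f$.
\<close>

section \<open>The Bessel--Clifford function\<close>

text \<open>
  Up to the factor $u^{\nu/2}$ this is $J_\nu(2 \sqrt u)$.  Dividing by that factor leaves an entire
  function, so that no branch of a power enters the analysis.
\<close>
definition clifford :: "real \<Rightarrow> real \<Rightarrow> real" where
  "clifford \<nu> u = (\<Sum>m. (- u) ^ m / (fact m * Gamma (real m + \<nu> + 1)))"

lemma Gamma_mono_nat:
  assumes "0 \<le> \<nu>"
  shows "Gamma (\<nu> + 1) \<le> Gamma (real m + \<nu> + 1)"
proof (induction m)
  case (Suc m)
  have "Gamma (real (Suc m) + \<nu> + 1) = (real m + \<nu> + 1) * Gamma (real m + \<nu> + 1)"
    using Gamma_plus1[of "real m + \<nu> + 1"] assms by (auto simp: add_ac nonpos_Ints_def)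
  moreover have "1 * Gamma (real m + \<nu> + 1) \<le> (real m + \<nu> + 1) * Gamma (real m + \<nu> + 1)"
    using assms by (intro mult_right_mono) (auto intro: Gamma_real_nonneg)
  ultimately show ?case using Suc by simp
qed simp

definition clifford_coeff :: "real \<Rightarrow> nat \<Rightarrow> real" where
  "clifford_coeff \<nu> m = (- 1) ^ m / (fact m * Gamma (real m + \<nu> + 1))"

lemma clifford_powser: "clifford \<nu> u = (\<Sum>m. clifford_coeff \<nu> m * u ^ m)"
  unfolding clifford_def clifford_coeff_def
  by (rule arg_cong[where f=suminf], rule ext) (simp add: power_minus')

lemma abs_clifford_coeff_le:
  assumes "0 \<le> \<nu>"
  shows "\<bar>clifford_coeff \<nu> m\<bar> \<le> inverse (Gamma (\<nu> + 1)) * inverse (fact m)"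
proof -
  have g: "0 < Gamma (\<nu> + 1)" "Gamma (\<nu> + 1) \<le> Gamma (real m + \<nu> + 1)"
    using assms Gamma_mono_nat by (auto intro: Gamma_real_pos)
  have "\<bar>clifford_coeff \<nu> m\<bar> = inverse (fact m) * inverse (Gamma (real m + \<nu> + 1))"
    using g by (simp add: clifford_coeff_def abs_mult divide_inverse)
  also have "\<dots> \<le> inverse (fact m) * inverse (Gamma (\<nu> + 1))"
    using g by (intro mult_left_mono le_imp_inverse_le) auto
  finally show ?thesis by (simp add: mult.commute)
qed

lemma summable_abs_clifford:
  assumes "0 \<le> \<nu>"
  shows "summable (\<lambda>m. \<bar>clifford_coeff \<nu> m * u ^ m\<bar>)"
proof (rule summable_comparison_test'[where N=0])
  show "summable (\<lambda>m. inverse (Gamma (\<nu> + 1)) * (inverse (fact m) * \<bar>u\<bar> ^ m))"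
    by (intro summable_mult summable_exp)
  fix m
  show "norm \<bar>clifford_coeff \<nu> m * u ^ m\<bar> \<le> inverse (Gamma (\<nu> + 1)) * (inverse (fact m) * \<bar>u\<bar> ^ m)"
    using mult_right_mono[OF abs_clifford_coeff_le[OF assms, of m], of "\<bar>u\<bar> ^ m"]
    by (simp add: abs_mult power_abs mult.assoc)
qed

lemma summable_clifford: "0 \<le> \<nu> \<Longrightarrow> summable (\<lambda>m. clifford_coeff \<nu> m * u ^ m)"
  by (rule summable_rabs_cancel) (rule summable_abs_clifford)

lemma diffs_clifford_coeff: "diffs (clifford_coeff \<nu>) = (\<lambda>m. - clifford_coeff (\<nu> + 1) m)"
proof
  fix m
  have "fact (Suc m) = real (Suc m) * fact m" "real (Suc m) + \<nu> + 1 = real m + (\<nu> + 1) + 1"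
    by simp_all
  then show "diffs (clifford_coeff \<nu>) m = - clifford_coeff (\<nu> + 1) m"
    unfolding diffs_def clifford_coeff_def by simp
qed

lemma has_field_derivative_clifford:
  assumes "0 \<le> \<nu>"
  shows "(clifford \<nu> has_field_derivative - clifford (\<nu> + 1) u) (at u)"
proof -
  have "((\<lambda>u. \<Sum>m. clifford_coeff \<nu> m * u ^ m) has_field_derivative
      (\<Sum>m. diffs (clifford_coeff \<nu>) m * u ^ m)) (at u)"
    by (rule termdiffs_strong'[where K="norm u + 1"]) (use summable_clifford[OF assms] in auto)
  moreover have "(\<Sum>m. diffs (clifford_coeff \<nu>) m * u ^ m) = - clifford (\<nu> + 1) u"
    unfolding diffs_clifford_coeff clifford_powser
    using suminf_minus[OF summable_clifford[of "\<nu> + 1" u]] assms by simp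
  ultimately show ?thesis by (simp add: clifford_powser[abs_def])
qed

lemma has_field_derivative_clifford' [derivative_intros]:
  assumes "0 \<le> \<nu>" "(g has_field_derivative g') (at x within S)"
  shows "((\<lambda>x. clifford \<nu> (g x)) has_field_derivative - clifford (\<nu> + 1) (g x) * g') (at x within S)"
  using DERIV_chain2[OF has_field_derivative_clifford[OF assms(1)] assms(2)] .

lemma continuous_on_clifford [continuous_intros]:
  assumes "0 \<le> \<nu>" "continuous_on S f"
  shows "continuous_on S (\<lambda>x. clifford \<nu> (f x))"
proof -
  have "continuous_on UNIV (clifford \<nu>)"
    using has_field_derivative_clifford[OF assms(1)]
    by (meson DERIV_continuous continuous_at_imp_continuous_on)
  then show ?thesis
    using assms(2) continuous_on_compose2 by blast
qed

text \<open>
  Multiplied by $u^\nu$ this is $(u^{\nu+1} C_{\nu+1})' = u^\nu C_\nu$, the identity behind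
  integration by parts against the kernel.  It holds coefficient by coefficient.
\<close>
lemma clifford_recurrence:
  assumes "0 \<le> \<nu>"
  shows "(\<nu> + 1) * clifford (\<nu> + 1) u - u * clifford (\<nu> + 2) u = clifford \<nu> u"
proof -
  define a where "a m = clifford_coeff (\<nu> + 1) m * u ^ m" for m
  define b where "b m = clifford_coeff (\<nu> + 2) m * u ^ Suc m" for m
  define c where "c m = clifford_coeff \<nu> m * u ^ m" for m
  have sa: "summable a" and sc: "summable c" and sb: "summable b"
    using summable_clifford[of "\<nu> + 1" u] summable_clifford[of \<nu> u]
      summable_mult[OF summable_clifford[of "\<nu> + 2" u], of u] assms
    by (simp_all add: a_def[abs_def] b_def[abs_def] c_def[abs_def] mult.left_commute)
  have G: "Gamma (real m + \<nu> + 2) = (real m + \<nu> + 1) * Gamma (real m + \<nu> + 1)" for m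
    using Gamma_plus1[of "real m + \<nu> + 1"] assms by (auto simp: add_ac nonpos_Ints_def)
  have Gp: "Gamma (real m + \<nu> + 1) > 0" for m
    using assms by (auto intro: Gamma_real_pos)
  have split: "(\<nu> + 1) * a (Suc m) - b m = c (Suc m)" for m
  proof -
    have "Gamma (real (Suc m) + (\<nu> + 1) + 1) = (real m + \<nu> + 2) * Gamma (real m + \<nu> + 2)"
      using G[of "Suc m"] by (simp add: add_ac)
    moreover have "Gamma (real m + (\<nu> + 2) + 1) = (real m + \<nu> + 2) * Gamma (real m + \<nu> + 2)"
      using G[of "Suc m"] by (simp add: add_ac)
    moreover have "Gamma (real (Suc m) + \<nu> + 1) = Gamma (real m + \<nu> + 2)"
      by (simp add: add_ac)
    ultimately show ?thesis
      using Gp[of "Suc m"] assms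
      unfolding a_def b_def c_def clifford_coeff_def
      by (simp add: divide_simps add_ac) (simp add: algebra_simps)
  qed
  have zero: "(\<nu> + 1) * a 0 = c 0"
    using G[of 0] Gp[of 0] assms by (simp add: a_def c_def clifford_coeff_def add_ac)
  have "(\<nu> + 1) * clifford (\<nu> + 1) u = (\<nu> + 1) * (a 0 + (\<Sum>m. a (Suc m)))"
    using suminf_split_head[OF sa] by (simp add: clifford_powser a_def[abs_def])
  moreover have "clifford \<nu> u = c 0 + (\<Sum>m. c (Suc m))"
    using suminf_split_head[OF sc] by (simp add: clifford_powser c_def[abs_def])
  moreover have "u * clifford (\<nu> + 2) u = (\<Sum>m. b m)"
    unfolding clifford_powser b_def
    using suminf_mult[OF summable_clifford[of "\<nu> + 2" u], of u] assms by (simp add: mult_ac)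
  moreover have "(\<Sum>m. c (Suc m)) = (\<nu> + 1) * (\<Sum>m. a (Suc m)) - (\<Sum>m. b m)"
    unfolding split[symmetric]
    using sa sb by (subst suminf_diff[symmetric]) (auto intro!: summable_mult simp: suminf_mult summable_Suc_iff)
  ultimately show ?thesis using zero by (simp add: algebra_simps)
qed

text \<open>
  By the recurrence $C = C_\nu$ solves $u C'' + (\nu+1) C' + C = 0$.  Therefore the energy
  $C^2 + u C'^2$ has derivative $-(2\nu+1) C'^2 \le 0$, and at $u = 0$ it is $C(0)^2$.
\<close>
lemma abs_clifford_le:
  assumes "0 \<le> \<nu>" "0 \<le> u"
  shows "\<bar>clifford \<nu> u\<bar> \<le> inverse (Gamma (\<nu> + 1))"
proof -
  define E where "E v = (clifford \<nu> v)\<^sup>2 + v * (clifford (\<nu> + 1) v)\<^sup>2" for v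
  have "E u \<le> E 0"
  proof (rule DERIV_nonpos_imp_nonincreasing[OF assms(2)])
    fix v assume v: "0 \<le> v" "v \<le> u"
    have "(E has_field_derivative
        2 * clifford \<nu> v * (- clifford (\<nu> + 1) v) + ((clifford (\<nu> + 1) v)\<^sup>2 +
          v * (2 * clifford (\<nu> + 1) v * (- clifford (\<nu> + 2) v)))) (at v)"
      unfolding E_def using assms(1)
      by (auto intro!: derivative_eq_intros simp: add_ac)
    moreover have "2 * clifford \<nu> v * (- clifford (\<nu> + 1) v) + ((clifford (\<nu> + 1) v)\<^sup>2 +
          v * (2 * clifford (\<nu> + 1) v * (- clifford (\<nu> + 2) v)))
        = - (2 * \<nu> + 1) * (clifford (\<nu> + 1) v)\<^sup>2"
      unfolding clifford_recurrence[OF assms(1), of v, symmetric]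
      by (simp add: power2_eq_square algebra_simps)
    moreover have "- (2 * \<nu> + 1) * (clifford (\<nu> + 1) v)\<^sup>2 \<le> 0"
      using assms(1) by (intro mult_nonpos_nonneg) auto
    ultimately show "\<exists>y. (E has_field_derivative y) (at v) \<and> y \<le> 0" by metis
  qed
  moreover have "E 0 = (inverse (Gamma (\<nu> + 1)))\<^sup>2"
  proof -
    have "clifford \<nu> 0 = clifford_coeff \<nu> 0"
      unfolding clifford_powser by (rule powser_zero)
    then show ?thesis by (simp add: E_def clifford_coeff_def divide_inverse)
  qed
  moreover have "(clifford \<nu> u)\<^sup>2 \<le> E u" using assms(2) by (simp add: E_def)
  ultimately have "\<bar>clifford \<nu> u\<bar>\<^sup>2 \<le> (inverse (Gamma (\<nu> + 1)))\<^sup>2" by simp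
  then show ?thesis
    by (rule power2_le_imp_le) (use assms in \<open>auto intro: Gamma_real_nonneg\<close>)
qed

lemma borel_measurable_clifford [measurable]: "0 \<le> \<nu> \<Longrightarrow> clifford \<nu> \<in> borel_measurable borel"
  by (intro borel_measurable_continuous_onI continuous_on_clifford continuous_on_id)

section \<open>Partial derivatives and Schwartz functions on the orthant\<close>

lemma open_pos_orthant: "open (pos_orthant :: (real ^ 'n) set)"
proof -
  have "(pos_orthant :: (real ^ 'n) set) = (\<Inter>l. {x. 0 < x $ l})"
    by (auto simp: pos_orthant_def)
  moreover have "open {x :: real ^ 'n. 0 < x $ l}" for l
    by (intro open_Collect_less continuous_intros)
  ultimately show ?thesis by (metis finite open_INT)
qed

lemma pos_orthant_subset_closed: "pos_orthant \<subseteq> closed_orthant"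
  by (auto simp: pos_orthant_def closed_orthant_def intro: less_imp_le)

lemma pos_orthantD: "x \<in> pos_orthant \<Longrightarrow> 0 < x $ l"
  by (simp add: pos_orthant_def)

definition orthant_part :: "(real ^ 'n \<Rightarrow> complex) \<Rightarrow> real ^ 'n \<Rightarrow> complex" where
  "orthant_part f x = (if x \<in> pos_orthant then f x else 0)"

definition has_partial ::
    "'n \<Rightarrow> (real ^ 'n \<Rightarrow> complex) \<Rightarrow> complex \<Rightarrow> real ^ 'n \<Rightarrow> bool" where
  "has_partial l f d x \<longleftrightarrow>
     ((\<lambda>s. f (x + s *\<^sub>R axis l 1)) has_vector_derivative d) (at 0)"

text \<open>
  Partial differentiation for functions extended by zero: at a boundary point the extension need not
  be differentiable and \<open>partial\<close> takes an arbitrary value there, which is cut off.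
\<close>
definition pd :: "'n \<Rightarrow> (real ^ 'n \<Rightarrow> complex) \<Rightarrow> real ^ 'n \<Rightarrow> complex" where
  "pd l f = orthant_part (partial l f)"

lemma pd_apply: "x \<in> pos_orthant \<Longrightarrow> pd l f x = partial l f x"
  by (simp add: pd_def orthant_part_def)

lemma pd_outside: "x \<notin> pos_orthant \<Longrightarrow> pd l f x = 0"
  by (simp add: pd_def orthant_part_def)

lemma has_partial_imp:
  assumes "has_partial l f d x"
  shows "partial_exists l f x" "partial l f x = d"
  using assms unfolding has_partial_def partial_exists_def partial_def
  by (auto intro: differentiableI_vector vector_derivative_at)

lemma partial_exists_iff: "partial_exists l f x \<longleftrightarrow> has_partial l f (partial l f x) x"
  unfolding has_partial_def partial_exists_def partial_def
  by (rule vector_derivative_works)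

lemma open_line_pos_orthant: "open {s. x + s *\<^sub>R axis l 1 \<in> (pos_orthant :: (real ^ 'n) set)}"
  using continuous_open_vimage[OF open_pos_orthant, of "\<lambda>s. x + s *\<^sub>R axis l 1"]
  by (simp add: vimage_def continuous_intros)

lemma has_partial_cong:
  assumes "has_partial l f d x" "x \<in> pos_orthant" "\<And>y. y \<in> pos_orthant \<Longrightarrow> f y = g y"
  shows "has_partial l g d x"
  unfolding has_partial_def
  by (rule has_vector_derivative_transform_within_open[OF assms(1)[unfolded has_partial_def]
        open_line_pos_orthant]) (use assms in auto)

lemma partial_exists_cong:
  assumes "x \<in> pos_orthant" "\<And>y. y \<in> pos_orthant \<Longrightarrow> f y = g y"
  shows "partial_exists l f x \<longleftrightarrow> partial_exists l g x"
proof
  assume "partial_exists l f x"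
  then show "partial_exists l g x"
    unfolding partial_exists_iff[of l f]
    by (rule has_partial_imp(1)[OF has_partial_cong]) (use assms in auto)
next
  assume "partial_exists l g x"
  then show "partial_exists l f x"
    unfolding partial_exists_iff[of l g]
    by (rule has_partial_imp(1)[OF has_partial_cong]) (use assms in auto)
qed

lemma partial_cong:
  assumes "x \<in> pos_orthant" "\<And>y. y \<in> pos_orthant \<Longrightarrow> f y = g y"
  shows "partial l f x = partial l g x"
  unfolding partial_def
proof (rule vector_derivative_cong_eq)
  have "\<forall>\<^sub>F s in nhds 0. s \<in> {s. x + s *\<^sub>R axis l 1 \<in> pos_orthant}"
    by (rule eventually_nhds_in_open[OF open_line_pos_orthant]) (use assms(1) in simp)
  then show "\<forall>\<^sub>F s in nhds 0. s \<in> UNIV \<longrightarrow> f (x + s *\<^sub>R axis l 1) = g (x + s *\<^sub>R axis l 1)"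
    by eventually_elim (use assms(2) in simp)
qed auto

lemma pd_eqI:
  assumes "\<And>x. x \<in> pos_orthant \<Longrightarrow> has_partial l f (d x) x" "\<And>x. x \<notin> pos_orthant \<Longrightarrow> d x = 0"
  shows "pd l f = d"
  unfolding pd_def orthant_part_def using has_partial_imp(2)[OF assms(1)] assms(2) by (intro ext) auto

lemma has_partial_line:
  assumes "has_partial l f d (x + s0 *\<^sub>R axis l 1)"
  shows "((\<lambda>s. f (x + s *\<^sub>R axis l 1)) has_vector_derivative d) (at s0)"
proof -
  have "((\<lambda>s. s - s0) has_vector_derivative 1) (at s0)"
    by (auto intro!: derivative_eq_intros)
  moreover have "((\<lambda>s. f (x + s0 *\<^sub>R axis l 1 + s *\<^sub>R axis l 1)) has_vector_derivative d) (at (s0 - s0))"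
    using assms by (simp add: has_partial_def)
  ultimately have "((\<lambda>s. f (x + s0 *\<^sub>R axis l 1 + s *\<^sub>R axis l 1)) \<circ> (\<lambda>s. s - s0)
      has_vector_derivative 1 *\<^sub>R d) (at s0)"
    by (rule vector_diff_chain_at)
  then show ?thesis by (simp add: o_def scaleR_diff_left algebra_simps)
qed

lemma iterated_partial_pd:
  "x \<in> pos_orthant \<Longrightarrow> iterated_partial ls f x = foldr pd ls f x"
proof (induction ls arbitrary: x)
  case (Cons l ls)
  then show ?case
    using partial_cong[OF Cons.prems, of "iterated_partial ls f" "foldr pd ls f"]
    by (simp add: pd_apply)
qed simp

text \<open>
  The conditions on a Schwartz function that involve the function but none of its derivatives.
\<close>
definition rapidly_decreasing :: "(real ^ 'n \<Rightarrow> complex) \<Rightarrow> bool" where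
  "rapidly_decreasing f \<longleftrightarrow>
     (\<forall>x. x \<notin> pos_orthant \<longrightarrow> f x = 0) \<and>
     (\<exists>g. continuous_on closed_orthant g \<and> (\<forall>x\<in>pos_orthant. g x = f x)) \<and>
     (\<forall>k::nat^'n. \<exists>C. \<forall>x\<in>pos_orthant. monomial x (\<chi> l. real (k $ l)) * cmod (f x) \<le> C)"

lemma bdd_above_image_iff: "bdd_above (h ` A) \<longleftrightarrow> (\<exists>C::real. \<forall>x\<in>A. h x \<le> C)"
  by (auto simp: bdd_above_def)

lemma multiindex_induct [case_names zero add]:
  fixes p :: "nat ^ 'n"
  assumes "P 0" "\<And>p l. P p \<Longrightarrow> P (p + axis l 1)"
  shows "P p"
proof (induction "\<Sum>l\<in>UNIV. p $ l" arbitrary: p)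
  case 0
  then have "p = 0" by (auto simp: vec_eq_iff)
  then show ?case using assms(1) by simp
next
  case (Suc n)
  then obtain l where l: "0 < p $ l" by (metis gr0I sum.neutral nat.distinct(1))
  define q where "q = p - axis l 1"
  have pq: "p = q + axis l 1" using l by (auto simp: q_def vec_eq_iff axis_def)
  have "(\<Sum>i\<in>UNIV. p $ i) = (\<Sum>i\<in>UNIV. q $ i) + (\<Sum>i\<in>UNIV. (axis l 1 :: nat^'n) $ i)"
    unfolding pq by (simp add: sum.distrib)
  also have "(\<Sum>i\<in>UNIV. (axis l 1 :: nat^'n) $ i) = 1"
    by (simp add: axis_def sum.delta)
  finally have "n = (\<Sum>i\<in>UNIV. q $ i)" using Suc by simp
  then show ?case using Suc(1) assms(2) pq by metis
qed

lemma ex_count_list: "\<exists>ls. \<forall>l. count_list ls l = (p :: nat ^ 'n) $ l"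
proof (induction p rule: multiindex_induct)
  case zero
  show ?case by (intro exI[of _ "[]"]) auto
next
  case (add p l)
  then obtain ls where "\<forall>l. count_list ls l = p $ l" by blast
  then show ?case by (intro exI[of _ "l # ls"]) (auto simp: axis_def)
qed

text \<open>
  Schwarz's theorem.  Write $f$ along a segment in direction \<open>m\<close> as the integral of its derivative,
  differentiate under that integral in direction \<open>l\<close>, and differentiate the resulting identity in
  direction \<open>m\<close>.
\<close>
lemma partial_commute:
  fixes f :: "real ^ 'n \<Rightarrow> complex"
  assumes f: "\<And>l x. x \<in> pos_orthant \<Longrightarrow> partial_exists l f x"
    and fm: "\<And>l m x. x \<in> pos_orthant \<Longrightarrow> partial_exists l (partial m f) x"
    and cm: "\<And>m. continuous_on pos_orthant (partial m f)"
    and clm: "\<And>l m. continuous_on pos_orthant (partial l (partial m f))"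
    and x: "x \<in> pos_orthant"
  shows "partial m (partial l f) x = partial l (partial m f) x"
proof -
  define y where "y s t = x + s *\<^sub>R axis l 1 + t *\<^sub>R axis m 1" for s t
  \<comment> \<open>small enough for the square of side twice \<open>\<delta>\<close> around \<open>x\<close> to stay in the orthant, also for \<open>l = m\<close>\<close>
  define \<delta> where "\<delta> = min (x $ l) (x $ m) / 2"
  have \<delta>: "0 < \<delta>" "2 * \<delta> \<le> x $ l" "2 * \<delta> \<le> x $ m"
    using pos_orthantD[OF x, of l] pos_orthantD[OF x, of m] by (auto simp: \<delta>_def)
  have y_in: "y s t \<in> pos_orthant" if "- \<delta> < s" "- \<delta> < t" for s t
    unfolding pos_orthant_def
  proof (intro CollectI allI)
    fix i
    have "0 < x $ i" by (rule pos_orthantD[OF x])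
    then show "0 < y s t $ i"
      using that \<delta> by (auto simp: y_def axis_def)
  qed
  have cy: "continuous_on A (\<lambda>p. y (fst p) (snd p))" for A
    unfolding y_def by (intro continuous_intros)
  have cyt: "continuous_on A (\<lambda>\<tau>. y s \<tau>)" for A s
    unfolding y_def by (intro continuous_intros)
  define a where "a = - \<delta> / 2"
  have a: "- \<delta> < a" "a < 0" using \<delta>(1) by (auto simp: a_def)
  have dt: "((\<lambda>t. f (y s t)) has_vector_derivative partial m f (y s t)) (at t)"
    if "- \<delta> < s" "- \<delta> < t" for s t
    using has_partial_line[of m f _ "x + s *\<^sub>R axis l 1" t] f[OF y_in[OF that], of m]
    unfolding partial_exists_iff y_def by blast
  have swap: "y s t = x + t *\<^sub>R axis m 1 + s *\<^sub>R axis l 1" for s t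
    by (simp add: y_def add_ac)
  have ds: "((\<lambda>s. f (y s t)) has_vector_derivative partial l f (y s t)) (at s)"
    if "- \<delta> < s" "- \<delta> < t" for s t
    using has_partial_line[of l f _ "x + t *\<^sub>R axis m 1" s] f[OF y_in[OF that], of l]
    unfolding partial_exists_iff swap by blast
  have dsm: "((\<lambda>s. partial m f (y s t)) has_vector_derivative partial l (partial m f) (y s t)) (at s)"
    if "- \<delta> < s" "- \<delta> < t" for s t
    using has_partial_line[of l "partial m f" _ "x + t *\<^sub>R axis m 1" s] fm[OF y_in[OF that], of l m]
    unfolding partial_exists_iff swap by blast
  have dtl: "((\<lambda>t. partial l f (y 0 t)) has_vector_derivative partial m (partial l f) (y 0 t)) (at t)"
    if "- \<delta> < t" for t
    using has_partial_line[of m "partial l f" _ "x + 0 *\<^sub>R axis l 1" t] fm[OF y_in[OF _ that], of 0 m l] \<delta>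
    unfolding partial_exists_iff y_def by simp
  have cont_t: "continuous_on {a..t} (\<lambda>\<tau>. partial m f (y s \<tau>))" if "- \<delta> < s" for s t
    by (rule continuous_on_compose2[OF cm cyt]) (use that a in \<open>auto intro!: y_in\<close>)
  have FTC: "integral {a..t} (\<lambda>\<tau>. partial m f (y s \<tau>)) = f (y s t) - f (y s a)"
    if "- \<delta> < s" "a \<le> t" for s t
  proof (rule integral_unique, rule fundamental_theorem_of_calculus)
    fix \<tau> assume "\<tau> \<in> {a..t}"
    then have "- \<delta> < \<tau>" using a by simp
    then show "((\<lambda>t. f (y s t)) has_vector_derivative partial m f (y s \<tau>)) (at \<tau> within {a..t})"
      by (rule has_vector_derivative_at_within[OF dt[OF that(1)]])
  qed (rule that(2))
  have leib: "partial l f (y 0 t) - partial l f (y 0 a)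
      = integral {a..t} (\<lambda>\<tau>. partial l (partial m f) (y 0 \<tau>))" if t: "a \<le> t" for t
  proof -
    let ?U = "{-\<delta><..<\<delta>}"
    have "((\<lambda>s. integral (cbox a t) (\<lambda>\<tau>. partial m f (y s \<tau>))) has_vector_derivative
        integral (cbox a t) (\<lambda>\<tau>. partial l (partial m f) (y 0 \<tau>))) (at 0 within ?U)"
    proof (rule leibniz_rule_vector_derivative)
      show "((\<lambda>s. partial m f (y s \<tau>)) has_vector_derivative partial l (partial m f) (y s \<tau>))
          (at s within ?U)" if "s \<in> ?U" "\<tau> \<in> cbox a t" for s \<tau>
        by (rule has_vector_derivative_at_within[OF dsm]) (use that a in auto)
      show "(\<lambda>\<tau>. partial m f (y s \<tau>)) integrable_on cbox a t" if "s \<in> ?U" for s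
        using cont_t[of s t] that by (auto intro!: integrable_continuous_interval)
      show "continuous_on (?U \<times> cbox a t) (\<lambda>(s, \<tau>). partial l (partial m f) (y s \<tau>))"
        unfolding split_beta
        by (rule continuous_on_compose2[OF clm cy]) (use a in \<open>auto intro!: y_in\<close>)
    qed (use \<delta> in auto)
    then have "((\<lambda>s. integral {a..t} (\<lambda>\<tau>. partial m f (y s \<tau>))) has_vector_derivative
        integral {a..t} (\<lambda>\<tau>. partial l (partial m f) (y 0 \<tau>))) (at 0)"
      using at_within_open[of 0 ?U] \<delta> by simp
    then have "((\<lambda>s. f (y s t) - f (y s a)) has_vector_derivative
        integral {a..t} (\<lambda>\<tau>. partial l (partial m f) (y 0 \<tau>))) (at 0)"
      by (rule has_vector_derivative_transform_within_open[where S = ?U])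
        (use t \<delta> FTC in auto)
    moreover have "((\<lambda>s. f (y s t) - f (y s a)) has_vector_derivative
        partial l f (y 0 t) - partial l f (y 0 a)) (at 0)"
      by (intro derivative_intros ds) (use a t \<delta> in auto)
    ultimately show ?thesis by (metis vector_derivative_at)
  qed
  have "((\<lambda>t. integral {a..t} (\<lambda>\<tau>. partial l (partial m f) (y 0 \<tau>))) has_vector_derivative
      partial l (partial m f) (y 0 0)) (at 0 within {a..\<delta>})"
  proof (rule integral_has_vector_derivative)
    show "continuous_on {a..\<delta>} (\<lambda>\<tau>. partial l (partial m f) (y 0 \<tau>))"
      by (rule continuous_on_compose2[OF clm cyt]) (use \<delta> a in \<open>auto intro!: y_in\<close>)
  qed (use a \<delta> in auto)
  then have "((\<lambda>t. integral {a..t} (\<lambda>\<tau>. partial l (partial m f) (y 0 \<tau>))) has_vector_derivative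
      partial l (partial m f) (y 0 0)) (at 0)"
    using at_within_Icc_at[of a 0 \<delta>] a \<delta> by simp
  then have "((\<lambda>t. partial l f (y 0 t) - partial l f (y 0 a)) has_vector_derivative
      partial l (partial m f) (y 0 0)) (at 0)"
    by (rule has_vector_derivative_transform_within_open[where S = "{a<..<\<delta>}"])
      (use a \<delta> leib in auto)
  moreover have "((\<lambda>t. partial l f (y 0 t) - partial l f (y 0 a)) has_vector_derivative
      partial m (partial l f) (y 0 0) - 0) (at 0)"
    by (intro derivative_intros dtl) (use \<delta> in auto)
  ultimately have "partial l (partial m f) (y 0 0) = partial m (partial l f) (y 0 0) - 0"
    by (metis vector_derivative_at)
  then show ?thesis by (simp add: y_def)
qed

lemma pd_commute:
  fixes f :: "real ^ 'n \<Rightarrow> complex"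
  assumes "smooth_on_orthant f"
  shows "pd m (pd l (foldr pd ls f)) = pd l (pd m (foldr pd ls f))"
proof
  fix x
  let ?h = "iterated_partial ls f"
  have sm1: "continuous_on pos_orthant (iterated_partial qs f)" for qs
    using assms unfolding smooth_on_orthant_def by simp
  have sm2: "partial_exists l (iterated_partial qs f) x" if "x \<in> pos_orthant" for x l qs
    using assms that unfolding smooth_on_orthant_def by simp
  show "pd m (pd l (foldr pd ls f)) x = pd l (pd m (foldr pd ls f)) x"
  proof (cases "x \<in> pos_orthant")
    case True
    have "partial m (partial l ?h) x = partial l (partial m ?h) x"
      proof (rule partial_commute[OF _ _ _ _ True])
      fix i j :: 'n and y :: "real ^ 'n"
      show "continuous_on pos_orthant (partial i ?h)" using sm1[of "i # ls"] by simp
      show "continuous_on pos_orthant (partial i (partial j ?h))"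
        using sm1[of "i # j # ls"] by simp
      assume y: "y \<in> pos_orthant"
      show "partial_exists i ?h y" by (rule sm2[OF y])
      show "partial_exists i (partial j ?h) y" using sm2[OF y, of i "j # ls"] by simp
    qed
    then show ?thesis
      using True iterated_partial_pd[OF True, of "m # l # ls" f]
        iterated_partial_pd[OF True, of "l # m # ls" f] by simp
  qed (simp add: pd_outside)
qed

lemma foldr_pd_remove1:
  assumes "smooth_on_orthant f" "l \<in> set ls"
  shows "foldr pd ls f = pd l (foldr pd (remove1 l ls) f)"
  using assms(2)
proof (induction ls)
  case (Cons a ls)
  then show ?case using pd_commute[OF assms(1)] by (cases "a = l") auto
qed simp

lemma foldr_pd_mset:
  assumes "smooth_on_orthant f" "mset ls = mset ls'"
  shows "foldr pd ls f = foldr pd ls' f"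
  using assms(2)
proof (induction ls arbitrary: ls')
  case (Cons l ls)
  then have l: "l \<in> set ls'" by (metis list.set_intros(1) mset_eq_setD)
  have "mset ls = mset (remove1 l ls')" using Cons.prems by (metis mset_remove1 remove1.simps(2))
  then show ?case using Cons.IH[of "remove1 l ls'"] foldr_pd_remove1[OF assms(1) l] by simp
qed simp

text \<open>
  The list chosen in \<open>Dp\<close> is a permutation of every list with the same multiplicities, and by Schwarz's
  theorem the order of differentiation does not matter.
\<close>
lemma Dp_pd:
  assumes "smooth_on_orthant f" "\<And>l. count_list ls l = p $ l" "x \<in> pos_orthant"
  shows "Dp p f x = foldr pd ls f x"
proof -
  have "mset (SOME ls. \<forall>l. count_list ls l = p $ l) = mset ls"
    using someI_ex[OF ex_count_list, of p] assms(2) by (intro multiset_eqI) (simp add: count_mset)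
  then show ?thesis
    unfolding Dp_def using foldr_pd_mset[OF assms(1)] iterated_partial_pd[OF assms(3)] by metis
qed

lemma schwartz_smooth: "f \<in> orthant_schwartz \<Longrightarrow> smooth_on_orthant f"
  by (simp add: orthant_schwartz_def)

lemma schwartz_zero: "f \<in> orthant_schwartz \<Longrightarrow> x \<notin> pos_orthant \<Longrightarrow> f x = 0"
  by (simp add: orthant_schwartz_def)

lemma rapidly_decreasing_foldr_pd:
  fixes f :: "real ^ 'n \<Rightarrow> complex"
  assumes f: "f \<in> orthant_schwartz"
  shows "rapidly_decreasing (foldr pd ls f)"
proof -
  define p where "p = (\<chi> l. count_list ls l)"
  have eq: "Dp p f x = foldr pd ls f x" if "x \<in> pos_orthant" for x
    using Dp_pd[OF schwartz_smooth[OF f] _ that] by (simp add: p_def)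
  have "foldr pd ls f x = 0" if "x \<notin> pos_orthant" for x
    using schwartz_zero[OF f that] that by (cases ls) (auto simp: pd_outside)
  moreover obtain g where "continuous_on closed_orthant g" "\<forall>x\<in>pos_orthant. g x = Dp p f x"
    using f unfolding orthant_schwartz_def by blast
  moreover have "\<exists>C. \<forall>x\<in>pos_orthant. monomial x (\<chi> l. real (k $ l)) * cmod (Dp p f x) \<le> C" for k :: "nat^'n"
    using f unfolding orthant_schwartz_def bdd_above_image_iff by blast
  ultimately show ?thesis
    unfolding rapidly_decreasing_def using eq by metis
qed

lemma rapidly_decreasing_continuous:
  "rapidly_decreasing f \<Longrightarrow> continuous_on pos_orthant f"
  unfolding rapidly_decreasing_def
  by (metis continuous_on_cong continuous_on_subset pos_orthant_subset_closed)

text \<open>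
  A family that is closed under differentiation contains all iterated derivatives of its members, so
  the zeroth order conditions on the family are all conditions.  Thanks to this principle the closure
  properties below need only a formula for first derivatives.
\<close>
lemma schwartz_coinduct:
  fixes f :: "real ^ 'n \<Rightarrow> complex"
  assumes "f \<in> X"
    and decr: "\<And>f. f \<in> X \<Longrightarrow> rapidly_decreasing f"
    and ex: "\<And>f l x. f \<in> X \<Longrightarrow> x \<in> pos_orthant \<Longrightarrow> partial_exists l f x"
    and step: "\<And>f l. f \<in> X \<Longrightarrow> pd l f \<in> X"
  shows "f \<in> orthant_schwartz"
proof -
  have X: "foldr pd ls f \<in> X" for ls
    by (induction ls) (auto intro: assms(1) step)
  have cont: "continuous_on pos_orthant (iterated_partial ls f)" for ls
    using rapidly_decreasing_continuous[OF decr[OF X[of ls]]]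
    by (rule continuous_on_cong[THEN iffD1, rotated 2]) (auto simp: iterated_partial_pd)
  have pe: "partial_exists l (iterated_partial ls f) x" if "x \<in> pos_orthant" for l ls x
    using ex[OF X[of ls] that] iterated_partial_pd
    by (subst partial_exists_cong[OF that, of _ "foldr pd ls f"]) auto
  have smooth: "smooth_on_orthant f"
    unfolding smooth_on_orthant_def using cont pe by blast
  have "(\<exists>g. continuous_on closed_orthant g \<and> (\<forall>x\<in>pos_orthant. g x = Dp p f x)) \<and>
      (\<forall>k. \<exists>C. \<forall>x\<in>pos_orthant. monomial x (\<chi> l. real ((k::nat^'n) $ l)) * cmod (Dp p f x) \<le> C)" for p
  proof -
    obtain ls where "\<And>l. count_list ls l = p $ l" using ex_count_list by blast
    then have "\<And>x. x \<in> pos_orthant \<Longrightarrow> Dp p f x = foldr pd ls f x"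
      using Dp_pd[OF smooth] by blast
    then show ?thesis using decr[OF X[of ls]] unfolding rapidly_decreasing_def by simp
  qed
  then show ?thesis
    using smooth decr[OF assms(1)]
    unfolding orthant_schwartz_def bdd_above_image_iff rapidly_decreasing_def by blast
qed

lemma schwartz_rapidly_decreasing: "f \<in> orthant_schwartz \<Longrightarrow> rapidly_decreasing f"
  using rapidly_decreasing_foldr_pd[of f "[]"] by simp

lemma schwartz_partial_exists:
  assumes "f \<in> orthant_schwartz" "x \<in> pos_orthant"
  shows "partial_exists l f x"
  using schwartz_smooth[OF assms(1)] assms(2) unfolding smooth_on_orthant_def
  by (metis foldr_Nil id_apply)

lemma schwartz_has_partial:
  assumes "f \<in> orthant_schwartz" "x \<in> pos_orthant"
  shows "has_partial l f (pd l f x) x"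
  using schwartz_partial_exists[OF assms, of l] assms(2)
  by (simp add: partial_exists_iff pd_apply)

lemma schwartz_pd:
  assumes f: "f \<in> orthant_schwartz"
  shows "pd l f \<in> orthant_schwartz"
proof (rule schwartz_coinduct[where X = "range (\<lambda>ls. foldr pd ls f)"])
  show "pd l f \<in> range (\<lambda>ls. foldr pd ls f)" by (rule range_eqI[of _ _ "[l]"]) simp
  fix h l assume "h \<in> range (\<lambda>ls. foldr pd ls f)"
  then obtain ls where h: "h = foldr pd ls f" by blast
  show "rapidly_decreasing h" unfolding h by (rule rapidly_decreasing_foldr_pd[OF f])
  show "pd l h \<in> range (\<lambda>ls. foldr pd ls f)" unfolding h by (rule range_eqI[of _ _ "l # ls"]) simp
  fix x :: "real ^ 'a" assume x: "x \<in> pos_orthant"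
  have "partial_exists l (iterated_partial ls f) x"
    using schwartz_smooth[OF f] x unfolding smooth_on_orthant_def by blast
  moreover have "partial_exists l (iterated_partial ls f) x \<longleftrightarrow> partial_exists l (foldr pd ls f) x"
    by (rule partial_exists_cong[OF x]) (rule iterated_partial_pd)
  ultimately show "partial_exists l h x" unfolding h by simp
qed

lemma Dp_zero: "Dp 0 (f :: real ^ 'n \<Rightarrow> complex) = f"
proof -
  define ls where "ls = (SOME ls :: 'n list. \<forall>l. count_list ls l = (0 :: nat ^ 'n) $ l)"
  have "\<forall>l. count_list ls l = (0 :: nat ^ 'n) $ l"
    unfolding ls_def by (rule someI_ex[OF ex_count_list])
  then have "ls = []" by (cases ls) (auto dest: spec[of _ "hd ls"])
  then show ?thesis by (simp add: Dp_def ls_def[symmetric] del: zero_index)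
qed

lemma Dp_add_axis:
  assumes "f \<in> orthant_schwartz" "x \<in> pos_orthant"
  shows "Dp (p + axis l 1) f x = Dp p (pd l f) x"
proof -
  obtain ls where ls: "\<And>l. count_list ls l = p $ l" using ex_count_list by blast
  have "Dp (p + axis l 1) f x = foldr pd (ls @ [l]) f x"
    by (rule Dp_pd[OF schwartz_smooth[OF assms(1)] _ assms(2)]) (auto simp: ls axis_def)
  also have "\<dots> = Dp p (pd l f) x"
    using Dp_pd[OF schwartz_smooth[OF schwartz_pd[OF assms(1)]] ls assms(2)] by simp
  finally show ?thesis .
qed

section \<open>Operators on the Schwartz space\<close>

lemma monomial_nonneg: "0 \<le> monomial x t"
  by (simp add: monomial_def prod_nonneg)

lemma monomial_pos: "x \<in> pos_orthant \<Longrightarrow> 0 < monomial x t"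
  unfolding monomial_def by (intro prod_pos) (metis pos_orthantD powr_gt_zero less_irrefl)

lemma monomial_add: "monomial x (s + t) = monomial x s * monomial x t"
  by (simp add: monomial_def powr_add prod.distrib)

lemma monomial_axis:
  assumes "x \<in> pos_orthant"
  shows "monomial x (axis l c) = x $ l powr c"
proof -
  have "monomial x (axis l c) = (\<Prod>i\<in>UNIV. if i = l then x $ l powr c else 1)"
    unfolding monomial_def
    by (intro prod.cong) (use pos_orthantD[OF assms] in \<open>auto simp: axis_def less_imp_neq[symmetric]\<close>)
  then show ?thesis by (simp add: prod.delta)
qed

abbreviation real_vec :: "nat ^ 'n \<Rightarrow> real ^ 'n" where
  "real_vec k \<equiv> (\<chi> l. real (k $ l))"

lemma real_vec_add_axis: "real_vec (k + axis l 1) = real_vec k + axis l 1"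
  by (auto simp: vec_eq_iff axis_def)

lemma rapidly_decreasingI:
  assumes "\<And>x. x \<notin> pos_orthant \<Longrightarrow> f x = 0"
    and "continuous_on closed_orthant g" "\<And>x. x \<in> pos_orthant \<Longrightarrow> g x = f x"
    and "\<And>k::nat^'n. \<exists>C. \<forall>x\<in>pos_orthant. monomial x (real_vec k) * cmod (f x) \<le> C"
  shows "rapidly_decreasing (f :: real ^ 'n \<Rightarrow> complex)"
  unfolding rapidly_decreasing_def using assms by blast

lemma rapidly_decreasing_lincomb:
  fixes f g :: "real ^ 'n \<Rightarrow> complex"
  assumes "rapidly_decreasing f" "rapidly_decreasing g"
  shows "rapidly_decreasing (\<lambda>x. a * f x + b * g x)"
proof -
  obtain f' where f: "continuous_on closed_orthant f'" "\<And>x. x \<in> pos_orthant \<Longrightarrow> f' x = f x"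
    "\<And>x. x \<notin> pos_orthant \<Longrightarrow> f x = 0"
    "\<And>k::nat^'n. \<exists>C. \<forall>x\<in>pos_orthant. monomial x (real_vec k) * cmod (f x) \<le> C"
    using assms(1) unfolding rapidly_decreasing_def by blast
  obtain g' where g: "continuous_on closed_orthant g'" "\<And>x. x \<in> pos_orthant \<Longrightarrow> g' x = g x"
    "\<And>x. x \<notin> pos_orthant \<Longrightarrow> g x = 0"
    "\<And>k::nat^'n. \<exists>C. \<forall>x\<in>pos_orthant. monomial x (real_vec k) * cmod (g x) \<le> C"
    using assms(2) unfolding rapidly_decreasing_def by blast
  show ?thesis
  proof (rule rapidly_decreasingI[where g = "\<lambda>x. a * f' x + b * g' x"])
    show "continuous_on closed_orthant (\<lambda>x. a * f' x + b * g' x)"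
      by (intro continuous_intros f g)
    fix k :: "nat ^ 'n"
    obtain C D where C: "\<forall>x\<in>pos_orthant. monomial x (real_vec k) * cmod (f x) \<le> C"
      and D: "\<forall>x\<in>pos_orthant. monomial x (real_vec k) * cmod (g x) \<le> D"
      using f(4)[of k] g(4)[of k] by blast
    have "monomial x (real_vec k) * cmod (a * f x + b * g x) \<le> cmod a * C + cmod b * D"
      if "x \<in> pos_orthant" for x
    proof -
      have "monomial x (real_vec k) * cmod (a * f x + b * g x)
          \<le> monomial x (real_vec k) * (cmod a * cmod (f x) + cmod b * cmod (g x))"
        by (intro mult_left_mono monomial_nonneg) (metis norm_mult norm_triangle_ineq)
      also have "\<dots> = cmod a * (monomial x (real_vec k) * cmod (f x))
          + cmod b * (monomial x (real_vec k) * cmod (g x))" by (simp add: algebra_simps)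
      also have "\<dots> \<le> cmod a * C + cmod b * D"
        using C D that by (intro add_mono mult_left_mono) auto
      finally show ?thesis .
    qed
    then show "\<exists>C. \<forall>x\<in>pos_orthant. monomial x (real_vec k) * cmod (a * f x + b * g x) \<le> C" by blast
  qed (use f g in auto)
qed

lemma has_partial_lincomb:
  assumes "has_partial l f d x" "has_partial l g e x"
  shows "has_partial l (\<lambda>x. a * f x + b * g x) (a * d + b * e) x"
  using assms unfolding has_partial_def
  by (intro has_vector_derivative_add has_vector_derivative_mult_right)

lemma has_partial_mult:
  assumes "has_partial l f d x" "has_partial l g e x"
  shows "has_partial l (\<lambda>x. f x * g x) (f x * e + d * g x) x"
  using has_vector_derivative_mult[OF assms(1)[unfolded has_partial_def] assms(2)[unfolded has_partial_def]]
  unfolding has_partial_def by simp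

lemma schwartz_lincomb:
  fixes f g :: "real ^ 'n \<Rightarrow> complex"
  assumes "f \<in> orthant_schwartz" "g \<in> orthant_schwartz"
  shows "(\<lambda>x. a * f x + b * g x) \<in> orthant_schwartz"
    and "pd l (\<lambda>x. a * f x + b * g x) = (\<lambda>x. a * pd l f x + b * pd l g x)"
proof -
  have pd: "pd l (\<lambda>x. a * f x + b * g x) = (\<lambda>x. a * pd l f x + b * pd l g x)"
    if "f \<in> orthant_schwartz" "g \<in> orthant_schwartz" for f g and l :: 'n
    by (rule pd_eqI) (use that in \<open>auto intro!: has_partial_lincomb schwartz_has_partial simp: pd_outside\<close>)
  then show "pd l (\<lambda>x. a * f x + b * g x) = (\<lambda>x. a * pd l f x + b * pd l g x)" using assms .
  show "(\<lambda>x. a * f x + b * g x) \<in> orthant_schwartz"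
  proof (rule schwartz_coinduct[where X = "{\<lambda>x. a * f x + b * g x | f g.
      f \<in> orthant_schwartz \<and> g \<in> orthant_schwartz}"])
    fix h :: "real ^ 'n \<Rightarrow> complex" and l :: 'n
    assume "h \<in> {\<lambda>x. a * f x + b * g x | f g. f \<in> orthant_schwartz \<and> g \<in> orthant_schwartz}"
    then obtain f g where h: "h = (\<lambda>x. a * f x + b * g x)" "f \<in> orthant_schwartz" "g \<in> orthant_schwartz"
      by blast
    show "rapidly_decreasing h"
      unfolding h(1) by (intro rapidly_decreasing_lincomb schwartz_rapidly_decreasing h)
    show "partial_exists l h x" if "x \<in> pos_orthant" for x
      unfolding h(1)
      by (rule has_partial_imp(1)[OF has_partial_lincomb[OF schwartz_has_partial schwartz_has_partial]])
        (use h that in auto)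
    show "pd l h \<in> {\<lambda>x. a * f x + b * g x | f g. f \<in> orthant_schwartz \<and> g \<in> orthant_schwartz}"
      unfolding h(1) pd[OF h(2,3)] using h schwartz_pd by blast
  qed (use assms in blast)
qed

lemma schwartz_simple_ops:
  fixes f g :: "real ^ 'n \<Rightarrow> complex"
  assumes "f \<in> orthant_schwartz" "g \<in> orthant_schwartz"
  shows schwartz_diff: "(\<lambda>x. f x - g x) \<in> orthant_schwartz"
    and schwartz_add: "(\<lambda>x. f x + g x) \<in> orthant_schwartz"
    and schwartz_cmult: "(\<lambda>x. a * f x) \<in> orthant_schwartz"
    and schwartz_0: "(\<lambda>x. 0 :: complex) \<in> (orthant_schwartz :: (real ^ 'n \<Rightarrow> complex) set)"
    and pd_cmult: "pd l (\<lambda>x. a * f x) = (\<lambda>x. a * pd l f x)"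
  using schwartz_lincomb[OF assms, where a = 1 and b = "-1"]
    schwartz_lincomb[OF assms, where a = 1 and b = 1]
    schwartz_lincomb[OF assms, where b = 0]
    schwartz_lincomb(1)[OF assms, where a = 0 and b = 0] by simp_all

definition xmult :: "'n \<Rightarrow> (real ^ 'n \<Rightarrow> complex) \<Rightarrow> real ^ 'n \<Rightarrow> complex" where
  "xmult l f x = of_real (x $ l) * f x"

lemma has_partial_coord:
  "has_partial m (\<lambda>x. of_real (x $ l)) (if m = l then 1 else 0) x"
proof -
  have "((\<lambda>s. complex_of_real (x $ l + s * (if m = l then 1 else 0))) has_vector_derivative
      of_real (if m = l then 1 else 0)) (at 0)"
    by (intro derivative_eq_intros | simp add: has_real_derivative_iff_has_vector_derivative[symmetric])+
  then show ?thesis unfolding has_partial_def by (auto simp: axis_def)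
qed

lemma rapidly_decreasing_xmult:
  fixes f :: "real ^ 'n \<Rightarrow> complex"
  assumes "rapidly_decreasing f"
  shows "rapidly_decreasing (xmult l f)"
proof -
  obtain f' where f: "continuous_on closed_orthant f'" "\<And>x. x \<in> pos_orthant \<Longrightarrow> f' x = f x"
    "\<And>x. x \<notin> pos_orthant \<Longrightarrow> f x = 0"
    "\<And>k::nat^'n. \<exists>C. \<forall>x\<in>pos_orthant. monomial x (real_vec k) * cmod (f x) \<le> C"
    using assms unfolding rapidly_decreasing_def by blast
  show ?thesis
  proof (rule rapidly_decreasingI[where g = "\<lambda>x. of_real (x $ l) * f' x"])
    show "continuous_on closed_orthant (\<lambda>x. of_real (x $ l) * f' x)"
      by (intro continuous_intros f)
    fix k :: "nat ^ 'n"
    have "monomial x (real_vec k) * cmod (xmult l f x) = monomial x (real_vec (k + axis l 1)) * cmod (f x)"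
      if "x \<in> pos_orthant" for x
      using pos_orthantD[OF that, of l]
      unfolding real_vec_add_axis monomial_add monomial_axis[OF that]
      by (simp add: xmult_def norm_mult)
    then show "\<exists>C. \<forall>x\<in>pos_orthant. monomial x (real_vec k) * cmod (xmult l f x) \<le> C"
      using f(4)[of "k + axis l 1"] by simp
  qed (use f in \<open>auto simp: xmult_def\<close>)
qed

lemma has_partial_xmult:
  fixes f :: "real ^ 'n \<Rightarrow> complex"
  assumes "f \<in> orthant_schwartz" "x \<in> pos_orthant"
  shows "has_partial m (xmult l f) (xmult l (pd m f) x + (if m = l then f x else 0)) x"
  using has_partial_mult[OF has_partial_coord[of m l x] schwartz_has_partial[OF assms, of m]]
  by (auto simp: xmult_def[abs_def])

lemma pd_xmult:
  fixes f :: "real ^ 'n \<Rightarrow> complex"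
  assumes "f \<in> orthant_schwartz"
  shows "pd m (xmult l f) = (\<lambda>x. xmult l (pd m f) x + (if m = l then f x else 0))"
  by (rule pd_eqI[OF has_partial_xmult[OF assms]])
    (use assms in \<open>auto simp: xmult_def pd_outside schwartz_zero\<close>)

text \<open>
  The family used in the coinduction has a second summand because the derivative of $x_l f$ contains
  $f$ itself.
\<close>
lemma schwartz_xmult:
  fixes f :: "real ^ 'n \<Rightarrow> complex"
  assumes "f \<in> orthant_schwartz"
  shows "xmult l f \<in> orthant_schwartz"
proof (rule schwartz_coinduct[where X = "{\<lambda>x. xmult l f x + g x | f g.
      f \<in> orthant_schwartz \<and> g \<in> orthant_schwartz}"])
  show "xmult l f \<in> {\<lambda>x. xmult l f x + g x | f g. f \<in> orthant_schwartz \<and> g \<in> orthant_schwartz}"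
    using assms schwartz_0[OF assms assms] by force
  fix h :: "real ^ 'n \<Rightarrow> complex" and m :: 'n
  assume "h \<in> {\<lambda>x. xmult l f x + g x | f g. f \<in> orthant_schwartz \<and> g \<in> orthant_schwartz}"
  then obtain f g where h: "h = (\<lambda>x. xmult l f x + g x)" and f: "f \<in> orthant_schwartz"
    and g: "g \<in> orthant_schwartz" by blast
  show "rapidly_decreasing h"
    using rapidly_decreasing_lincomb[OF rapidly_decreasing_xmult[of f l] schwartz_rapidly_decreasing[OF g], where a = 1 and b = 1]
      schwartz_rapidly_decreasing[OF f] by (simp add: h)
  have hp: "has_partial m h (xmult l (pd m f) x + (if m = l then f x else 0) + pd m g x) x"
    if "x \<in> pos_orthant" for x
    using has_partial_lincomb[OF has_partial_xmult[OF f that] schwartz_has_partial[OF g that], where a = 1 and b = 1]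
    by (simp add: h)
  then show "partial_exists m h x" if "x \<in> pos_orthant" for x
    using has_partial_imp(1) that by blast
  have "pd m h = (\<lambda>x. xmult l (pd m f) x + ((if m = l then f x else 0) + pd m g x))"
    by (rule pd_eqI) (use hp in \<open>auto simp: xmult_def pd_outside schwartz_zero[OF f] add.assoc\<close>)
  moreover have "(\<lambda>x. (if m = l then f x else 0) + pd m g x) \<in> orthant_schwartz"
    using schwartz_add[OF f schwartz_pd[OF g]] schwartz_pd[OF g] by (cases "m = l") auto
  ultimately show "pd m h \<in> {\<lambda>x. xmult l f x + g x | f g. f \<in> orthant_schwartz \<and> g \<in> orthant_schwartz}"
    using schwartz_pd[OF f]
    by (intro CollectI exI[of _ "pd m f"] exI[of _ "\<lambda>x. (if m = l then f x else 0) + pd m g x"]) simp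
qed

text \<open>
  For imaginary \<open>c\<close> this is the unimodular factor of the fractional powers, for negative real \<open>c\<close> a
  decaying exponential.
\<close>
definition chirp :: "complex ^ 'n \<Rightarrow> real ^ 'n \<Rightarrow> complex" where
  "chirp c x = exp (\<Sum>l\<in>UNIV. c $ l * of_real (x $ l))"

lemma has_partial_chirp: "has_partial m (chirp c) (c $ m * chirp c x) x"
proof -
  have "chirp c (x + s *\<^sub>R axis m 1) = exp (of_real s * c $ m) * chirp c x" for s
  proof -
    have "(\<Sum>l\<in>UNIV. c $ l * of_real (axis m 1 $ l)) = (\<Sum>l\<in>UNIV. if l = m then c $ m else 0)"
      by (rule sum.cong) (auto simp: axis_def)
    then have "(\<Sum>l\<in>UNIV. c $ l * of_real (axis m 1 $ l)) = c $ m" by simp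
    then have "(\<Sum>l\<in>UNIV. c $ l * of_real ((x + s *\<^sub>R axis m 1) $ l))
        = of_real s * c $ m + (\<Sum>l\<in>UNIV. c $ l * of_real (x $ l))"
      by (simp add: distrib_left sum.distrib sum_distrib_left[symmetric] mult.left_commute)
    then show ?thesis by (simp add: chirp_def exp_add)
  qed
  moreover have "((\<lambda>s. exp (of_real s * c $ m) * chirp c x) has_vector_derivative c $ m * chirp c x) (at 0)"
  proof -
    have "((\<lambda>w. exp (w * c $ m) * chirp c x) has_field_derivative c $ m * chirp c x) (at (of_real 0))"
      by (auto intro!: derivative_eq_intros)
    from has_vector_derivative_real_field[OF this] show ?thesis by simp
  qed
  ultimately show ?thesis by (simp add: has_partial_def)
qed

lemma continuous_on_chirp: "continuous_on S (chirp c)"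
  unfolding chirp_def by (intro continuous_intros)

lemma norm_chirp: "cmod (chirp c x) = exp (\<Sum>l\<in>UNIV. Re (c $ l) * x $ l)"
  by (simp add: chirp_def norm_exp_eq_Re)

lemma rapidly_decreasing_mult_bounded:
  fixes f :: "real ^ 'n \<Rightarrow> complex"
  assumes "rapidly_decreasing f" "continuous_on closed_orthant e"
    and "\<And>x. x \<in> pos_orthant \<Longrightarrow> cmod (e x) \<le> 1"
  shows "rapidly_decreasing (\<lambda>x. e x * f x)"
proof -
  obtain f' where f: "continuous_on closed_orthant f'" "\<And>x. x \<in> pos_orthant \<Longrightarrow> f' x = f x"
    "\<And>x. x \<notin> pos_orthant \<Longrightarrow> f x = 0"
    "\<And>k::nat^'n. \<exists>C. \<forall>x\<in>pos_orthant. monomial x (real_vec k) * cmod (f x) \<le> C"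
    using assms(1) unfolding rapidly_decreasing_def by blast
  show ?thesis
  proof (rule rapidly_decreasingI[where g = "\<lambda>x. e x * f' x"])
    show "continuous_on closed_orthant (\<lambda>x. e x * f' x)"
      by (intro continuous_intros f assms)
    fix k :: "nat ^ 'n"
    have "monomial x (real_vec k) * cmod (e x * f x) \<le> monomial x (real_vec k) * cmod (f x)"
      if "x \<in> pos_orthant" for x
      using mult_right_mono[OF assms(3)[OF that], of "cmod (f x)"]
      by (intro mult_left_mono monomial_nonneg) (simp add: norm_mult)
    then show "\<exists>C. \<forall>x\<in>pos_orthant. monomial x (real_vec k) * cmod (e x * f x) \<le> C"
      using f(4)[of k] by (meson order_trans)
  qed (use f in auto)
qed

lemma has_partial_chirp_mult:
  fixes f :: "real ^ 'n \<Rightarrow> complex"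
  assumes "f \<in> orthant_schwartz" "x \<in> pos_orthant"
  shows "has_partial m (\<lambda>x. chirp c x * f x) (chirp c x * (pd m f x + c $ m * f x)) x"
  using has_partial_mult[OF has_partial_chirp[of m c x] schwartz_has_partial[OF assms, of m]]
  by (simp add: algebra_simps)

lemma pd_chirp_mult:
  fixes f :: "real ^ 'n \<Rightarrow> complex"
  assumes "f \<in> orthant_schwartz"
  shows "pd m (\<lambda>x. chirp c x * f x) = (\<lambda>x. chirp c x * (pd m f x + c $ m * f x))"
  by (rule pd_eqI) (use assms in \<open>auto intro!: has_partial_chirp_mult simp: pd_outside schwartz_zero\<close>)

lemma schwartz_chirp_mult:
  fixes f :: "real ^ 'n \<Rightarrow> complex"
  assumes "f \<in> orthant_schwartz" "\<And>l. Re (c $ l) = 0"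
  shows "(\<lambda>x. chirp c x * f x) \<in> orthant_schwartz"
proof (rule schwartz_coinduct[where X = "{\<lambda>x. chirp c x * f x | f. f \<in> orthant_schwartz}"])
  fix h :: "real ^ 'n \<Rightarrow> complex" and m :: 'n
  assume "h \<in> {\<lambda>x. chirp c x * f x | f. f \<in> orthant_schwartz}"
  then obtain f where h: "h = (\<lambda>x. chirp c x * f x)" and f: "f \<in> orthant_schwartz" by blast
  show "rapidly_decreasing h"
    unfolding h by (intro rapidly_decreasing_mult_bounded schwartz_rapidly_decreasing f continuous_on_chirp)
      (simp add: norm_chirp assms)
  show "partial_exists m h x" if "x \<in> pos_orthant" for x
    unfolding h by (rule has_partial_imp(1)[OF has_partial_chirp_mult[OF f that]])
  show "pd m h \<in> {\<lambda>x. chirp c x * f x | f. f \<in> orthant_schwartz}"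
    unfolding h pd_chirp_mult[OF f]
    using schwartz_add[OF schwartz_pd[OF f] schwartz_cmult[OF f f], of m "c $ m"]
    by (intro CollectI exI[of _ "\<lambda>x. pd m f x + c $ m * f x"] conjI refl)
qed (use assms in blast)

definition expo :: "real ^ 'n \<Rightarrow> real ^ 'n \<Rightarrow> complex" where
  "expo b = orthant_part (chirp (\<chi> l. - of_real (b $ l)))"

lemma expo_apply: "x \<in> pos_orthant \<Longrightarrow> expo b x = of_real (\<Prod>l\<in>UNIV. exp (- (b $ l * x $ l)))"
  by (simp add: expo_def orthant_part_def chirp_def exp_sum exp_of_real[symmetric])

lemma expo_outside: "x \<notin> pos_orthant \<Longrightarrow> expo b x = 0"
  by (simp add: expo_def orthant_part_def)

lemma norm_expo: "cmod (expo b x) = (if x \<in> pos_orthant then (\<Prod>l\<in>UNIV. exp (- (b $ l * x $ l))) else 0)"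
  by (simp add: expo_apply expo_outside prod_nonneg del: of_real_prod)

lemma has_partial_expo:
  assumes "x \<in> pos_orthant"
  shows "has_partial m (expo b) (- of_real (b $ m) * expo b x) x"
  using has_partial_cong[OF has_partial_chirp[of m "\<chi> l. - of_real (b $ l)" x] assms, of "expo b"] assms
  by (simp add: expo_def orthant_part_def)

lemma pd_expo:
  fixes b :: "real ^ 'n"
  shows "pd m (\<lambda>x. a * expo b x) = (\<lambda>x. - a * of_real (b $ m) * expo b x)"
proof (rule pd_eqI)
  fix x :: "real ^ 'n" assume "x \<in> pos_orthant"
  then show "has_partial m (\<lambda>x. a * expo b x) (- a * of_real (b $ m) * expo b x) x"
    using has_partial_lincomb[OF has_partial_expo[of x m b] has_partial_expo[of x m b], where a = a and b = 0]
    by (simp add: mult.assoc)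
qed (simp add: expo_outside)

lemma power_exp_le: "x ^ k * exp (- (b * x)) \<le> fact k / b ^ k" if "0 < b" "0 < x" for b x :: real
proof -
  have "(b * x) ^ k / fact k \<le> exp (b * x)"
  proof -
    have "(\<Sum>n\<in>{k}. (b * x) ^ n / fact n) \<le> (\<Sum>n. (b * x) ^ n / fact n)"
      by (rule sum_le_suminf) (use that in \<open>auto intro: summable_exp_generic[of "b * x"] simp: divide_inverse summable_exp mult.commute\<close>)
    then show ?thesis by (simp add: exp_def divide_inverse mult.commute)
  qed
  then have "x ^ k * b ^ k \<le> fact k * exp (b * x)"
    by (simp add: power_mult_distrib divide_simps mult_ac)
  then show ?thesis using that by (simp add: exp_minus field_simps)
qed

lemma schwartz_expo_aux:
  fixes b :: "real ^ 'n"
  assumes b: "\<And>l. 0 < b $ l"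
  shows "(\<lambda>x. a * expo b x) \<in> orthant_schwartz"
proof (rule schwartz_coinduct[where X = "range (\<lambda>a x. a * expo b x)"])
  fix h :: "real ^ 'n \<Rightarrow> complex" and m :: 'n
  assume "h \<in> range (\<lambda>a x. a * expo b x)"
  then obtain a where h: "h = (\<lambda>x. a * expo b x)" by blast
  have "rapidly_decreasing (expo b)"
  proof (rule rapidly_decreasingI[where g = "chirp (\<chi> l. - of_real (b $ l))"])
    fix k :: "nat ^ 'n"
    have "monomial x (real_vec k) * cmod (expo b x) \<le> (\<Prod>l\<in>UNIV. fact (k $ l) / b $ l ^ (k $ l))"
      if "x \<in> pos_orthant" for x
    proof -
      have "monomial x (real_vec k) * cmod (expo b x) = (\<Prod>l\<in>UNIV. x $ l ^ (k $ l) * exp (- (b $ l * x $ l)))"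
        using that by (simp add: norm_expo monomial_def prod.distrib powr_realpow pos_orthantD)
      also have "\<dots> \<le> (\<Prod>l\<in>UNIV. fact (k $ l) / b $ l ^ (k $ l))"
        by (intro prod_mono conjI power_exp_le b pos_orthantD[OF that] mult_nonneg_nonneg)
          (use pos_orthantD[OF that] in \<open>auto intro: less_imp_le\<close>)
      finally show ?thesis .
    qed
    then show "\<exists>C. \<forall>x\<in>pos_orthant. monomial x (real_vec k) * cmod (expo b x) \<le> C" by blast
  qed (auto simp: continuous_on_chirp expo_def orthant_part_def)
  then show "rapidly_decreasing h"
    using rapidly_decreasing_lincomb[of "expo b" "expo b", where a = a and b = 0] by (simp add: h)
  show "partial_exists m h x" if "x \<in> pos_orthant" for x
    using has_partial_imp(1)[OF has_partial_lincomb[OF has_partial_expo[OF that] has_partial_expo[OF that], where a = a and b = 0]]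
    by (simp add: h)
  show "pd m h \<in> range (\<lambda>a x. a * expo b x)"
    unfolding h pd_expo by (rule range_eqI[of _ _ "- a * of_real (b $ m)"]) simp
qed blast

lemma schwartz_expo: "(\<And>l. 0 < b $ l) \<Longrightarrow> expo b \<in> orthant_schwartz"
  using schwartz_expo_aux[of b 1] by simp

lemma seminorm_le_iff:
  fixes f :: "real ^ 'n \<Rightarrow> complex"
  assumes "f \<in> orthant_schwartz"
  shows "schwartz_seminorm k p f \<le> C \<longleftrightarrow>
    (\<forall>x\<in>pos_orthant. monomial x (real_vec k) * cmod (Dp p f x) \<le> C)"
proof -
  have "(1 :: real ^ 'n) \<in> pos_orthant" by (simp add: pos_orthant_def)
  then have "pos_orthant \<noteq> ({} :: (real ^ 'n) set)" by blast
  moreover have "bdd_above ((\<lambda>x. monomial x (real_vec k) * cmod (Dp p f x)) ` pos_orthant)"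
    using assms by (simp add: orthant_schwartz_def)
  ultimately show ?thesis
    unfolding schwartz_seminorm_def by (rule cSUP_le_iff)
qed

lemma seminorm_upper:
  assumes "f \<in> orthant_schwartz" "x \<in> pos_orthant"
  shows "monomial x (real_vec k) * cmod (Dp p f x) \<le> schwartz_seminorm k p f"
  using seminorm_le_iff[OF assms(1)] assms(2) by blast

lemma seminorm_nonneg:
  fixes f :: "real ^ 'n \<Rightarrow> complex"
  assumes "f \<in> orthant_schwartz"
  shows "0 \<le> schwartz_seminorm k p f"
proof -
  have "(1 :: real ^ 'n) \<in> pos_orthant" by (simp add: pos_orthant_def)
  from seminorm_upper[OF assms this, of k p]
  show ?thesis by (meson monomial_nonneg mult_nonneg_nonneg norm_ge_zero order_trans)
qed

lemma seminorm_add_axis: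
  assumes "f \<in> orthant_schwartz"
  shows "schwartz_seminorm k (p + axis l 1) f = schwartz_seminorm k p (pd l f)"
  unfolding schwartz_seminorm_def
  by (rule SUP_cong) (simp_all add: Dp_add_axis[OF assms] del: One_nat_def)

lemma Dp_lincomb:
  fixes f g :: "real ^ 'n \<Rightarrow> complex"
  assumes "f \<in> orthant_schwartz" "g \<in> orthant_schwartz" "x \<in> pos_orthant"
  shows "Dp p (\<lambda>x. a * f x + b * g x) x = a * Dp p f x + b * Dp p g x"
  using assms(1,2)
proof (induction p arbitrary: f g rule: multiindex_induct)
  case zero
  then show ?case by (simp add: Dp_zero)
next
  case (add p l)
  then show ?case
    using Dp_add_axis[OF schwartz_lincomb(1)[OF add.prems] assms(3)] add.IH[OF schwartz_pd schwartz_pd]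
    by (simp add: Dp_add_axis assms(3) schwartz_lincomb(2) del: One_nat_def)
qed

lemma seminorm_lincomb_le:
  fixes f g :: "real ^ 'n \<Rightarrow> complex"
  assumes "f \<in> orthant_schwartz" "g \<in> orthant_schwartz"
  shows "schwartz_seminorm k p (\<lambda>x. a * f x + b * g x)
    \<le> cmod a * schwartz_seminorm k p f + cmod b * schwartz_seminorm k p g"
  unfolding seminorm_le_iff[OF schwartz_lincomb(1)[OF assms]]
proof
  fix x :: "real ^ 'n" assume x: "x \<in> pos_orthant"
  have "monomial x (real_vec k) * cmod (Dp p (\<lambda>x. a * f x + b * g x) x)
      \<le> monomial x (real_vec k) * (cmod a * cmod (Dp p f x) + cmod b * cmod (Dp p g x))"
    unfolding Dp_lincomb[OF assms x]
    by (intro mult_left_mono monomial_nonneg) (metis norm_mult norm_triangle_ineq)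
  also have "\<dots> = cmod a * (monomial x (real_vec k) * cmod (Dp p f x))
      + cmod b * (monomial x (real_vec k) * cmod (Dp p g x))" by (simp add: algebra_simps)
  also have "\<dots> \<le> cmod a * schwartz_seminorm k p f + cmod b * schwartz_seminorm k p g"
    by (intro add_mono mult_left_mono seminorm_upper assms x) auto
  finally show "monomial x (real_vec k) * cmod (Dp p (\<lambda>x. a * f x + b * g x) x)
    \<le> cmod a * schwartz_seminorm k p f + cmod b * schwartz_seminorm k p g" .
qed

text \<open>
  For a seminorm \<open>q\<close> this is continuity: the topology is generated by the seminorms
  \<open>schwartz_seminorm k p\<close>.
\<close>
definition seminorm_bounded :: "((real ^ 'n \<Rightarrow> complex) \<Rightarrow> real) \<Rightarrow> bool" where
  "seminorm_bounded q \<longleftrightarrow> (\<exists>F C. finite F \<and> 0 \<le> C \<and>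
     (\<forall>f\<in>orthant_schwartz. q f \<le> C * (\<Sum>(k, p)\<in>F. schwartz_seminorm k p f)))"

lemma seminorm_bounded_mono:
  assumes "seminorm_bounded q" "\<And>f. f \<in> orthant_schwartz \<Longrightarrow> q' f \<le> q f"
  shows "seminorm_bounded q'"
  using assms unfolding seminorm_bounded_def by (meson order_trans)

lemma seminorm_bounded_seminorm: "seminorm_bounded (schwartz_seminorm k p)"
  unfolding seminorm_bounded_def
  by (rule exI[of _ "{(k, p)}"], rule exI[of _ 1]) auto

lemma seminorm_bounded_add:
  fixes q1 q2 :: "(real ^ 'n \<Rightarrow> complex) \<Rightarrow> real"
  assumes "seminorm_bounded q1" "seminorm_bounded q2"
  shows "seminorm_bounded (\<lambda>f. q1 f + q2 f)"
proof -
  define S where "S F f = (\<Sum>(k, p)\<in>F. schwartz_seminorm k p f)"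
    for F and f :: "real ^ 'n \<Rightarrow> complex"
  obtain F1 C1 where 1: "finite F1" "0 \<le> C1" "\<And>f. f \<in> orthant_schwartz \<Longrightarrow> q1 f \<le> C1 * S F1 f"
    using assms(1) unfolding seminorm_bounded_def S_def by blast
  obtain F2 C2 where 2: "finite F2" "0 \<le> C2" "\<And>f. f \<in> orthant_schwartz \<Longrightarrow> q2 f \<le> C2 * S F2 f"
    using assms(2) unfolding seminorm_bounded_def S_def by blast
  have mono: "S F f \<le> S (F1 \<union> F2) f" if "F \<subseteq> F1 \<union> F2" "f \<in> orthant_schwartz" for F f
    unfolding S_def by (rule sum_mono2) (use that 1 2 in \<open>auto intro: seminorm_nonneg\<close>)
  have "q1 f + q2 f \<le> (C1 + C2) * S (F1 \<union> F2) f" if f: "f \<in> orthant_schwartz" for f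
  proof -
    have "C1 * S F1 f \<le> C1 * S (F1 \<union> F2) f" "C2 * S F2 f \<le> C2 * S (F1 \<union> F2) f"
      using 1 2 mono[OF _ f] by (auto intro!: mult_left_mono)
    then show ?thesis using 1(3)[OF f] 2(3)[OF f] by (simp add: algebra_simps)
  qed
  then show ?thesis
    unfolding seminorm_bounded_def S_def using 1 2
    by (intro exI[of _ "F1 \<union> F2"] exI[of _ "C1 + C2"]) auto
qed

lemma seminorm_bounded_cmult:
  assumes "seminorm_bounded q" "0 \<le> c"
  shows "seminorm_bounded (\<lambda>f. c * q f)"
proof -
  obtain F C where 1: "finite F" "0 \<le> C"
    "\<And>f. f \<in> orthant_schwartz \<Longrightarrow> q f \<le> C * (\<Sum>(k, p)\<in>F. schwartz_seminorm k p f)"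
    using assms(1) unfolding seminorm_bounded_def by blast
  have "c * q f \<le> (c * C) * (\<Sum>(k, p)\<in>F. schwartz_seminorm k p f)" if "f \<in> orthant_schwartz" for f
    using mult_left_mono[OF 1(3)[OF that] assms(2)] by (simp add: mult.assoc)
  then show ?thesis
    unfolding seminorm_bounded_def using 1 assms(2) by (intro exI[of _ F] exI[of _ "c * C"]) auto
qed

lemma seminorm_bounded_0: "seminorm_bounded (\<lambda>f. 0)"
  using seminorm_bounded_cmult[OF seminorm_bounded_seminorm, of 0] by simp

lemma seminorm_bounded_sum:
  assumes "finite A" "\<And>a. a \<in> A \<Longrightarrow> seminorm_bounded (q a)"
  shows "seminorm_bounded (\<lambda>f. \<Sum>a\<in>A. q a f)"
  using assms by (induction A rule: finite_induct) (auto intro: seminorm_bounded_0 seminorm_bounded_add)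

definition continuous_op :: "((real ^ 'n \<Rightarrow> complex) \<Rightarrow> real ^ 'n \<Rightarrow> complex) \<Rightarrow> bool" where
  "continuous_op T \<longleftrightarrow> (\<forall>f\<in>orthant_schwartz. T f \<in> orthant_schwartz) \<and>
     (\<forall>k p. seminorm_bounded (\<lambda>f. schwartz_seminorm k p (T f)))"

lemma seminorm_bounded_compose:
  fixes T :: "(real ^ 'n \<Rightarrow> complex) \<Rightarrow> real ^ 'n \<Rightarrow> complex"
  assumes q: "seminorm_bounded q" and T: "continuous_op T"
  shows "seminorm_bounded (\<lambda>f. q (T f))"
proof -
  obtain F C where 1: "finite F" "0 \<le> C"
    "\<And>f. f \<in> orthant_schwartz \<Longrightarrow> q f \<le> C * (\<Sum>(k, p)\<in>F. schwartz_seminorm k p f)"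
    using q unfolding seminorm_bounded_def by blast
  have "seminorm_bounded (\<lambda>f. C * (\<Sum>a\<in>F. case a of (k, p) \<Rightarrow> schwartz_seminorm k p (T f)))"
    using T 1 unfolding continuous_op_def
    by (intro seminorm_bounded_cmult seminorm_bounded_sum) (auto split: prod.splits)
  then show ?thesis
    by (rule seminorm_bounded_mono) (use T 1(3) in \<open>auto simp: continuous_op_def\<close>)
qed

lemma continuous_op_compose:
  assumes "continuous_op S" "continuous_op T"
  shows "continuous_op (\<lambda>f. S (T f))"
  unfolding continuous_op_def
  using assms seminorm_bounded_compose[OF _ assms(2), of "\<lambda>f. schwartz_seminorm _ _ (S f)"]
  by (auto simp: continuous_op_def)

lemma continuous_op_lincomb:
  fixes S T :: "(real ^ 'n \<Rightarrow> complex) \<Rightarrow> real ^ 'n \<Rightarrow> complex"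
  assumes "continuous_op S" "continuous_op T"
  shows "continuous_op (\<lambda>f x. a * S f x + b * T f x)"
  unfolding continuous_op_def
proof (intro conjI ballI allI)
  show "(\<lambda>x. a * S f x + b * T f x) \<in> orthant_schwartz" if "f \<in> orthant_schwartz" for f
    using assms that by (intro schwartz_lincomb(1)) (auto simp: continuous_op_def)
  fix k p
  have "seminorm_bounded (\<lambda>f. cmod a * schwartz_seminorm k p (S f) + cmod b * schwartz_seminorm k p (T f))"
    using assms by (intro seminorm_bounded_add seminorm_bounded_cmult) (auto simp: continuous_op_def)
  then show "seminorm_bounded (\<lambda>f. schwartz_seminorm k p (\<lambda>x. a * S f x + b * T f x))"
    by (rule seminorm_bounded_mono, intro seminorm_lincomb_le)
      (use assms in \<open>auto simp: continuous_op_def\<close>)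
qed

lemma continuous_op_id: "continuous_op (\<lambda>f. f)"
  by (auto simp: continuous_op_def intro: seminorm_bounded_seminorm)

lemma continuous_op_cmult: "continuous_op T \<Longrightarrow> continuous_op (\<lambda>f x. a * T f x)"
  using continuous_op_lincomb[of T T a 0] by simp

lemma continuous_op_add:
  "continuous_op S \<Longrightarrow> continuous_op T \<Longrightarrow> continuous_op (\<lambda>f x. S f x + T f x)"
  using continuous_op_lincomb[of S T 1 1] by simp

lemma continuous_op_0: "continuous_op (\<lambda>f x. 0)"
  using continuous_op_lincomb[OF continuous_op_id continuous_op_id, of 0 0] by simp

lemma continuous_op_pd: "continuous_op (pd l)"
  unfolding continuous_op_def
proof (intro conjI allI ballI)
  show "seminorm_bounded (\<lambda>f. schwartz_seminorm k p (pd l f))" for k p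
    by (rule seminorm_bounded_mono[OF seminorm_bounded_seminorm[of k "p + axis l 1"]])
      (simp add: seminorm_add_axis del: One_nat_def)
qed (rule schwartz_pd)

text \<open>
  The counterpart of \<open>schwartz_coinduct\<close> for estimates.  If the first derivatives of the operators in a
  family are again expressed by operators of the family, induction on the multi-index removes the
  derivatives from all seminorms to be estimated.
\<close>
lemma continuous_op_family:
  fixes T :: "(real ^ 'n \<Rightarrow> complex) \<Rightarrow> real ^ 'n \<Rightarrow> complex"
  assumes "T \<in> \<T>"
    and maps: "\<And>T f. T \<in> \<T> \<Longrightarrow> f \<in> orthant_schwartz \<Longrightarrow> T f \<in> orthant_schwartz"
    and base: "\<And>T k. T \<in> \<T> \<Longrightarrow> seminorm_bounded (\<lambda>f. schwartz_seminorm k 0 (T f))"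
    and step: "\<And>T l. T \<in> \<T> \<Longrightarrow> \<exists>T'\<in>\<T>. \<exists>A B. continuous_op A \<and> continuous_op B \<and>
       (\<forall>f\<in>orthant_schwartz. pd l (T f) = (\<lambda>x. T' (A f) x + B f x))"
  shows "continuous_op T"
  unfolding continuous_op_def
proof (intro conjI allI ballI)
  show "seminorm_bounded (\<lambda>f. schwartz_seminorm k p (T f))" for k p
    using assms(1)
  proof (induction p arbitrary: T rule: multiindex_induct)
    case zero
    then show ?case by (rule base)
  next
    case (add p l)
    obtain T' A B where *: "T' \<in> \<T>" "continuous_op A" "continuous_op B"
       "\<forall>f\<in>orthant_schwartz. pd l (T f) = (\<lambda>x. T' (A f) x + B f x)"
      using step[OF add.prems] by blast
    have "seminorm_bounded (\<lambda>f. schwartz_seminorm k p (T' (A f)) + schwartz_seminorm k p (B f))"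
      using seminorm_bounded_compose[OF add.IH[OF *(1)] *(2)] *(3)
      by (intro seminorm_bounded_add) (auto simp: continuous_op_def)
    then show ?case
    proof (rule seminorm_bounded_mono)
      fix f :: "real ^ 'n \<Rightarrow> complex" assume f: "f \<in> orthant_schwartz"
      have S: "T' (A f) \<in> orthant_schwartz" "B f \<in> orthant_schwartz"
        using f * maps by (auto simp: continuous_op_def)
      show "schwartz_seminorm k (p + axis l 1) (T f)
          \<le> schwartz_seminorm k p (T' (A f)) + schwartz_seminorm k p (B f)"
        using seminorm_lincomb_le[OF S, of k p 1 1] f *(4)
        by (simp add: seminorm_add_axis[OF maps[OF add.prems f]] del: One_nat_def)
    qed
  qed
qed (rule maps[OF assms(1)])

lemma continuous_op_xmult: "continuous_op (xmult l :: (real ^ 'n \<Rightarrow> complex) \<Rightarrow> _)"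
proof (rule continuous_op_family[where \<T> = "{xmult l}"])
  fix T :: "(real ^ 'n \<Rightarrow> complex) \<Rightarrow> real ^ 'n \<Rightarrow> complex" and k :: "nat ^ 'n" and m
  assume T: "T \<in> {xmult l}"
  show "seminorm_bounded (\<lambda>f. schwartz_seminorm k 0 (T f))"
  proof (rule seminorm_bounded_mono[OF seminorm_bounded_seminorm[of "k + axis l 1" 0]])
    fix f :: "real ^ 'n \<Rightarrow> complex" assume f: "f \<in> orthant_schwartz"
    show "schwartz_seminorm k 0 (T f) \<le> schwartz_seminorm (k + axis l 1) 0 f"
      unfolding schwartz_seminorm_def real_vec_add_axis monomial_add
    proof (rule eq_refl[OF SUP_cong[OF refl]])
      fix x :: "real ^ 'n" assume x: "x \<in> pos_orthant"
      show "monomial x (real_vec k) * cmod (Dp 0 (T f) x)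
          = monomial x (real_vec k) * monomial x (axis l 1) * cmod (Dp 0 f x)"
        using T pos_orthantD[OF x, of l] unfolding Dp_zero monomial_axis[OF x]
        by (simp add: xmult_def norm_mult)
    qed
  qed
  show "\<exists>T'\<in>{xmult l}. \<exists>A B. continuous_op A \<and> continuous_op B \<and>
       (\<forall>f\<in>orthant_schwartz. pd m (T f) = (\<lambda>x. T' (A f) x + B f x))"
    using T continuous_op_pd[of m] continuous_op_0 continuous_op_id
    by (rule_tac bexI[of _ "xmult l"], rule_tac exI[of _ "pd m"],
        rule_tac exI[of _ "\<lambda>f x. if m = l then f x else 0"])
      (cases "m = l"; auto simp: pd_xmult)+
qed (auto intro: schwartz_xmult)

lemma continuous_op_chirp:
  fixes c :: "complex ^ 'n"
  assumes "\<And>l. Re (c $ l) = 0"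
  shows "continuous_op (\<lambda>f x. chirp c x * f x)"
proof (rule continuous_op_family[where \<T> = "{\<lambda>f x. chirp c x * f x}"])
  fix T :: "(real ^ 'n \<Rightarrow> complex) \<Rightarrow> real ^ 'n \<Rightarrow> complex" and k :: "nat ^ 'n" and m
  assume T: "T \<in> {\<lambda>f x. chirp c x * f x}"
  show "seminorm_bounded (\<lambda>f. schwartz_seminorm k 0 (T f))"
    by (rule seminorm_bounded_mono[OF seminorm_bounded_seminorm[of k 0]])
      (use T in \<open>simp add: schwartz_seminorm_def Dp_zero norm_mult norm_chirp assms\<close>)
  show "\<exists>T'\<in>{\<lambda>f x. chirp c x * f x}. \<exists>A B. continuous_op A \<and> continuous_op B \<and>
       (\<forall>f\<in>orthant_schwartz. pd m (T f) = (\<lambda>x. T' (A f) x + B f x))"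
    using T continuous_op_add[OF continuous_op_pd[of m] continuous_op_cmult[OF continuous_op_id, of "c $ m"]]
      continuous_op_0
    by (rule_tac bexI[of _ "\<lambda>f x. chirp c x * f x"],
        rule_tac exI[of _ "\<lambda>f x. pd m f x + c $ m * f x"], rule_tac exI[of _ "\<lambda>f x. 0"])
      (auto simp: pd_chirp_mult)
qed (use assms in \<open>auto intro: schwartz_chirp_mult\<close>)

lemma topspace_schwartz:
  "topspace schwartz_topology = (orthant_schwartz :: (real ^ 'n \<Rightarrow> complex) set)"
proof -
  have "f \<in> schwartz_ball 0 0 f 1" if "f \<in> orthant_schwartz" for f :: "real ^ 'n \<Rightarrow> complex"
  proof -
    have "schwartz_seminorm 0 0 (\<lambda>x. f x - f x) \<le> 0"
      using seminorm_le_iff[OF schwartz_0[OF that that], of 0 0 0] by (simp add: Dp_zero)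
    then show ?thesis using that by (simp add: schwartz_ball_def)
  qed
  then have "orthant_schwartz \<subseteq> \<Union> {schwartz_ball k p f e |k p (f :: real ^ 'n \<Rightarrow> complex) e.
      f \<in> orthant_schwartz \<and> 0 < e}"
    using zero_less_one by blast
  then show ?thesis
    unfolding schwartz_topology_def topology_generated_by_topspace
    by (auto simp: schwartz_ball_def)
qed

lemma openin_schwartz_ball:
  "f \<in> orthant_schwartz \<Longrightarrow> 0 < e \<Longrightarrow> openin schwartz_topology (schwartz_ball k p f e)"
  unfolding schwartz_topology_def by (rule topology_generated_by_Basis) blast

text \<open>
  Balls of a single seminorm form only a subbase.  A neighbourhood of \<open>g\<close> inside the preimage of a
  ball is the intersection of balls for the finitely many seminorms in the estimate of \<open>T\<close>.
\<close>
lemma continuous_op_imp_continuous_map: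
  fixes T :: "(real ^ 'n \<Rightarrow> complex) \<Rightarrow> real ^ 'n \<Rightarrow> complex"
  assumes T: "continuous_op T" and lin: "linear_on_functions orthant_schwartz T"
  shows "continuous_map schwartz_topology schwartz_topology T"
proof -
  have maps: "T f \<in> orthant_schwartz" if "f \<in> orthant_schwartz" for f
    using T that by (simp add: continuous_op_def)
  have diff: "T (\<lambda>x. f x - g x) = (\<lambda>x. T f x - T g x)"
    if "f \<in> orthant_schwartz" "g \<in> orthant_schwartz" for f g
    using lin[unfolded linear_on_functions_def, rule_format, OF that, of 1 "-1"] by simp
  have pre: "openin schwartz_topology (T -` schwartz_ball k p h e \<inter> orthant_schwartz)"
    if h: "h \<in> orthant_schwartz" for k p h e
  proof (subst openin_subopen, safe)
    fix g assume g: "g \<in> orthant_schwartz" "T g \<in> schwartz_ball k p h e"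
    obtain F C where F: "finite F" "0 \<le> C"
      "\<And>f. f \<in> orthant_schwartz \<Longrightarrow> schwartz_seminorm k p (T f) \<le> C * (\<Sum>(k, p)\<in>F. schwartz_seminorm k p f)"
      using T unfolding continuous_op_def seminorm_bounded_def by meson
    define d where "d = e - schwartz_seminorm k p (\<lambda>x. T g x - h x)"
    have d: "0 < d" using g by (simp add: d_def schwartz_ball_def)
    define \<eta> where "\<eta> = d / (C * card F + 1)"
    have D: "0 < C * card F + 1" using F(2) by (simp add: add_nonneg_pos)
    have \<eta>: "0 < \<eta>" using d D by (simp add: \<eta>_def)
    \<comment> \<open>the pair \<open>(0, 0)\<close> makes this a set of Schwartz functions even if \<open>F\<close> is empty\<close>
    define V where "V = (\<Inter>(k, p)\<in>insert (0, 0) F. schwartz_ball k p g \<eta>)"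
    have zero: "schwartz_seminorm k p (\<lambda>x. g x - g x) < \<eta>" for k p
      using seminorm_lincomb_le[OF g(1) g(1), of k p 0 0] \<eta> by simp
    have "openin schwartz_topology V"
      unfolding V_def using F(1)
      by (intro openin_Inter) (auto intro!: openin_schwartz_ball g \<eta>)
    moreover have "g \<in> V"
      using zero g(1) by (auto simp: V_def schwartz_ball_def)
    moreover have "V \<subseteq> T -` schwartz_ball k p h e \<inter> orthant_schwartz"
    proof
      fix f assume f: "f \<in> V"
      then have fS: "f \<in> orthant_schwartz" by (auto simp: V_def schwartz_ball_def)
      have small: "schwartz_seminorm k p (\<lambda>x. f x - g x) \<le> \<eta>" if "(k, p) \<in> F" for k p
        using f that by (auto simp: V_def schwartz_ball_def intro: less_imp_le)
      have "schwartz_seminorm k p (T (\<lambda>x. f x - g x)) \<le> C * (\<Sum>(k, p)\<in>F. schwartz_seminorm k p (\<lambda>x. f x - g x))"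
        by (rule F(3)) (rule schwartz_diff[OF fS g(1)])
      also have "\<dots> \<le> C * (\<Sum>(k, p)\<in>F. \<eta>)"
        using small by (intro mult_left_mono sum_mono F(2)) auto
      also have "\<dots> = (C * card F) * \<eta>" by simp
      also have "\<dots> < (C * card F + 1) * \<eta>" using \<eta> by (simp add: algebra_simps)
      also have "\<dots> = d" using D by (simp add: \<eta>_def)
      finally have small': "schwartz_seminorm k p (\<lambda>x. T f x - T g x) < d"
        unfolding diff[OF fS g(1)] .
      have "schwartz_seminorm k p (\<lambda>x. 1 * (T f x - T g x) + 1 * (T g x - h x))
          \<le> cmod 1 * schwartz_seminorm k p (\<lambda>x. T f x - T g x) + cmod 1 * schwartz_seminorm k p (\<lambda>x. T g x - h x)"
        by (intro seminorm_lincomb_le schwartz_diff maps fS g(1) h)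
      then have "schwartz_seminorm k p (\<lambda>x. T f x - h x) < e"
        using small' by (simp add: d_def)
      then show "f \<in> T -` schwartz_ball k p h e \<inter> orthant_schwartz"
        using maps[OF fS] fS by (simp add: schwartz_ball_def)
    qed
    ultimately show "\<exists>V. openin schwartz_topology V \<and> g \<in> V \<and> V \<subseteq> T -` schwartz_ball k p h e \<inter> orthant_schwartz"
      by blast
  qed
  show ?thesis
    unfolding schwartz_topology_def
  proof (rule continuous_on_generated_topo, fold schwartz_topology_def)
    fix U :: "(real ^ 'n \<Rightarrow> complex) set"
    assume "U \<in> {schwartz_ball k p f e |k p f e. f \<in> orthant_schwartz \<and> 0 < e}"
    then show "openin schwartz_topology (T -` U \<inter> topspace schwartz_topology)"
      using pre unfolding topspace_schwartz by blast
  next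
    have "\<Union> {schwartz_ball k p (f :: real ^ 'n \<Rightarrow> complex) e |k p f e. f \<in> orthant_schwartz \<and> 0 < e} = topspace schwartz_topology"
      unfolding schwartz_topology_def by simp
    then show "T ` topspace schwartz_topology \<subseteq> \<Union> {schwartz_ball k p f e |k p f e. f \<in> orthant_schwartz \<and> 0 < e}"
      using maps unfolding topspace_schwartz by auto
  qed
qed

section \<open>Integration over the orthant\<close>

lemma has_vector_derivative_quotient:
  fixes f :: "real \<Rightarrow> 'a::real_normed_vector"
  shows "(f has_vector_derivative d) (at x) \<longleftrightarrow> ((\<lambda>h. (f (x + h) - f x) /\<^sub>R h) \<longlongrightarrow> d) (at 0)"
proof -
  have "(f has_vector_derivative d) (at x) \<longleftrightarrow>
      ((\<lambda>h. norm (f (x + h) - f x - h *\<^sub>R d) / norm h) \<longlongrightarrow> 0) (at 0)"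
    unfolding has_vector_derivative_def has_derivative_at by (simp add: bounded_linear_scaleR_left)
  also have "\<dots> \<longleftrightarrow> ((\<lambda>h. norm ((f (x + h) - f x) /\<^sub>R h - d)) \<longlongrightarrow> 0) (at 0)"
  proof (rule filterlim_cong[OF refl refl])
    have "norm (f (x + h) - f x - h *\<^sub>R d) / norm h = norm ((f (x + h) - f x) /\<^sub>R h - d)"
      if "h \<noteq> 0" for h
    proof -
      have "(f (x + h) - f x) /\<^sub>R h - d = (f (x + h) - f x - h *\<^sub>R d) /\<^sub>R h"
        using that by (simp add: scaleR_diff_right)
      then show ?thesis by (simp add: divide_inverse mult.commute)
    qed
    then show "\<forall>\<^sub>F h in at 0. norm (f (x + h) - f x - h *\<^sub>R d) / norm h = norm ((f (x + h) - f x) /\<^sub>R h - d)"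
      by (auto simp: eventually_at_filter)
  qed
  also have "\<dots> \<longleftrightarrow> ((\<lambda>h. (f (x + h) - f x) /\<^sub>R h) \<longlongrightarrow> d) (at 0)"
    by (simp add: tendsto_norm_zero_iff LIM_zero_iff)
  finally show ?thesis .
qed

lemma integral_translation:
  fixes f :: "'a::euclidean_space \<Rightarrow> complex"
  assumes "integrable lborel f"
  shows "integrable lborel (\<lambda>x. f (c + x))" "(LINT x|lborel. f (c + x)) = integral\<^sup>L lborel f"
proof -
  have [measurable]: "f \<in> borel_measurable borel" using assms by simp
  have "integrable (distr lborel borel ((+) c)) f" using assms by (simp add: lborel_distr_plus)
  then show "integrable lborel (\<lambda>x. f (c + x))" by (subst (asm) integrable_distr_eq) auto
  have "integral\<^sup>L (distr lborel borel ((+) c)) f = (LINT x|lborel. f (c + x))"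
    by (rule integral_distr) auto
  then show "(LINT x|lborel. f (c + x)) = integral\<^sup>L lborel f" by (simp add: lborel_distr_plus)
qed

lemma integral_prod_coordinates:
  fixes g :: "'n::finite \<Rightarrow> real \<Rightarrow> real"
  assumes "\<And>l. integrable lborel (g l)"
  shows "integrable lborel (\<lambda>x :: real ^ 'n. \<Prod>l\<in>UNIV. g l (x $ l))"
    and "(LINT x|lborel. (\<Prod>l\<in>UNIV. g l ((x :: real ^ 'n) $ l))) = (\<Prod>l\<in>UNIV. integral\<^sup>L lborel (g l))"
proof -
  interpret product_sigma_finite "\<lambda>_ :: real ^ 'n. lborel :: real measure" ..
  have [measurable]: "g l \<in> borel_measurable borel" for l using assms[of l] by simp
  have B: "(Basis :: (real ^ 'n) set) = (\<lambda>l. axis l 1) ` UNIV" by (auto simp: Basis_vec_def)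
  have inj: "inj (\<lambda>l :: 'n. axis l (1::real))" by (auto simp: inj_on_def axis_eq_axis)
  have re: "(\<Prod>b\<in>Basis. h (axis_index b) b) = (\<Prod>l\<in>UNIV. h l (axis l 1))"
    for h :: "'n \<Rightarrow> real ^ 'n \<Rightarrow> real"
    unfolding B by (subst prod.reindex[OF inj]) simp
  let ?P = "\<Pi>\<^sub>M b\<in>(Basis :: (real ^ 'n) set). (lborel :: real measure)"
  let ?T = "\<lambda>f. \<Sum>b\<in>(Basis :: (real ^ 'n) set). f b *\<^sub>R b"
  let ?F = "\<lambda>x :: real ^ 'n. \<Prod>l\<in>UNIV. g l (x $ l)"
  have F: "?F (?T f) = (\<Prod>b\<in>Basis. g (axis_index b) (f b))" for f
  proof -
    have "?T f $ l = f (axis l 1)" for l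
    proof -
      have "?T f $ l = ?T f \<bullet> axis l 1" by (simp add: inner_axis)
      also have "\<dots> = f (axis l 1)"
        by (subst inner_sum_left, subst sum.remove[of _ "axis l 1"])
          (auto simp: inner_Basis intro!: sum.neutral)
      finally show ?thesis .
    qed
    then show ?thesis using re[of "\<lambda>l b. g l (f b)"] by simp
  qed
  have T: "?T \<in> measurable ?P borel" by measurable
  have Fm: "?F \<in> borel_measurable borel" by measurable
  have i: "integrable ?P (\<lambda>f. \<Prod>b\<in>Basis. g (axis_index b) (f b))"
    by (rule product_integrable_prod) (use assms in auto)
  show "integrable lborel ?F"
    unfolding lborel_eq[where 'a = "real ^ 'n"]
    by (subst integrable_distr_eq[OF T Fm]) (unfold F, rule i)
  have "integral\<^sup>L lborel ?F = (LINT f|?P. (\<Prod>b\<in>Basis. g (axis_index b) (f b)))"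
    unfolding lborel_eq[where 'a = "real ^ 'n"] by (subst integral_distr[OF T Fm]) (simp only: F)
  also have "\<dots> = (\<Prod>b\<in>(Basis :: (real ^ 'n) set). integral\<^sup>L lborel (g (axis_index b)))"
    by (rule product_integral_prod) (use assms in auto)
  also have "\<dots> = (\<Prod>l\<in>UNIV. integral\<^sup>L lborel (g l))"
    using re[of "\<lambda>l b. integral\<^sup>L lborel (g l)"] by simp
  finally show "integral\<^sup>L lborel ?F = (\<Prod>l\<in>UNIV. integral\<^sup>L lborel (g l))" .
qed

definition decay :: "real ^ 'n \<Rightarrow> real" where
  "decay x = (\<Prod>l\<in>UNIV. indicator {0<..} (x $ l) * inverse ((1 + x $ l)\<^sup>2))"

lemma decay_outside: "x \<notin> pos_orthant \<Longrightarrow> decay x = 0"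
  by (auto simp: decay_def pos_orthant_def indicator_def)

lemma decay_apply: "x \<in> pos_orthant \<Longrightarrow> decay x = (\<Prod>l\<in>UNIV. inverse ((1 + x $ l)\<^sup>2))"
  unfolding decay_def by (intro prod.cong) (auto simp: indicator_def pos_orthant_def)

lemma decay_nonneg: "0 \<le> decay x"
  unfolding decay_def by (intro prod_nonneg) auto

lemma integrable_decay: "integrable lborel (decay :: real ^ 'n \<Rightarrow> real)"
  unfolding decay_def[abs_def]
proof (rule integral_prod_coordinates(1))
  have "((\<lambda>x :: real. - inverse (1 + x)) \<longlongrightarrow> - 0) at_top"
    by (intro tendsto_minus tendsto_inverse_0_at_top filterlim_tendsto_add_at_top[OF tendsto_const] filterlim_ident)
  then have L: "((\<lambda>x :: real. - inverse (1 + x)) \<longlongrightarrow> 0) at_top" by simp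
  have nn: "(\<integral>\<^sup>+x. ennreal (inverse ((1 + x)\<^sup>2)) * indicator {0..} x \<partial>lborel) = ennreal (0 - (- inverse (1 + 0)))"
    by (rule nn_integral_FTC_atLeast[OF _ _ _ L])
      (auto intro!: derivative_eq_intros simp: power2_eq_square field_simps)
  have "integrable lborel (\<lambda>x :: real. inverse ((1 + x)\<^sup>2) * indicator {0..} x)"
  proof (rule integrableI_nonneg)
    show "(\<integral>\<^sup>+x. ennreal (inverse ((1 + x)\<^sup>2) * indicator {0..} x) \<partial>lborel) < \<infinity>"
      using nn by (simp add: ennreal_mult'' ennreal_indicator)
  qed auto
  then show "integrable lborel (\<lambda>x :: real. indicator {0<..} x * inverse ((1 + x)\<^sup>2))" for l :: 'n
    by (rule Bochner_Integration.integrable_bound) (auto simp: indicator_def)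
qed

definition growth :: "nat \<Rightarrow> real ^ 'n \<Rightarrow> real" where
  "growth N x = (\<Prod>l\<in>UNIV. (1 + x $ l) ^ N)"

lemma growth_decay:
  assumes "x \<in> pos_orthant"
  shows "growth N x = growth (N + 2) x * decay x"
proof -
  have "(1 + s) ^ N = (1 + s) ^ (N + 2) * inverse ((1 + s)\<^sup>2)" if "0 < s" for s :: real
    using that by (simp add: power_add del: add_2_eq_Suc')
  then show ?thesis
    using pos_orthantD[OF assms]
    unfolding growth_def decay_apply[OF assms] prod.distrib[symmetric] by (intro prod.cong refl) blast
qed

text \<open>
  By $(1+s)^N \le 2^N (1+s^N)$ and expansion of the product over the coordinates, the weight
  \<open>growth N\<close> is dominated by $2^{Nd}$ times the sum of the monomials $x^k$ with all $k_l$ equal to 0 or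
  \<open>N\<close>.  This is the corresponding combination of seminorms.
\<close>
definition growth_norm :: "nat \<Rightarrow> (real ^ 'n \<Rightarrow> complex) \<Rightarrow> real" where
  "growth_norm N f = 2 ^ (N * CARD('n)) *
     (\<Sum>A\<in>UNIV. schwartz_seminorm (\<chi> l. if l \<in> A then N else 0) 0 f)"

lemma seminorm_bounded_growth_norm: "seminorm_bounded (growth_norm N)"
  unfolding growth_norm_def
  by (intro seminorm_bounded_cmult seminorm_bounded_sum seminorm_bounded_seminorm) auto

lemma growth_norm_upper:
  fixes f :: "real ^ 'n \<Rightarrow> complex"
  assumes f: "f \<in> orthant_schwartz" and x: "x \<in> pos_orthant"
  shows "growth N x * cmod (f x) \<le> growth_norm N f"
proof -
  have one: "(1 + s) ^ N \<le> 2 ^ N * (s ^ N + 1)" if "0 < s" for s :: real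
  proof (cases "s \<le> 1")
    case True
    then have "(1 + s) ^ N \<le> 2 ^ N" using that by (intro power_mono) auto
    also have "\<dots> \<le> 2 ^ N * (s ^ N + 1)" using that by simp
    finally show ?thesis .
  next
    case False
    then have "(1 + s) ^ N \<le> (2 * s) ^ N" by (intro power_mono) auto
    also have "\<dots> \<le> 2 ^ N * (s ^ N + 1)" by (simp add: power_mult_distrib)
    finally show ?thesis .
  qed
  have pos: "0 < x $ l" for l by (rule pos_orthantD[OF x])
  have "growth N x \<le> (\<Prod>l\<in>UNIV. 2 ^ N * (x $ l ^ N + 1))"
    unfolding growth_def
    by (intro prod_mono conjI one pos zero_le_power) (simp add: add_nonneg_nonneg less_imp_le[OF pos])
  also have "\<dots> = 2 ^ (N * CARD('n)) * (\<Prod>l\<in>UNIV. x $ l ^ N + 1)"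
    by (simp add: prod.distrib power_mult)
  also have "(\<Prod>l\<in>UNIV. x $ l ^ N + 1) = (\<Sum>A\<in>UNIV. \<Prod>l\<in>A. x $ l ^ N)"
    by (subst prod_add) auto
  also have "\<dots> = (\<Sum>A\<in>UNIV. monomial x (real_vec (\<chi> l. if l \<in> A then N else 0)))"
  proof (rule sum.cong[OF refl])
    fix A :: "'n set"
    have "monomial x (real_vec (\<chi> l. if l \<in> A then N else 0)) = (\<Prod>l\<in>UNIV. if l \<in> A then x $ l ^ N else 1)"
      unfolding monomial_def using pos
      by (intro prod.cong) (auto simp: powr_realpow less_imp_neq[symmetric] pos)
    then show "(\<Prod>l\<in>A. x $ l ^ N) = monomial x (real_vec (\<chi> l. if l \<in> A then N else 0))"
      by (simp add: prod.If_cases)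
  qed
  finally have "growth N x * cmod (f x) \<le>
      2 ^ (N * CARD('n)) * (\<Sum>A\<in>UNIV. monomial x (real_vec (\<chi> l. if l \<in> A then N else 0))) * cmod (f x)"
    by (intro mult_right_mono) auto
  also have "\<dots> = 2 ^ (N * CARD('n)) * (\<Sum>A\<in>UNIV. monomial x (real_vec (\<chi> l. if l \<in> A then N else 0)) * cmod (Dp 0 f x))"
    by (simp add: Dp_zero sum_distrib_right mult.assoc)
  also have "\<dots> \<le> growth_norm N f"
    unfolding growth_norm_def by (intro mult_left_mono sum_mono seminorm_upper f x) auto
  finally show ?thesis .
qed

lemma schwartz_growth_bound:
  fixes f :: "real ^ 'n \<Rightarrow> complex"
  assumes f: "f \<in> orthant_schwartz" and x: "x \<in> pos_orthant"
    and w: "cmod w \<le> C * growth N x" and C: "0 \<le> C"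
  shows "cmod (f x * w) \<le> C * growth_norm (N + 2) f * decay x"
proof -
  have "cmod (f x * w) \<le> cmod (f x) * (C * growth N x)"
    using w by (simp add: norm_mult mult_left_mono)
  also have "\<dots> = C * (growth (N + 2) x * cmod (f x)) * decay x"
    using growth_decay[OF x, of N] by simp
  also have "\<dots> \<le> C * growth_norm (N + 2) f * decay x"
    by (intro mult_right_mono mult_left_mono growth_norm_upper f x C decay_nonneg)
  finally show ?thesis .
qed

lemma schwartz_borel_measurable:
  fixes f :: "real ^ 'n \<Rightarrow> complex"
  assumes f: "f \<in> orthant_schwartz"
  shows "f \<in> borel_measurable borel"
proof -
  have "(\<lambda>x. indicator pos_orthant x *\<^sub>R f x) \<in> borel_measurable borel"
    by (intro borel_measurable_continuous_on_indicator borel_open open_pos_orthant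
        rapidly_decreasing_continuous schwartz_rapidly_decreasing f)
  also have "(\<lambda>x. indicator pos_orthant x *\<^sub>R f x) = f"
    using schwartz_zero[OF f] by (auto simp: indicator_def)
  finally show ?thesis .
qed

lemma schwartz_integrable:
  fixes f w :: "real ^ 'n \<Rightarrow> complex"
  assumes f: "f \<in> orthant_schwartz" and [measurable]: "w \<in> borel_measurable borel"
    and w: "\<And>x. x \<in> pos_orthant \<Longrightarrow> cmod (w x) \<le> C * growth N x" and C: "0 \<le> C"
  shows "integrable lborel (\<lambda>x. f x * w x)"
    and "cmod (LINT x|lborel. f x * w x) \<le> C * growth_norm (N + 2) f * integral\<^sup>L lborel (decay :: real ^ 'n \<Rightarrow> real)"
proof -
  have [measurable]: "f \<in> borel_measurable borel" by (rule schwartz_borel_measurable[OF f])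
  have bnd: "cmod (f x * w x) \<le> C * growth_norm (N + 2) f * decay x" for x
    using schwartz_growth_bound[OF f _ w C] by (cases "x \<in> pos_orthant") (auto simp: schwartz_zero[OF f] decay_outside)
  have i: "integrable lborel (\<lambda>x :: real ^ 'n. C * growth_norm (N + 2) f * decay x)"
    by (intro integrable_mult_right integrable_decay)
  show "integrable lborel (\<lambda>x. f x * w x)"
    by (rule Bochner_Integration.integrable_bound[OF i]) (use order_trans[OF bnd abs_ge_self] in auto)
  have "cmod (LINT x|lborel. f x * w x) \<le> (LINT x|lborel. C * growth_norm (N + 2) f * decay (x :: real ^ 'n))"
    by (rule order_trans[OF integral_norm_bound])
      (rule integral_mono[OF integrable_norm[OF \<open>integrable lborel (\<lambda>x. f x * w x)\<close>] i bnd])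
  then show "cmod (LINT x|lborel. f x * w x) \<le> C * growth_norm (N + 2) f * integral\<^sup>L lborel (decay :: real ^ 'n \<Rightarrow> real)"
    by simp
qed

text \<open>
  Translation invariance makes the integral of every difference quotient vanish, and dominated
  convergence passes to the derivative.  Shifting backwards keeps the quotients supported in the
  orthant: a point outside has a coordinate that is not positive and stays so.  The only face through
  which a backward shift leaves the orthant is $x_l = 0$, where \<open>F\<close> tends to zero.
\<close>
lemma integral_partial_eq_0:
  fixes F D :: "real ^ 'n \<Rightarrow> complex"
  assumes F: "integrable lborel F" "\<And>x. x \<notin> pos_orthant \<Longrightarrow> F x = 0"
    and D: "D \<in> borel_measurable borel" "\<And>x. x \<notin> pos_orthant \<Longrightarrow> D x = 0"
    and der: "\<And>x. x \<in> pos_orthant \<Longrightarrow> has_partial l F (D x) x"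
    and Fb: "\<And>x. x \<in> pos_orthant \<Longrightarrow> cmod (F x) \<le> C * x $ l"
    and Db: "\<And>x. x \<in> pos_orthant \<Longrightarrow> cmod (D x) \<le> C * decay x"
  shows "integral\<^sup>L lborel D = 0"
proof -
  define e :: "real ^ 'n" where "e = axis l 1"
  define h where "h n = inverse (real (Suc n))" for n
  have h: "0 < h n" "h n \<le> 1" for n by (auto simp: h_def inverse_le_1_iff)
  have h0: "h \<longlonglongrightarrow> 0" unfolding h_def by (rule LIMSEQ_inverse_real_of_nat)
  define q where "q n x = (F (x + (- h n) *\<^sub>R e) - F x) /\<^sub>R (- h n)" for n x
  have [measurable]: "F \<in> borel_measurable borel" using F(1) by simp
  have C: "0 \<le> C" 
  proof -
    have 1: "(1 :: real ^ 'n) \<in> pos_orthant" by (simp add: pos_orthant_def)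
    have "0 \<le> C * (1 :: real ^ 'n) $ l" using Fb[OF 1] norm_ge_zero order_trans by blast
    then show ?thesis by simp
  qed
  have q_int: "integral\<^sup>L lborel (q n) = 0" for n
  proof -
    have "integrable lborel (\<lambda>x. F ((- h n) *\<^sub>R e + x))"
      "(LINT x|lborel. F ((- h n) *\<^sub>R e + x)) = integral\<^sup>L lborel F"
      by (rule integral_translation[OF F(1)])+
    then show ?thesis using F(1) unfolding q_def by (simp add: add.commute)
  qed
  have coord: "(x + s *\<^sub>R e) $ i = (if i = l then x $ l + s else x $ i)" for x s i
    by (auto simp: e_def axis_def)
  have bound: "cmod (q n x) \<le> 4 * C * decay x" for n x
  proof (cases "x \<in> pos_orthant")
    case False
    then obtain i where i: "x $ i \<le> 0" by (auto simp: pos_orthant_def not_less)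
    have "(x + (- h n) *\<^sub>R e) $ i \<le> 0" using i h(1)[of n] unfolding coord by auto
    then have "x + (- h n) *\<^sub>R e \<notin> pos_orthant" using pos_orthantD not_less by blast
    then show ?thesis using False F(2) by (simp add: q_def decay_outside)
  next
    case True
    \<comment> \<open>the shift at which the segment from \<open>x\<close> to \<open>x - h n *\<^sub>R e\<close> ends or leaves the orthant\<close>
    define a where "a = max (- h n) (- (x $ l))"
    define G where "G s = F (x + s *\<^sub>R e)" for s
    have a: "a < 0" "- h n \<le> a" "- (x $ l) \<le> a" using h[of n] pos_orthantD[OF True, of l] by (auto simp: a_def)
    have in_pos: "x + s *\<^sub>R e \<in> pos_orthant" if "- (x $ l) < s" for s
      using that True unfolding pos_orthant_def coord mem_Collect_eq by auto
    have out: "x + s *\<^sub>R e \<notin> pos_orthant" if "s \<le> - (x $ l)" for s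
      using that coord[of x s l] pos_orthantD[of "x + s *\<^sub>R e" l] by auto
    have Ga: "G (- h n) = G a"
    proof (cases "- (x $ l) < - h n")
      case False
      then have "a = - (x $ l)" by (simp add: a_def)
      then show ?thesis using False F(2)[OF out, of "- h n"] F(2)[OF out, of a] by (simp add: G_def)
    qed (simp add: a_def)
    have dG: "(G has_vector_derivative D (x + s *\<^sub>R e)) (at s)" if "- (x $ l) < s" for s
      using has_partial_line[OF der[OF in_pos[OF that], unfolded e_def]] by (simp add: G_def[abs_def] e_def)
    have contG: "continuous_on {a..0} G"
    proof (rule continuous_at_imp_continuous_on, safe)
      fix s assume s: "s \<in> {a..0}"
      show "isCont G s"
      proof (cases "- (x $ l) < s")
        case True
        then show ?thesis using dG has_vector_derivative_continuous by blast
      next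
        case False
        then have s: "s = - (x $ l)" using s a by auto
        have "G s = 0" unfolding G_def by (rule F(2)[OF out]) (simp add: s)
        moreover have "(G \<longlongrightarrow> 0) (at s)"
        proof (rule Lim_null_comparison[where g = "\<lambda>t. C * \<bar>x $ l + t\<bar>"])
          have "norm (G t) \<le> C * \<bar>x $ l + t\<bar>" for t
          proof (cases "x + t *\<^sub>R e \<in> pos_orthant")
            case True
            then show ?thesis using Fb[OF True] pos_orthantD[OF True, of l] unfolding coord by (simp add: G_def)
          qed (use F(2) C in \<open>simp add: G_def\<close>)
          then show "\<forall>\<^sub>F t in at s. norm (G t) \<le> C * \<bar>x $ l + t\<bar>" by simp
          have "((\<lambda>t. C * \<bar>x $ l + t\<bar>) \<longlongrightarrow> C * \<bar>x $ l + s\<bar>) (at s)" by (intro tendsto_intros)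
          then show "((\<lambda>t. C * \<bar>x $ l + t\<bar>) \<longlongrightarrow> 0) (at s)" by (simp add: s)
        qed
        ultimately show ?thesis by (simp add: isCont_def)
      qed
    qed
    obtain s where s: "s \<in> {a<..<0}" "norm (G 0 - G a) \<le> norm ((0 - a) *\<^sub>R D (x + s *\<^sub>R e))"
      using mvt_general[OF a(1) contG, of "\<lambda>s h. h *\<^sub>R D (x + s *\<^sub>R e)"] dG a(3)
      unfolding has_vector_derivative_def by fastforce
    have s': "- (x $ l) < s" "- 1 \<le> s" using s a h[of n] by auto
    have "decay (x + s *\<^sub>R e) \<le> 4 * decay x"
    proof -
      define P where "P = (\<Prod>i\<in>UNIV - {l}. inverse ((1 + x $ i)\<^sup>2))"
      have P: "0 \<le> P" unfolding P_def by (intro prod_nonneg) auto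
      have "decay (x + s *\<^sub>R e) = inverse ((1 + (x $ l + s))\<^sup>2) * P"
        unfolding decay_apply[OF in_pos[OF s'(1)]] coord P_def
        by (subst prod.remove[of _ l]) (auto intro!: prod.cong)
      also have "\<dots> \<le> (4 * inverse ((1 + x $ l)\<^sup>2)) * P"
      proof (intro mult_right_mono P)
        have "(1 + x $ l) / 2 \<le> 1 + (x $ l + s)" using s' by simp
        then have "((1 + x $ l) / 2)\<^sup>2 \<le> (1 + (x $ l + s))\<^sup>2"
          using pos_orthantD[OF True, of l] by (intro power_mono) auto
        then have "inverse ((1 + (x $ l + s))\<^sup>2) \<le> inverse (((1 + x $ l) / 2)\<^sup>2)"
          using pos_orthantD[OF True, of l] by (intro le_imp_inverse_le) auto
        also have "inverse (((1 + x $ l) / 2)\<^sup>2) = 4 * inverse ((1 + x $ l)\<^sup>2)"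
          by (simp only: power_divide inverse_divide) (simp add: field_simps)
        finally show "inverse ((1 + (x $ l + s))\<^sup>2) \<le> 4 * inverse ((1 + x $ l)\<^sup>2)" .
      qed
      also have "\<dots> = 4 * decay x"
        unfolding decay_apply[OF True] P_def by (subst (2) prod.remove[of _ l]) auto
      finally show ?thesis .
    qed
    then have Ds: "cmod (D (x + s *\<^sub>R e)) \<le> C * (4 * decay x)"
      using Db[OF in_pos[OF s'(1)]] C by (meson mult_left_mono order_trans)
    have "norm (G 0 - G (- h n)) \<le> h n * (C * (4 * decay x))"
      using s(2) mult_mono[of "- a" "h n", OF _ Ds] a h[of n] unfolding Ga by simp
    moreover have "norm (q n x) = norm (G 0 - G (- h n)) / h n"
      using h[of n] unfolding q_def G_def by (simp add: norm_minus_commute divide_inverse mult.commute)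
    ultimately show ?thesis using h[of n] by (simp add: divide_le_eq mult.commute mult.left_commute)
  qed
  have lim: "(\<lambda>n. q n x) \<longlonglongrightarrow> D x" for x
  proof (cases "x \<in> pos_orthant")
    case True
    have "((\<lambda>t. (F (x + t *\<^sub>R e) - F x) /\<^sub>R t) \<longlongrightarrow> D x) (at 0)"
      using der[OF True] unfolding has_partial_def has_vector_derivative_quotient e_def by simp
    moreover have "filterlim (\<lambda>n. - h n) (at 0) sequentially"
    proof (rule filterlim_atI)
      show "(\<lambda>n. - h n) \<longlonglongrightarrow> 0" using tendsto_minus[OF h0] by simp
      have "- h n \<noteq> 0" for n using h(1)[of n] by linarith
      then show "\<forall>\<^sub>F n in sequentially. - h n \<noteq> 0" by simp
    qed
    ultimately show ?thesis unfolding q_def by (rule filterlim_compose)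
  next
    case False
    have "q n x = 0" for n using bound[of n x] decay_outside[OF False] by simp
    then show ?thesis using D(2)[OF False] by simp
  qed
  have "(\<lambda>n. integral\<^sup>L lborel (q n)) \<longlonglongrightarrow> integral\<^sup>L lborel D"
  proof (rule integral_dominated_convergence[where w = "\<lambda>x. 4 * C * decay x"])
    show "D \<in> borel_measurable lborel" using D(1) by simp
    show "q n \<in> borel_measurable lborel" for n unfolding q_def by measurable
    show "integrable lborel (\<lambda>x :: real ^ 'n. 4 * C * decay x)"
      by (intro integrable_mult_right integrable_decay)
  qed (use lim bound in auto)
  then show ?thesis using q_int by (simp add: LIMSEQ_const_iff)
qed

lemma has_vector_derivative_integral_dominated:
  fixes g g' :: "real \<Rightarrow> 'a::euclidean_space \<Rightarrow> complex"
  assumes \<delta>: "0 < \<delta>"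
    and int: "\<And>s. \<bar>s\<bar> < \<delta> \<Longrightarrow> integrable lborel (g s)"
    and der: "\<And>s x. \<bar>s\<bar> < \<delta> \<Longrightarrow> ((\<lambda>s. g s x) has_vector_derivative g' s x) (at s)"
    and bnd: "\<And>s x. \<bar>s\<bar> < \<delta> \<Longrightarrow> cmod (g' s x) \<le> G x"
    and G: "integrable lborel G"
    and meas: "g' 0 \<in> borel_measurable borel"
  shows "((\<lambda>s. integral\<^sup>L lborel (g s)) has_vector_derivative integral\<^sup>L lborel (g' 0)) (at 0)"
  unfolding has_vector_derivative_quotient tendsto_at_iff_sequentially
proof safe
  fix X :: "nat \<Rightarrow> real" assume X: "\<forall>i. X i \<in> UNIV - {0}" "X \<longlonglongrightarrow> 0"
  have ev: "\<forall>\<^sub>F n in sequentially. \<bar>X n\<bar> < \<delta>"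
    using X(2) \<delta> by (simp add: tendsto_iff dist_real_def)
  then obtain N where N: "\<And>n. \<bar>X (n + N)\<bar> < \<delta>"
    unfolding eventually_sequentially by (metis le_add2)
  define Y where "Y n = X (n + N)" for n
  have Y: "Y \<longlonglongrightarrow> 0" "\<And>n. Y n \<noteq> 0" "\<And>n. \<bar>Y n\<bar> < \<delta>"
    using X N LIMSEQ_ignore_initial_segment[OF X(2), of N] by (simp_all add: Y_def[abs_def])
  define q where "q n x = (g (Y n) x - g 0 x) /\<^sub>R Y n" for n x
  have "(\<lambda>n. integral\<^sup>L lborel (q n)) \<longlonglongrightarrow> integral\<^sup>L lborel (g' 0)"
  proof (rule integral_dominated_convergence[where w = G])
    show "g' 0 \<in> borel_measurable lborel" using meas by simp
    show "q n \<in> borel_measurable lborel" for n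
      using int[of "Y n"] int[of 0] Y(3)[of n] \<delta> unfolding q_def by (intro measurable) auto
    show "AE x in lborel. (\<lambda>n. q n x) \<longlonglongrightarrow> g' 0 x"
    proof (rule AE_I2)
      fix x
      have "((\<lambda>h. (g (0 + h) x - g 0 x) /\<^sub>R h) \<longlongrightarrow> g' 0 x) (at 0)"
        using der[of 0 x] \<delta> unfolding has_vector_derivative_quotient by simp
      moreover have "filterlim Y (at 0) sequentially"
        by (rule filterlim_atI) (use Y in auto)
      ultimately show "(\<lambda>n. q n x) \<longlonglongrightarrow> g' 0 x"
        unfolding q_def using filterlim_compose by fastforce
    qed
    show "AE x in lborel. norm (q n x) \<le> G x" for n
    proof (rule AE_I2)
      fix x
      have "norm (g (Y n) x - g 0 x) \<le> G x * norm (Y n - 0)"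
      proof (rule differentiable_bound[where S = "{-\<delta><..<\<delta>}" and f' = "\<lambda>s h. h *\<^sub>R g' s x"])
        fix s assume s: "s \<in> {-\<delta><..<\<delta>}"
        then have s': "\<bar>s\<bar> < \<delta>" by auto
        show "((\<lambda>a. g a x) has_derivative (\<lambda>h. h *\<^sub>R g' s x)) (at s within {-\<delta><..<\<delta>})"
          using der[OF s'] by (simp add: has_vector_derivative_def has_derivative_at_withinI)
        show "onorm (\<lambda>h. h *\<^sub>R g' s x) \<le> G x"
          by (rule onorm_bound)
            (use mult_right_mono[OF bnd[OF s', of x] abs_ge_zero] order_trans[OF norm_ge_zero bnd[OF s']]
              in \<open>auto simp: mult.commute\<close>)
      qed (use Y(3)[of n] \<delta> in auto)
      then show "norm (q n x) \<le> G x"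
        using Y(2)[of n] by (simp add: q_def divide_inverse[symmetric] mult.commute[of "inverse _"] divide_le_eq)
    qed
  qed (rule G)
  moreover have "integral\<^sup>L lborel (q n) = (integral\<^sup>L lborel (g (Y n)) - integral\<^sup>L lborel (g 0)) /\<^sub>R Y n" for n
    unfolding q_def using int Y(3) \<delta> by (simp add: Bochner_Integration.integral_diff)
  ultimately have "(\<lambda>n. ((\<lambda>h. (integral\<^sup>L lborel (g (0 + h)) - integral\<^sup>L lborel (g 0)) /\<^sub>R h) \<circ> X) (n + N))
      \<longlonglongrightarrow> integral\<^sup>L lborel (g' 0)"
    by (simp add: Y_def o_def)
  then show "((\<lambda>h. (integral\<^sup>L lborel (g (0 + h)) - integral\<^sup>L lborel (g 0)) /\<^sub>R h) \<circ> X)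
      \<longlonglongrightarrow> integral\<^sup>L lborel (g' 0)"
    by (rule LIMSEQ_offset)
qed

text \<open>
  The kernel of the Hankel transform of order \<open>\<mu>\<close> is the case \<open>\<alpha> = \<nu> = \<mu>\<close>.  Differentiation and
  integration by parts change the power and the Bessel index separately.
\<close>
definition kern :: "real ^ 'n \<Rightarrow> real ^ 'n \<Rightarrow> real ^ 'n \<Rightarrow> real ^ 'n \<Rightarrow> real ^ 'n \<Rightarrow> real" where
  "kern r \<alpha> \<nu> x t = (\<Prod>l\<in>UNIV. x $ l powr \<alpha> $ l * clifford (\<nu> $ l) (r $ l * (x $ l * t $ l)))"

lemma has_partial_prod:
  fixes \<psi> :: "'n::finite \<Rightarrow> real \<Rightarrow> real"
  assumes "(\<psi> l has_field_derivative d) (at (x $ l))"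
  shows "has_partial l (\<lambda>x. of_real (\<Prod>i\<in>UNIV. \<psi> i (x $ i))) (of_real (d * (\<Prod>i\<in>UNIV - {l}. \<psi> i (x $ i)))) x"
proof -
  define P where "P = (\<Prod>i\<in>UNIV - {l}. \<psi> i (x $ i))"
  have "(\<Prod>i\<in>UNIV. \<psi> i ((x + s *\<^sub>R axis l 1) $ i)) = \<psi> l (x $ l + s) * P" for s
    unfolding P_def by (subst prod.remove[of _ l]) (auto simp: axis_def intro!: prod.cong)
  moreover have "((\<lambda>s. complex_of_real (\<psi> l (x $ l + s) * P)) has_vector_derivative of_real (d * P)) (at 0)"
  proof -
    have "((\<lambda>s. \<psi> l (x $ l + s)) has_field_derivative d) (at 0)"
      using DERIV_shift[of "\<psi> l" d 0 "x $ l"] assms by (simp add: add.commute)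
    then have "((\<lambda>s. \<psi> l (x $ l + s) * P) has_field_derivative d * P) (at 0)"
      by (rule DERIV_cmult_right)
    then show ?thesis
      by (intro has_vector_derivative_of_real) (simp add: has_real_derivative_iff_has_vector_derivative)
  qed
  ultimately show ?thesis unfolding has_partial_def P_def[symmetric] by simp
qed

lemma axis_add_nth: "(\<alpha> + axis l 1) $ i = (if i = l then \<alpha> $ l + 1 else (\<alpha> :: real ^ 'n) $ i)"
  by (simp add: axis_def)

lemma kern_remove:
  "kern r \<alpha> \<nu> x t = (x $ l powr \<alpha> $ l * clifford (\<nu> $ l) (r $ l * (x $ l * t $ l))) *
     (\<Prod>i\<in>UNIV - {l}. x $ i powr \<alpha> $ i * clifford (\<nu> $ i) (r $ i * (x $ i * t $ i)))"
  unfolding kern_def by (subst prod.remove[of _ l]) auto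

lemma kern_axis_cong:
  "(\<Prod>i\<in>UNIV - {l}. x $ i powr (\<alpha> + axis l 1) $ i * clifford ((\<nu> + axis l 1) $ i) (g i))
    = (\<Prod>i\<in>UNIV - {l}. x $ i powr \<alpha> $ i * clifford (\<nu> $ i) (g i))"
  "(\<Prod>i\<in>UNIV - {l}. x $ i powr (\<alpha> + axis l 1) $ i * clifford (\<nu> $ i) (g i))
    = (\<Prod>i\<in>UNIV - {l}. x $ i powr \<alpha> $ i * clifford (\<nu> $ i) (g i))"
  "(\<Prod>i\<in>UNIV - {l}. x $ i powr \<alpha> $ i * clifford ((\<nu> + axis l 1) $ i) (g i))
    = (\<Prod>i\<in>UNIV - {l}. x $ i powr \<alpha> $ i * clifford (\<nu> $ i) (g i))"
  by (intro prod.cong refl; simp add: axis_add_nth del: vector_add_component)+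

lemma kern_shift:
  assumes "x \<in> pos_orthant"
  shows "kern r (\<alpha> + axis l 1) \<nu> x t = x $ l * kern r \<alpha> \<nu> x t"
  using pos_orthantD[OF assms, of l]
  unfolding kern_remove[where l = l] kern_axis_cong axis_add_nth by (simp add: powr_add)

lemma kern_recurrence:
  fixes \<nu> :: "real ^ 'n"
  assumes "x \<in> pos_orthant" "0 \<le> \<nu> $ l"
  shows "(\<nu> $ l + 1) * kern r \<alpha> (\<nu> + axis l 1) x t
    - r $ l * t $ l * kern r (\<alpha> + axis l 1) (\<nu> + axis l 1 + axis l 1) x t = kern r \<alpha> \<nu> x t"
proof -
  have "(\<nu> $ l + 1) * kern r \<alpha> (\<nu> + axis l 1) x t
    - r $ l * t $ l * kern r (\<alpha> + axis l 1) (\<nu> + axis l 1 + axis l 1) x t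
    = (x $ l powr \<alpha> $ l) * ((\<nu> $ l + 1) * clifford (\<nu> $ l + 1) (r $ l * (x $ l * t $ l))
       - r $ l * (x $ l * t $ l) * clifford (\<nu> $ l + 2) (r $ l * (x $ l * t $ l)))
      * (\<Prod>i\<in>UNIV - {l}. x $ i powr \<alpha> $ i * clifford (\<nu> $ i) (r $ i * (x $ i * t $ i)))"
    using pos_orthantD[OF assms(1), of l]
    unfolding kern_shift[OF assms(1)] kern_remove[where l = l] kern_axis_cong axis_add_nth
    by (simp add: algebra_simps powr_add)
  then show ?thesis unfolding clifford_recurrence[OF assms(2)] by (simp add: kern_remove[where l = l])
qed

lemma has_partial_kern:
  fixes \<alpha> \<nu> :: "real ^ 'n"
  assumes x: "x \<in> pos_orthant" and \<nu>: "\<And>l. 0 \<le> \<nu> $ l"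
  shows "has_partial l (\<lambda>x. of_real (kern r (\<alpha> + axis l 1) \<nu> x t))
    (of_real ((\<alpha> $ l + 1) * kern r \<alpha> \<nu> x t - r $ l * t $ l * kern r (\<alpha> + axis l 1) (\<nu> + axis l 1) x t)) x"
proof -
  define \<psi> where "\<psi> i s = s powr (\<alpha> + axis l 1) $ i * clifford (\<nu> $ i) (r $ i * (s * t $ i))" for i s
  have xl: "0 < x $ l" by (rule pos_orthantD[OF x])
  have "((\<lambda>s. s powr (\<alpha> $ l + 1) * clifford (\<nu> $ l) (r $ l * (s * t $ l))) has_field_derivative
      (\<alpha> $ l + 1) * x $ l powr \<alpha> $ l * clifford (\<nu> $ l) (r $ l * (x $ l * t $ l))
      - r $ l * t $ l * (x $ l powr (\<alpha> $ l + 1) * clifford (\<nu> $ l + 1) (r $ l * (x $ l * t $ l)))) (at (x $ l))"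
    using xl \<nu>[of l] by (auto intro!: derivative_eq_intros simp: algebra_simps)
  then have "(\<psi> l has_field_derivative
      (\<alpha> $ l + 1) * x $ l powr \<alpha> $ l * clifford (\<nu> $ l) (r $ l * (x $ l * t $ l))
      - r $ l * t $ l * (x $ l powr (\<alpha> $ l + 1) * clifford (\<nu> $ l + 1) (r $ l * (x $ l * t $ l)))) (at (x $ l))"
    unfolding \<psi>_def by (simp add: axis_add_nth)
  from has_partial_prod[of \<psi>, OF this]
  have "has_partial l (\<lambda>x. of_real (kern r (\<alpha> + axis l 1) \<nu> x t))
    (of_real (((\<alpha> $ l + 1) * x $ l powr \<alpha> $ l * clifford (\<nu> $ l) (r $ l * (x $ l * t $ l))
      - r $ l * t $ l * (x $ l powr (\<alpha> $ l + 1) * clifford (\<nu> $ l + 1) (r $ l * (x $ l * t $ l)))) *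
      (\<Prod>i\<in>UNIV - {l}. x $ i powr (\<alpha> + axis l 1) $ i * clifford (\<nu> $ i) (r $ i * (x $ i * t $ i))))) x"
    by (simp add: \<psi>_def kern_def)
  also have "((\<alpha> $ l + 1) * x $ l powr \<alpha> $ l * clifford (\<nu> $ l) (r $ l * (x $ l * t $ l))
      - r $ l * t $ l * (x $ l powr (\<alpha> $ l + 1) * clifford (\<nu> $ l + 1) (r $ l * (x $ l * t $ l)))) *
      (\<Prod>i\<in>UNIV - {l}. x $ i powr (\<alpha> + axis l 1) $ i * clifford (\<nu> $ i) (r $ i * (x $ i * t $ i)))
    = (\<alpha> $ l + 1) * kern r \<alpha> \<nu> x t - r $ l * t $ l * kern r (\<alpha> + axis l 1) (\<nu> + axis l 1) x t"
    unfolding kern_remove[where l = l] kern_axis_cong axis_add_nth by (simp add: algebra_simps)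
  finally show ?thesis .
qed

lemma has_partial_kern_snd:
  fixes \<alpha> \<nu> :: "real ^ 'n"
  assumes x: "x \<in> pos_orthant" and \<nu>: "\<And>l. 0 \<le> \<nu> $ l"
  shows "has_partial l (\<lambda>t. of_real (kern r \<alpha> \<nu> x t))
    (of_real (- (r $ l * kern r (\<alpha> + axis l 1) (\<nu> + axis l 1) x t))) t"
proof -
  define \<psi> where "\<psi> i s = x $ i powr \<alpha> $ i * clifford (\<nu> $ i) (r $ i * (x $ i * s))" for i s
  have "(\<psi> l has_field_derivative - (r $ l * x $ l * (x $ l powr \<alpha> $ l * clifford (\<nu> $ l + 1) (r $ l * (x $ l * t $ l))))) (at (t $ l))"
    using \<nu>[of l] unfolding \<psi>_def by (auto intro!: derivative_eq_intros simp: algebra_simps)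
  from has_partial_prod[of \<psi>, OF this]
  have "has_partial l (\<lambda>t. of_real (kern r \<alpha> \<nu> x t))
    (of_real (- (r $ l * x $ l * (x $ l powr \<alpha> $ l * clifford (\<nu> $ l + 1) (r $ l * (x $ l * t $ l)))) *
      (\<Prod>i\<in>UNIV - {l}. x $ i powr \<alpha> $ i * clifford (\<nu> $ i) (r $ i * (x $ i * t $ i))))) t"
    by (simp add: \<psi>_def kern_def)
  also have "- (r $ l * x $ l * (x $ l powr \<alpha> $ l * clifford (\<nu> $ l + 1) (r $ l * (x $ l * t $ l)))) *
      (\<Prod>i\<in>UNIV - {l}. x $ i powr \<alpha> $ i * clifford (\<nu> $ i) (r $ i * (x $ i * t $ i)))
    = - (r $ l * kern r (\<alpha> + axis l 1) (\<nu> + axis l 1) x t)"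
    using pos_orthantD[OF x, of l]
    unfolding kern_shift[OF x] kern_remove[where l = l] kern_axis_cong axis_add_nth
    by (simp add: algebra_simps powr_add)
  finally show ?thesis .
qed

text \<open>
  The value of the product of Bessel factors at the origin, which is their maximal modulus on the closed
  orthant.
\<close>
definition clifford_bound :: "real ^ 'n \<Rightarrow> real" where
  "clifford_bound \<nu> = (\<Prod>l\<in>UNIV. inverse (Gamma (\<nu> $ l + 1)))"

lemma clifford_bound_nonneg: "(\<And>l. 0 \<le> \<nu> $ l) \<Longrightarrow> 0 \<le> clifford_bound \<nu>"
  unfolding clifford_bound_def by (intro prod_nonneg) (auto intro!: Gamma_real_nonneg add_nonneg_pos)

lemma abs_kern_le_monomial:
  fixes \<alpha> \<nu> :: "real ^ 'n"
  assumes \<nu>: "\<And>l. 0 \<le> \<nu> $ l" and r: "\<And>l. 0 < r $ l"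
    and x: "x \<in> pos_orthant" and t: "t \<in> closed_orthant"
  shows "\<bar>kern r \<alpha> \<nu> x t\<bar> \<le> clifford_bound \<nu> * monomial x \<alpha>"
proof -
  have "\<bar>kern r \<alpha> \<nu> x t\<bar> = (\<Prod>l\<in>UNIV. \<bar>clifford (\<nu> $ l) (r $ l * (x $ l * t $ l))\<bar>) * monomial x \<alpha>"
    by (simp add: kern_def abs_prod abs_mult prod.distrib monomial_def mult.commute)
  also have "\<dots> \<le> clifford_bound \<nu> * monomial x \<alpha>"
    unfolding clifford_bound_def
    by (intro mult_right_mono prod_mono conjI abs_clifford_le \<nu> monomial_nonneg)
      (use t r pos_orthantD[OF x] in \<open>auto simp: closed_orthant_def less_imp_le\<close>)
  finally show ?thesis .
qed

lemma monomial_le_growth: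
  fixes \<alpha> :: "real ^ 'n"
  assumes "\<And>l. \<alpha> $ l \<le> real N" "\<And>l. 0 \<le> \<alpha> $ l" "x \<in> pos_orthant"
  shows "monomial x \<alpha> \<le> growth N x"
  unfolding monomial_def growth_def
proof (intro prod_mono conjI)
  fix l
  have x: "0 < x $ l" by (rule pos_orthantD[OF assms(3)])
  have "x $ l powr \<alpha> $ l \<le> (1 + x $ l) powr \<alpha> $ l"
    using x assms(2)[of l] by (intro powr_mono2) auto
  also have "\<dots> \<le> (1 + x $ l) powr real N"
    using x assms(1)[of l] by (intro powr_mono) auto
  also have "\<dots> = (1 + x $ l) ^ N" using x by (simp add: powr_realpow)
  finally show "x $ l powr \<alpha> $ l \<le> (1 + x $ l) ^ N" .
qed simp

lemma ex_growth_exponent: "\<exists>N. \<forall>l. (\<alpha> :: real ^ 'n) $ l \<le> real N"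
proof -
  have "\<alpha> $ l \<le> real (nat \<lceil>\<Sum>i\<in>UNIV. \<bar>\<alpha> $ i\<bar>\<rceil>)" for l
  proof -
    have "\<alpha> $ l \<le> \<bar>\<alpha> $ l\<bar>" by simp
    also have "\<dots> \<le> (\<Sum>i\<in>UNIV. \<bar>\<alpha> $ i\<bar>)" by (rule member_le_sum) auto
    finally show ?thesis by (simp add: sum_nonneg le_nat_iff) linarith
  qed
  then show ?thesis by blast
qed

lemma borel_measurable_kern [measurable]:
  fixes \<nu> :: "real ^ 'n"
  assumes "\<And>l. 0 \<le> \<nu> $ l"
  shows "(\<lambda>x. kern r \<alpha> \<nu> x t) \<in> borel_measurable borel"
    and "(\<lambda>(x, t). kern r \<alpha> \<nu> x t) \<in> borel_measurable (borel \<Otimes>\<^sub>M borel)"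
proof -
  have [measurable]: "clifford (\<nu> $ l) \<in> borel_measurable borel" for l
    by (rule borel_measurable_clifford[OF assms])
  have [measurable]: "(\<lambda>x :: real ^ 'n. x $ l) \<in> borel_measurable borel" for l
    by (intro borel_measurable_continuous_onI continuous_intros)
  show "(\<lambda>x. kern r \<alpha> \<nu> x t) \<in> borel_measurable borel"
    unfolding kern_def by measurable
  show "(\<lambda>(x, t). kern r \<alpha> \<nu> x t) \<in> borel_measurable (borel \<Otimes>\<^sub>M borel)"
    unfolding kern_def split_beta by measurable
qed

definition hankel_integral ::
    "real ^ 'n \<Rightarrow> real ^ 'n \<Rightarrow> real ^ 'n \<Rightarrow> (real ^ 'n \<Rightarrow> complex) \<Rightarrow> real ^ 'n \<Rightarrow> complex" where
  "hankel_integral r \<alpha> \<nu> f t = (LINT x|lborel. f x * of_real (kern r \<alpha> \<nu> x t))"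

section \<open>The Hankel transform of Schwartz functions\<close>

lemma decay_le_1: "decay x \<le> 1"
proof (cases "x \<in> pos_orthant")
  case True
  have "inverse ((1 + s)\<^sup>2) \<le> 1" if "0 < s" for s :: real
    using that by (intro inverse_le_1_iff[THEN iffD2] disjI2 one_le_power) auto
  then show ?thesis
    unfolding decay_apply[OF True] using pos_orthantD[OF True] by (intro prod_le_1) auto
qed (simp add: decay_outside)

lemma kern_growth:
  fixes \<alpha> \<nu> :: "real ^ 'n"
  assumes "\<And>l. 0 < r $ l" "\<And>l. 0 \<le> \<alpha> $ l" "\<And>l. 0 \<le> \<nu> $ l"
  obtains N where "\<And>x t. x \<in> pos_orthant \<Longrightarrow> t \<in> closed_orthant \<Longrightarrow>
    cmod (of_real (kern r \<alpha> \<nu> x t)) \<le> clifford_bound \<nu> * growth N x"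
proof -
  obtain N where N: "\<And>l. \<alpha> $ l \<le> real N" using ex_growth_exponent by blast
  have "cmod (of_real (kern r \<alpha> \<nu> x t)) \<le> clifford_bound \<nu> * growth N x"
    if "x \<in> pos_orthant" "t \<in> closed_orthant" for x t
  proof -
    have "\<bar>kern r \<alpha> \<nu> x t\<bar> \<le> clifford_bound \<nu> * monomial x \<alpha>"
      by (rule abs_kern_le_monomial) (use assms that in auto)
    also have "\<dots> \<le> clifford_bound \<nu> * growth N x"
      by (intro mult_left_mono monomial_le_growth N clifford_bound_nonneg assms that)
    finally show ?thesis by simp
  qed
  then show thesis by (rule that)
qed

lemma nonneg_add_axis: "(\<And>l. 0 \<le> \<mu> $ l) \<Longrightarrow> 0 \<le> (\<mu> + axis l 1) $ i" for \<mu> :: "real ^ 'n"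
  unfolding axis_add_nth by (auto simp: add_nonneg_nonneg)

text \<open>
  The differential operator $x_l \partial_l^2 + (c+1) \partial_l$, which the Hankel transform with
  $\mu_l = c$ turns into multiplication by $-r_l t_l$.  Both coefficients are written out so that it is
  literally a linear combination of two operators.
\<close>
definition bessel_op :: "'n \<Rightarrow> real \<Rightarrow> (real ^ 'n \<Rightarrow> complex) \<Rightarrow> real ^ 'n \<Rightarrow> complex" where
  "bessel_op l c f = (\<lambda>x. 1 * xmult l (pd l (pd l f)) x + of_real (c + 1) * pd l f x)"

lemma continuous_op_bessel_op: "continuous_op (bessel_op l c)"
  unfolding bessel_op_def
  by (intro continuous_op_lincomb continuous_op_pd
      continuous_op_compose[OF continuous_op_xmult continuous_op_compose[OF continuous_op_pd continuous_op_pd]])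

context
  fixes r :: "real ^ 'n"
  assumes r_pos: "\<And>l. 0 < r $ l"
begin

lemma kern_product_bound:
  fixes \<alpha> \<nu> :: "real ^ 'n"
  assumes "f \<in> orthant_schwartz" "\<And>l. 0 \<le> \<alpha> $ l" "\<And>l. 0 \<le> \<nu> $ l"
  obtains C where "0 \<le> C" "\<And>x t. x \<in> pos_orthant \<Longrightarrow> t \<in> closed_orthant \<Longrightarrow>
    cmod (f x * of_real (kern r \<alpha> \<nu> x t)) \<le> C * decay x"
proof -
  obtain N where N: "\<And>x t. x \<in> pos_orthant \<Longrightarrow> t \<in> closed_orthant \<Longrightarrow>
    cmod (of_real (kern r \<alpha> \<nu> x t)) \<le> clifford_bound \<nu> * growth N x"
    using kern_growth[OF r_pos assms(2,3)] by blast
  have "cmod (f x * of_real (kern r \<alpha> \<nu> x t)) \<le> clifford_bound \<nu> * growth_norm (N + 2) f * decay x"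
    if "x \<in> pos_orthant" "t \<in> closed_orthant" for x t
    by (rule schwartz_growth_bound[OF assms(1) that(1) N[OF that] clifford_bound_nonneg[OF assms(3)]])
  then show thesis
    by (intro that[of "\<bar>clifford_bound \<nu> * growth_norm (N + 2) f\<bar>"])
      (auto intro: order_trans[OF _ mult_right_mono[OF abs_ge_self decay_nonneg]])
qed

lemma hankel_integrable:
  fixes \<alpha> \<nu> :: "real ^ 'n"
  assumes "f \<in> orthant_schwartz" "\<And>l. 0 \<le> \<alpha> $ l" "\<And>l. 0 \<le> \<nu> $ l" "t \<in> closed_orthant"
  shows "integrable lborel (\<lambda>x. f x * of_real (kern r \<alpha> \<nu> x t))"
proof -
  obtain N where N: "\<And>x t. x \<in> pos_orthant \<Longrightarrow> t \<in> closed_orthant \<Longrightarrow>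
    cmod (of_real (kern r \<alpha> \<nu> x t)) \<le> clifford_bound \<nu> * growth N x"
    using kern_growth[OF r_pos assms(2,3)] by blast
  show ?thesis
    by (rule schwartz_integrable(1)[OF assms(1) _ N clifford_bound_nonneg])
      (use assms borel_measurable_kern(1)[OF assms(3)] in auto)
qed

lemma hankel_integral_bound:
  fixes \<alpha> \<nu> :: "real ^ 'n"
  assumes "\<And>l. 0 \<le> \<alpha> $ l" "\<And>l. 0 \<le> \<nu> $ l"
  obtains q where "seminorm_bounded q"
    "\<And>f t. f \<in> orthant_schwartz \<Longrightarrow> t \<in> closed_orthant \<Longrightarrow> cmod (hankel_integral r \<alpha> \<nu> f t) \<le> q f"
proof -
  obtain N where N: "\<And>x t. x \<in> pos_orthant \<Longrightarrow> t \<in> closed_orthant \<Longrightarrow>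
    cmod (of_real (kern r \<alpha> \<nu> x t)) \<le> clifford_bound \<nu> * growth N x"
    using kern_growth[OF r_pos assms] by blast
  define I where "I = integral\<^sup>L lborel (decay :: real ^ 'n \<Rightarrow> real)"
  have I: "0 \<le> I" unfolding I_def by (rule Bochner_Integration.integral_nonneg) (simp add: decay_nonneg)
  show thesis
  proof (rule that[of "\<lambda>f. (clifford_bound \<nu> * I) * growth_norm (N + 2) f"])
    show "seminorm_bounded (\<lambda>f. (clifford_bound \<nu> * I) * growth_norm (N + 2) f)"
      by (intro seminorm_bounded_cmult seminorm_bounded_growth_norm mult_nonneg_nonneg I clifford_bound_nonneg assms)
    fix f :: "real ^ 'n \<Rightarrow> complex" and t :: "real ^ 'n"
    assume f: "f \<in> orthant_schwartz" and t: "t \<in> closed_orthant"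
    have "cmod (hankel_integral r \<alpha> \<nu> f t) \<le> clifford_bound \<nu> * growth_norm (N + 2) f * I"
      unfolding hankel_integral_def I_def
      by (rule schwartz_integrable(2)[OF f _ N clifford_bound_nonneg])
        (use assms t borel_measurable_kern(1)[OF assms(2)] in auto)
    then show "cmod (hankel_integral r \<alpha> \<nu> f t) \<le> (clifford_bound \<nu> * I) * growth_norm (N + 2) f"
      by (simp add: mult_ac)
  qed
qed

lemma hankel_integral_lincomb:
  fixes \<alpha> \<nu> :: "real ^ 'n"
  assumes "f \<in> orthant_schwartz" "g \<in> orthant_schwartz" "\<And>l. 0 \<le> \<alpha> $ l" "\<And>l. 0 \<le> \<nu> $ l" "t \<in> closed_orthant"
  shows "hankel_integral r \<alpha> \<nu> (\<lambda>x. a * f x + b * g x) t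
    = a * hankel_integral r \<alpha> \<nu> f t + b * hankel_integral r \<alpha> \<nu> g t"
proof -
  have "hankel_integral r \<alpha> \<nu> (\<lambda>x. a * f x + b * g x) t
      = (LINT x|lborel. a * (f x * of_real (kern r \<alpha> \<nu> x t)) + b * (g x * of_real (kern r \<alpha> \<nu> x t)))"
    unfolding hankel_integral_def by (simp add: algebra_simps)
  also have "\<dots> = a * hankel_integral r \<alpha> \<nu> f t + b * hankel_integral r \<alpha> \<nu> g t"
    unfolding hankel_integral_def
    using hankel_integrable[OF assms(1,3,4,5)] hankel_integrable[OF assms(2,3,4,5)] by simp
  finally show ?thesis .
qed

text \<open>
  The function whose derivative is integrated is $f(x)\, x^{\alpha+e_l}$ times the Bessel factors.  The
  additional factor $x_l$ makes it vanish on the face $x_l = 0$, so there is no boundary term.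
\<close>
lemma hankel_integration_by_parts:
  fixes \<alpha> \<nu> :: "real ^ 'n"
  assumes f: "f \<in> orthant_schwartz" and \<alpha>: "\<And>l. 0 \<le> \<alpha> $ l" and \<nu>: "\<And>l. 0 \<le> \<nu> $ l"
    and t: "t \<in> closed_orthant"
  shows "hankel_integral r (\<alpha> + axis l 1) \<nu> (pd l f) t + of_real (\<alpha> $ l + 1) * hankel_integral r \<alpha> \<nu> f t
    - of_real (r $ l * t $ l) * hankel_integral r (\<alpha> + axis l 1) (\<nu> + axis l 1) f t = 0"
proof -
  let ?a = "\<alpha> + axis l 1" and ?n = "\<nu> + axis l 1"
  note a = nonneg_add_axis[of \<alpha> l, OF \<alpha>] and n = nonneg_add_axis[of \<nu> l, OF \<nu>]
  note p = schwartz_pd[OF f, of l]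
  define F where "F x = f x * of_real (kern r ?a \<nu> x t)" for x
  define D1 where "D1 x = pd l f x * of_real (kern r ?a \<nu> x t)" for x
  define D2 where "D2 x = f x * of_real (kern r \<alpha> \<nu> x t)" for x
  define D3 where "D3 x = f x * of_real (kern r ?a ?n x t)" for x
  define D where "D x = D1 x + of_real (\<alpha> $ l + 1) * D2 x - of_real (r $ l * t $ l) * D3 x" for x
  have iF: "integrable lborel F" unfolding F_def by (rule hankel_integrable[OF f a \<nu> t])
  have i1: "integrable lborel D1" unfolding D1_def by (rule hankel_integrable[OF p a \<nu> t])
  have i2: "integrable lborel D2" unfolding D2_def by (rule hankel_integrable[OF f \<alpha> \<nu> t])
  have i3: "integrable lborel D3" unfolding D3_def by (rule hankel_integrable[OF f a n t])
  have iD: "integrable lborel D" unfolding D_def by (intro Bochner_Integration.integrable_add Bochner_Integration.integrable_diff integrable_mult_right i1 i2 i3)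
  obtain C1 where C1: "0 \<le> C1" "\<And>x. x \<in> pos_orthant \<Longrightarrow> cmod (D1 x) \<le> C1 * decay x"
    unfolding D1_def using kern_product_bound[OF p a \<nu>] t by metis
  obtain C2 where C2: "0 \<le> C2" "\<And>x. x \<in> pos_orthant \<Longrightarrow> cmod (D2 x) \<le> C2 * decay x"
    unfolding D2_def using kern_product_bound[OF f \<alpha> \<nu>] t by metis
  obtain C3 where C3: "0 \<le> C3" "\<And>x. x \<in> pos_orthant \<Longrightarrow> cmod (D3 x) \<le> C3 * decay x"
    unfolding D3_def using kern_product_bound[OF f a n] t by metis
  define C where "C = C1 + (\<bar>\<alpha> $ l + 1\<bar> + 1) * C2 + \<bar>r $ l * t $ l\<bar> * C3"
  have "integral\<^sup>L lborel D = 0"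
  proof (rule integral_partial_eq_0[OF iF])
    show "F x = 0" "D x = 0" if "x \<notin> pos_orthant" for x
      using schwartz_zero[OF f that] schwartz_zero[OF p that]
      by (auto simp: F_def D_def D1_def D2_def D3_def)
    show "D \<in> borel_measurable borel" using iD by simp
    fix x :: "real ^ 'n" assume x: "x \<in> pos_orthant"
    show "has_partial l F (D x) x"
      using has_partial_mult[OF schwartz_has_partial[OF f x, of l] has_partial_kern[OF x \<nu>, of l r \<alpha> t]]
      unfolding F_def D_def D1_def D2_def D3_def by (simp add: algebra_simps)
    have "cmod (F x) = cmod (D2 x) * x $ l"
      using pos_orthantD[OF x, of l] by (simp add: F_def D2_def kern_shift[OF x] norm_mult)
    also have "\<dots> \<le> C2 * x $ l"
      using C2 pos_orthantD[OF x, of l] mult_left_mono[OF decay_le_1[of x] C2(1)]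
      by (intro mult_right_mono order_trans[OF C2(2)[OF x]]) auto
    also have "\<dots> \<le> C * x $ l"
    proof -
      have "C2 \<le> C" unfolding C_def using C1(1) C2(1) C3(1) by (simp add: algebra_simps add_nonneg_nonneg)
      then show ?thesis using pos_orthantD[OF x, of l] by (intro mult_right_mono) auto
    qed
    finally show "cmod (F x) \<le> C * x $ l" .
    have "cmod (D x) \<le> cmod (D1 x) + \<bar>\<alpha> $ l + 1\<bar> * cmod (D2 x) + \<bar>r $ l * t $ l\<bar> * cmod (D3 x)"
      unfolding D_def
      by (intro order_trans[OF norm_triangle_ineq4] add_mono order_trans[OF norm_triangle_ineq])
        (simp_all only: norm_mult norm_of_real order_refl)
    also have "\<dots> \<le> C1 * decay x + \<bar>\<alpha> $ l + 1\<bar> * (C2 * decay x) + \<bar>r $ l * t $ l\<bar> * (C3 * decay x)"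
      by (intro add_mono mult_left_mono C1 C2 C3 x) auto
    also have "\<dots> \<le> C * decay x"
      using mult_nonneg_nonneg[OF C2(1) decay_nonneg[of x]] by (simp add: C_def algebra_simps)
    finally show "cmod (D x) \<le> C * decay x" .
  qed
  moreover have "integral\<^sup>L lborel D = integral\<^sup>L lborel D1 + of_real (\<alpha> $ l + 1) * integral\<^sup>L lborel D2
      - of_real (r $ l * t $ l) * integral\<^sup>L lborel D3"
    unfolding D_def using i1 i2 i3 by simp
  ultimately show ?thesis
    by (simp add: hankel_integral_def D1_def[abs_def] D2_def[abs_def] D3_def[abs_def])
qed

text \<open>
  In the case \<open>\<alpha> = \<mu>\<close>, \<open>\<nu> = \<mu> + axis l 1\<close> the recurrence merges the two terms of the integration by
  parts in which \<open>f\<close> is not differentiated.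
\<close>
lemma hankel_integral_pd:
  fixes \<mu> :: "real ^ 'n"
  assumes f: "f \<in> orthant_schwartz" and \<mu>: "\<And>l. 0 \<le> \<mu> $ l" and t: "t \<in> closed_orthant"
  shows "hankel_integral r (\<mu> + axis l 1) (\<mu> + axis l 1) (pd l f) t = - hankel_integral r \<mu> \<mu> f t"
proof -
  note n = nonneg_add_axis[of \<mu> l, OF \<mu>]
  note n2 = nonneg_add_axis[of "\<mu> + axis l 1" l, OF n]
  have "of_real (\<mu> $ l + 1) * hankel_integral r \<mu> (\<mu> + axis l 1) f t
      - of_real (r $ l * t $ l) * hankel_integral r (\<mu> + axis l 1) (\<mu> + axis l 1 + axis l 1) f t
    = (LINT x|lborel. of_real (\<mu> $ l + 1) * (f x * of_real (kern r \<mu> (\<mu> + axis l 1) x t))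
        - of_real (r $ l * t $ l) * (f x * of_real (kern r (\<mu> + axis l 1) (\<mu> + axis l 1 + axis l 1) x t)))"
    unfolding hankel_integral_def
    using hankel_integrable[OF f \<mu> n t] hankel_integrable[OF f n n2 t] by simp
  also have "\<dots> = hankel_integral r \<mu> \<mu> f t"
    unfolding hankel_integral_def
  proof (rule Bochner_Integration.integral_cong[OF refl])
    fix x :: "real ^ 'n"
    show "of_real (\<mu> $ l + 1) * (f x * of_real (kern r \<mu> (\<mu> + axis l 1) x t))
        - of_real (r $ l * t $ l) * (f x * of_real (kern r (\<mu> + axis l 1) (\<mu> + axis l 1 + axis l 1) x t))
      = f x * of_real (kern r \<mu> \<mu> x t)"
    proof (cases "x \<in> pos_orthant")
      case True
      show ?thesis
        unfolding kern_recurrence[OF True \<mu>, of l r \<mu> t, symmetric] by (simp add: algebra_simps)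
    qed (simp add: schwartz_zero[OF f])
  qed
  finally show ?thesis
    using hankel_integration_by_parts[OF f \<mu> n t, of l] by (simp add: algebra_simps eq_neg_iff_add_eq_0)
qed

text \<open>
  The case \<open>\<alpha> = \<nu> = \<mu>\<close> of the integration by parts; the factor $x_l$ is moved from the kernel to the
  function.
\<close>
lemma hankel_integral_mult_axis:
  fixes \<mu> :: "real ^ 'n"
  assumes f: "f \<in> orthant_schwartz" and \<mu>: "\<And>l. 0 \<le> \<mu> $ l" and t: "t \<in> closed_orthant"
  shows "of_real (r $ l * t $ l) * hankel_integral r (\<mu> + axis l 1) (\<mu> + axis l 1) f t
    = hankel_integral r \<mu> \<mu> (\<lambda>x. 1 * xmult l (pd l f) x + of_real (\<mu> $ l + 1) * f x) t"
proof -
  have "hankel_integral r (\<mu> + axis l 1) \<mu> (pd l f) t = hankel_integral r \<mu> \<mu> (xmult l (pd l f)) t"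
    unfolding hankel_integral_def
  proof (rule Bochner_Integration.integral_cong[OF refl])
    fix x :: "real ^ 'n"
    show "pd l f x * of_real (kern r (\<mu> + axis l 1) \<mu> x t) = xmult l (pd l f) x * of_real (kern r \<mu> \<mu> x t)"
      by (cases "x \<in> pos_orthant") (simp_all add: kern_shift xmult_def pd_outside)
  qed
  then show ?thesis
    using hankel_integration_by_parts[OF f \<mu> \<mu> t, of l]
    unfolding hankel_integral_lincomb[OF schwartz_xmult[OF schwartz_pd[OF f]] f \<mu> \<mu> t]
    by (simp add: algebra_simps)
qed

text \<open>
  One application of each of the two preceding identities.  Decay of the transform is paid for with
  derivatives of \<open>f\<close>.
\<close>
lemma hankel_integral_coord_mult:
  fixes \<mu> :: "real ^ 'n"
  assumes f: "f \<in> orthant_schwartz" and \<mu>: "\<And>l. 0 \<le> \<mu> $ l" and t: "t \<in> closed_orthant"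
  shows "of_real (r $ l * t $ l) * hankel_integral r \<mu> \<mu> f t = - hankel_integral r \<mu> \<mu> (bessel_op l (\<mu> $ l) f) t"
  using hankel_integral_pd[OF f \<mu> t, of l] hankel_integral_mult_axis[OF schwartz_pd[OF f] \<mu> t, of l l]
  unfolding bessel_op_def by (metis mult_minus_right neg_equal_iff_equal minus_minus)

text \<open>
  Every factor $t_l$ is traded for a Bessel operator, until the uniform bound on the kernel suffices.
  The bound is uniform in \<open>f\<close> and serves both for membership in the Schwartz space and for
  continuity.
\<close>
lemma hankel_integral_decay:
  fixes \<mu> :: "real ^ 'n"
  assumes \<mu>: "\<And>l. 0 \<le> \<mu> $ l"
  shows "\<exists>q. seminorm_bounded q \<and> (\<forall>f\<in>orthant_schwartz. \<forall>t\<in>pos_orthant.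
    monomial t (real_vec k) * cmod (hankel_integral r \<mu> \<mu> f t) \<le> q f)"
proof (induction k rule: multiindex_induct)
  case zero
  obtain q where q: "seminorm_bounded q"
    "\<And>f t. f \<in> orthant_schwartz \<Longrightarrow> t \<in> closed_orthant \<Longrightarrow> cmod (hankel_integral r \<mu> \<mu> f t) \<le> q f"
    using hankel_integral_bound[OF \<mu> \<mu>] by blast
  have "monomial t (real_vec 0) = 1" if "t \<in> pos_orthant" for t :: "real ^ 'n"
    unfolding monomial_def using pos_orthantD[OF that] by (intro prod.neutral) (auto simp: less_imp_neq[symmetric])
  then show ?case using q pos_orthant_subset_closed by (intro exI[of _ q]) auto
next
  case (add k l)
  then obtain q where q: "seminorm_bounded q"
    "\<And>f t. f \<in> orthant_schwartz \<Longrightarrow> t \<in> pos_orthant \<Longrightarrow>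
      monomial t (real_vec k) * cmod (hankel_integral r \<mu> \<mu> f t) \<le> q f" by blast
  define q' where "q' f = inverse (r $ l) * q (bessel_op l (\<mu> $ l) f)" for f
  have "seminorm_bounded q'"
    unfolding q'_def using r_pos[of l]
    by (intro seminorm_bounded_cmult seminorm_bounded_compose[OF q(1)] continuous_op_bessel_op) auto
  moreover have "monomial t (real_vec (k + axis l 1)) * cmod (hankel_integral r \<mu> \<mu> f t) \<le> q' f"
    if f: "f \<in> orthant_schwartz" and t: "t \<in> pos_orthant" for f t
  proof -
    have tc: "t \<in> closed_orthant" using t pos_orthant_subset_closed by blast
    have B: "bessel_op l (\<mu> $ l) f \<in> orthant_schwartz"
      using continuous_op_bessel_op f unfolding continuous_op_def by blast
    have "r $ l * t $ l * cmod (hankel_integral r \<mu> \<mu> f t) = cmod (of_real (r $ l * t $ l) * hankel_integral r \<mu> \<mu> f t)"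
      using r_pos[of l] pos_orthantD[OF t, of l] by (simp add: norm_mult)
    also have "\<dots> = cmod (hankel_integral r \<mu> \<mu> (bessel_op l (\<mu> $ l) f) t)"
      unfolding hankel_integral_coord_mult[OF f \<mu> tc] by simp
    finally have "t $ l * cmod (hankel_integral r \<mu> \<mu> f t)
        = inverse (r $ l) * cmod (hankel_integral r \<mu> \<mu> (bessel_op l (\<mu> $ l) f) t)"
      using r_pos[of l] by (simp add: field_simps)
    then have "monomial t (real_vec (k + axis l 1)) * cmod (hankel_integral r \<mu> \<mu> f t)
        = inverse (r $ l) * (monomial t (real_vec k) * cmod (hankel_integral r \<mu> \<mu> (bessel_op l (\<mu> $ l) f) t))"
      unfolding real_vec_add_axis monomial_add monomial_axis[OF t]
      using pos_orthantD[OF t, of l] by (simp add: mult.assoc mult.left_commute)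
    also have "\<dots> \<le> q' f"
      unfolding q'_def using q(2)[OF B t] r_pos[of l] by (intro mult_left_mono) auto
    finally show ?thesis .
  qed
  ultimately show ?case by blast
qed

text \<open>
  Continuity up to the boundary provides the continuous extensions that a Schwartz function must have.
\<close>
lemma hankel_integral_continuous:
  fixes \<alpha> \<nu> :: "real ^ 'n"
  assumes f: "f \<in> orthant_schwartz" and \<alpha>: "\<And>l. 0 \<le> \<alpha> $ l" and \<nu>: "\<And>l. 0 \<le> \<nu> $ l"
  shows "continuous_on closed_orthant (hankel_integral r \<alpha> \<nu> f)"
  unfolding continuous_on_sequentially
proof (intro allI ballI impI, elim conjE)
  fix X :: "nat \<Rightarrow> real ^ 'n" and t assume t: "t \<in> closed_orthant" and X: "\<forall>n. X n \<in> closed_orthant" "X \<longlonglongrightarrow> t"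
  obtain C where C: "0 \<le> C" "\<And>x t. x \<in> pos_orthant \<Longrightarrow> t \<in> closed_orthant \<Longrightarrow>
    cmod (f x * of_real (kern r \<alpha> \<nu> x t)) \<le> C * decay x"
    using kern_product_bound[OF f \<alpha> \<nu>] by blast
  have "(\<lambda>n. LINT x|lborel. f x * of_real (kern r \<alpha> \<nu> x (X n))) \<longlonglongrightarrow> (LINT x|lborel. f x * of_real (kern r \<alpha> \<nu> x t))"
  proof (rule integral_dominated_convergence[where w = "\<lambda>x. C * decay x"])
    show "(\<lambda>x. f x * of_real (kern r \<alpha> \<nu> x t)) \<in> borel_measurable lborel"
      using hankel_integrable[OF f \<alpha> \<nu> t] by simp
    show "(\<lambda>x. f x * of_real (kern r \<alpha> \<nu> x (X n))) \<in> borel_measurable lborel" for n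
      using hankel_integrable[OF f \<alpha> \<nu>] X(1) by (blast intro: borel_measurable_integrable)
    show "integrable lborel (\<lambda>x :: real ^ 'n. C * decay x)" by (intro integrable_mult_right integrable_decay)
    have "isCont (kern r \<alpha> \<nu> x) t" for x
    proof -
      have "continuous_on UNIV (kern r \<alpha> \<nu> x)"
        unfolding kern_def by (intro continuous_intros continuous_on_clifford \<nu>)
      then show ?thesis by (simp add: continuous_on_eq_continuous_at)
    qed
    then show "AE x in lborel. (\<lambda>n. f x * of_real (kern r \<alpha> \<nu> x (X n))) \<longlonglongrightarrow> f x * of_real (kern r \<alpha> \<nu> x t)"
      using X(2) by (intro AE_I2 tendsto_mult tendsto_const tendsto_of_real isCont_tendsto_compose[where g = "kern r \<alpha> \<nu> _"]) auto
    show "AE x in lborel. norm (f x * of_real (kern r \<alpha> \<nu> x (X n))) \<le> C * decay x" for n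
    proof (rule AE_I2)
      fix x show "norm (f x * of_real (kern r \<alpha> \<nu> x (X n))) \<le> C * decay x"
        using C(2) X(1) C(1) decay_nonneg[of x] by (cases "x \<in> pos_orthant") (auto simp: schwartz_zero[OF f])
    qed
  qed
  then show "(hankel_integral r \<alpha> \<nu> f \<circ> X) \<longlonglongrightarrow> hankel_integral r \<alpha> \<nu> f t"
    by (simp add: hankel_integral_def o_def)
qed

lemma has_partial_hankel_integral:
  fixes \<alpha> \<nu> :: "real ^ 'n"
  assumes f: "f \<in> orthant_schwartz" and \<alpha>: "\<And>l. 0 \<le> \<alpha> $ l" and \<nu>: "\<And>l. 0 \<le> \<nu> $ l"
    and t: "t \<in> pos_orthant"
  shows "has_partial l (hankel_integral r \<alpha> \<nu> f)
    (- of_real (r $ l) * hankel_integral r (\<alpha> + axis l 1) (\<nu> + axis l 1) f t) t"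
proof -
  note a = nonneg_add_axis[of \<alpha> l, OF \<alpha>] and n = nonneg_add_axis[of \<nu> l, OF \<nu>]
  define y where "y s = t + s *\<^sub>R axis l 1" for s
  define \<delta> where "\<delta> = t $ l"
  have \<delta>: "0 < \<delta>" using pos_orthantD[OF t] by (simp add: \<delta>_def)
  have y: "y s \<in> closed_orthant" if "\<bar>s\<bar> < \<delta>" for s
    unfolding closed_orthant_def y_def using that pos_orthantD[OF t]
    by (auto simp: axis_def \<delta>_def less_imp_le)
  obtain C where C: "0 \<le> C" "\<And>x t. x \<in> pos_orthant \<Longrightarrow> t \<in> closed_orthant \<Longrightarrow>
    cmod (f x * of_real (kern r (\<alpha> + axis l 1) (\<nu> + axis l 1) x t)) \<le> C * decay x"
    using kern_product_bound[OF f a n] by blast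
  define g where "g s x = f x * of_real (kern r \<alpha> \<nu> x (y s))" for s x
  define g' where "g' s x = f x * of_real (- (r $ l * kern r (\<alpha> + axis l 1) (\<nu> + axis l 1) x (y s)))" for s x
  have "((\<lambda>s. integral\<^sup>L lborel (g s)) has_vector_derivative integral\<^sup>L lborel (g' 0)) (at 0)"
  proof (rule has_vector_derivative_integral_dominated[OF \<delta>, where G = "\<lambda>x. r $ l * (C * decay x)"])
    fix s x assume s: "\<bar>s\<bar> < \<delta>"
    show "integrable lborel (g s)" unfolding g_def by (rule hankel_integrable[OF f \<alpha> \<nu> y[OF s]])
    show "((\<lambda>s. g s x) has_vector_derivative g' s x) (at s)"
    proof (cases "x \<in> pos_orthant")
      case True
      show ?thesis
        unfolding g_def g'_def y_def
        by (intro has_vector_derivative_mult_right has_partial_line has_partial_kern_snd True \<nu>)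
    qed (simp add: g_def g'_def schwartz_zero[OF f])
    have "cmod (g' s x) = r $ l * cmod (f x * of_real (kern r (\<alpha> + axis l 1) (\<nu> + axis l 1) x (y s)))"
      using r_pos[of l] by (simp add: g'_def norm_mult)
    also have "\<dots> \<le> r $ l * (C * decay x)"
      using C(2)[OF _ y[OF s], of x] C(1) r_pos[of l] decay_nonneg[of x]
      by (intro mult_left_mono) (cases "x \<in> pos_orthant", auto simp: schwartz_zero[OF f])
    finally show "cmod (g' s x) \<le> r $ l * (C * decay x)" .
  next
    show "integrable lborel (\<lambda>x :: real ^ 'n. r $ l * (C * decay x))"
      by (intro integrable_mult_right integrable_decay)
    have [measurable]: "f \<in> borel_measurable borel" by (rule schwartz_borel_measurable[OF f])
    note borel_measurable_kern(1)[OF n, measurable]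
    show "g' 0 \<in> borel_measurable borel" unfolding g'_def by measurable
  qed
  moreover have "integral\<^sup>L lborel (g' 0) = - of_real (r $ l) * hankel_integral r (\<alpha> + axis l 1) (\<nu> + axis l 1) f t"
  proof -
    have "g' 0 = (\<lambda>x. - of_real (r $ l) * (f x * of_real (kern r (\<alpha> + axis l 1) (\<nu> + axis l 1) x t)))"
      by (auto simp: g'_def y_def)
    then show ?thesis unfolding hankel_integral_def by (simp only: integral_mult_right_zero)
  qed
  ultimately show ?thesis
    unfolding has_partial_def by (simp add: hankel_integral_def g_def[abs_def] y_def)
qed

end

definition hankel ::
    "real ^ 'n \<Rightarrow> real ^ 'n \<Rightarrow> (real ^ 'n \<Rightarrow> complex) \<Rightarrow> real ^ 'n \<Rightarrow> complex" where
  "hankel r \<mu> f = orthant_part (hankel_integral r \<mu> \<mu> f)"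

lemma hankel_outside: "t \<notin> pos_orthant \<Longrightarrow> hankel r \<mu> f t = 0"
  by (simp add: hankel_def orthant_part_def)

lemma hankel_apply: "t \<in> pos_orthant \<Longrightarrow> hankel r \<mu> f t = hankel_integral r \<mu> \<mu> f t"
  by (simp add: hankel_def orthant_part_def)

context
  fixes r :: "real ^ 'n"
  assumes r_pos: "\<And>l. 0 < r $ l"
begin

lemma has_partial_hankel:
  assumes "f \<in> orthant_schwartz" "\<And>l. 0 \<le> \<mu> $ l" "t \<in> pos_orthant"
  shows "has_partial l (hankel r \<mu> f) (- of_real (r $ l) * hankel r (\<mu> + axis l 1) f t) t"
  using has_partial_cong[OF has_partial_hankel_integral[OF r_pos assms(1,2,2,3), of l] assms(3), of "hankel r \<mu> f"]
  by (simp add: hankel_apply assms(3))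

lemma pd_hankel:
  assumes "f \<in> orthant_schwartz" "\<And>l. 0 \<le> \<mu> $ l"
  shows "pd l (hankel r \<mu> f) = (\<lambda>t. - of_real (r $ l) * hankel r (\<mu> + axis l 1) f t)"
  by (rule pd_eqI) (use has_partial_hankel[OF assms] in \<open>auto simp: hankel_outside\<close>)

lemma rapidly_decreasing_hankel:
  assumes f: "f \<in> orthant_schwartz" and \<mu>: "\<And>l. 0 \<le> \<mu> $ l"
  shows "rapidly_decreasing (hankel r \<mu> f)"
proof (rule rapidly_decreasingI[where g = "hankel_integral r \<mu> \<mu> f"])
  show "\<exists>C. \<forall>t\<in>pos_orthant. monomial t (real_vec k) * cmod (hankel r \<mu> f t) \<le> C" for k :: "nat ^ 'n"
    using hankel_integral_decay[OF r_pos \<mu>, of k] f by (auto simp: hankel_apply)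
qed (use hankel_integral_continuous[OF r_pos f \<mu> \<mu>] in \<open>auto simp: hankel_outside hankel_apply\<close>)

lemma schwartz_hankel:
  assumes f: "f \<in> orthant_schwartz" and \<mu>: "\<And>l. 0 \<le> \<mu> $ l"
  shows "hankel r \<mu> f \<in> orthant_schwartz"
proof (rule schwartz_coinduct[where X = "{\<lambda>t. c * hankel r \<mu> f t | c \<mu>. \<forall>l. 0 \<le> \<mu> $ l}"])
  show "hankel r \<mu> f \<in> {\<lambda>t. c * hankel r \<mu> f t | c \<mu>. \<forall>l. 0 \<le> \<mu> $ l}"
    using \<mu> by (intro CollectI exI[of _ 1] exI[of _ \<mu>]) simp
  fix h l assume "h \<in> {\<lambda>t. c * hankel r \<mu> f t | c \<mu>. \<forall>l. 0 \<le> \<mu> $ l}"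
  then obtain c \<mu> where h: "h = (\<lambda>t. c * hankel r \<mu> f t)" and \<mu>: "\<And>l. 0 \<le> \<mu> $ l" by blast
  show "rapidly_decreasing h"
    using rapidly_decreasing_lincomb[OF rapidly_decreasing_hankel[OF f \<mu>] rapidly_decreasing_hankel[OF f \<mu>], where a = c and b = 0]
    by (simp add: h)
  have hp: "has_partial l h (c * (- of_real (r $ l)) * hankel r (\<mu> + axis l 1) f t) t" if "t \<in> pos_orthant" for t
    using has_partial_lincomb[OF has_partial_hankel[OF f \<mu> that] has_partial_hankel[OF f \<mu> that], where a = c and b = 0]
    by (simp add: h mult.assoc)
  then show "partial_exists l h t" if "t \<in> pos_orthant" for t
    using has_partial_imp(1) that by blast
  have "pd l h = (\<lambda>t. c * (- of_real (r $ l)) * hankel r (\<mu> + axis l 1) f t)"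
    by (rule pd_eqI) (use hp in \<open>auto simp: hankel_outside\<close>)
  then show "pd l h \<in> {\<lambda>t. c * hankel r \<mu> f t | c \<mu>. \<forall>l. 0 \<le> \<mu> $ l}"
    using nonneg_add_axis[OF \<mu>]
    by (intro CollectI exI[of _ "c * (- of_real (r $ l))"] exI[of _ "\<mu> + axis l 1"]) auto
qed

lemma continuous_op_hankel:
  assumes \<mu>: "\<And>l. 0 \<le> \<mu> $ l"
  shows "continuous_op (hankel r \<mu>)"
proof (rule continuous_op_family[where \<T> = "{\<lambda>f t. c * hankel r \<mu> f t | c \<mu>. \<forall>l. 0 \<le> \<mu> $ l}"])
  show "hankel r \<mu> \<in> {\<lambda>f t. c * hankel r \<mu> f t | c \<mu>. \<forall>l. 0 \<le> \<mu> $ l}"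
    using \<mu> by (intro CollectI exI[of _ 1] exI[of _ \<mu>]) simp
  fix T assume "T \<in> {\<lambda>f t. c * hankel r \<mu> f t | c \<mu>. \<forall>l. 0 \<le> \<mu> $ l}"
  then obtain c \<mu> where T: "T = (\<lambda>f t. c * hankel r \<mu> f t)" and \<mu>: "\<And>l. 0 \<le> \<mu> $ l" by blast
  show S: "T f \<in> orthant_schwartz" if "f \<in> orthant_schwartz" for f
    unfolding T by (rule schwartz_cmult[OF schwartz_hankel schwartz_hankel]) (use that \<mu> in auto)
  show "seminorm_bounded (\<lambda>f. schwartz_seminorm k 0 (T f))" for k
  proof -
    obtain q where q: "seminorm_bounded q" "\<And>f t. f \<in> orthant_schwartz \<Longrightarrow> t \<in> pos_orthant \<Longrightarrow>
        monomial t (real_vec k) * cmod (hankel_integral r \<mu> \<mu> f t) \<le> q f"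
      using hankel_integral_decay[OF r_pos \<mu>, of k] by blast
    have "seminorm_bounded (\<lambda>f. cmod c * q f)"
      by (intro seminorm_bounded_cmult q) auto
    then show ?thesis
    proof (rule seminorm_bounded_mono)
      fix f :: "real ^ 'n \<Rightarrow> complex" assume f: "f \<in> orthant_schwartz"
      have "monomial t (real_vec k) * cmod (Dp 0 (T f) t) \<le> cmod c * q f" if t: "t \<in> pos_orthant" for t
        using mult_left_mono[OF q(2)[OF f t], of "cmod c"]
        by (simp add: Dp_zero T hankel_apply[OF t] norm_mult mult.left_commute)
      then show "schwartz_seminorm k 0 (T f) \<le> cmod c * q f"
        unfolding seminorm_le_iff[OF S[OF f]] by blast
    qed
  qed
  fix l
  have pd: "pd l (T f) = (\<lambda>t. (c * - of_real (r $ l)) * hankel r (\<mu> + axis l 1) f t + 0)"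
    if f: "f \<in> orthant_schwartz" for f
    unfolding T pd_cmult[OF schwartz_hankel[OF f \<mu>] schwartz_hankel[OF f \<mu>]] pd_hankel[OF f \<mu>]
    by (simp add: mult.assoc)
  have "(\<lambda>f t. (c * - of_real (r $ l)) * hankel r (\<mu> + axis l 1) f t) \<in> {\<lambda>f t. c * hankel r \<mu> f t | c \<mu>. \<forall>l. 0 \<le> \<mu> $ l}"
    using nonneg_add_axis[OF \<mu>]
    by (intro CollectI exI[of _ "c * (- of_real (r $ l))"] exI[of _ "\<mu> + axis l 1"]) auto
  then show "\<exists>T'\<in>{\<lambda>f t. c * hankel r \<mu> f t | c \<mu>. \<forall>l. 0 \<le> \<mu> $ l}. \<exists>A B. continuous_op A \<and> continuous_op B \<and>
       (\<forall>f\<in>orthant_schwartz. pd l (T f) = (\<lambda>x. T' (A f) x + B f x))"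
    using pd continuous_op_id continuous_op_0 by (rule_tac bexI) (rule exI[of _ "\<lambda>f. f"], rule exI[of _ "\<lambda>f x. 0"], auto)
qed

lemma hankel_lincomb:
  assumes "f \<in> orthant_schwartz" "g \<in> orthant_schwartz" "\<And>l. 0 \<le> \<mu> $ l"
  shows "hankel r \<mu> (\<lambda>x. a * f x + b * g x) = (\<lambda>x. a * hankel r \<mu> f x + b * hankel r \<mu> g x)"
proof
  fix t
  show "hankel r \<mu> (\<lambda>x. a * f x + b * g x) t = a * hankel r \<mu> f t + b * hankel r \<mu> g t"
    using hankel_integral_lincomb[OF r_pos assms(1,2,3,3)] pos_orthant_subset_closed
    by (cases "t \<in> pos_orthant") (auto simp: hankel_apply hankel_outside)
qed

lemma hankel_pd:
  assumes "f \<in> orthant_schwartz" "\<And>l. 0 \<le> \<mu> $ l"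
  shows "hankel r (\<mu> + axis l 1) (pd l f) = (\<lambda>t. - hankel r \<mu> f t)"
proof
  fix t
  show "hankel r (\<mu> + axis l 1) (pd l f) t = - hankel r \<mu> f t"
    using hankel_integral_pd[OF r_pos assms] pos_orthant_subset_closed
    by (cases "t \<in> pos_orthant") (auto simp: hankel_apply hankel_outside)
qed

lemma kern_symmetric: "monomial t \<mu> * kern r \<mu> \<nu> x t = monomial x \<mu> * kern r \<mu> \<nu> t x"
  unfolding monomial_def kern_def prod.distrib[symmetric]
  by (intro prod.cong refl) (simp add: mult.assoc mult.left_commute mult.commute)

text \<open>
  After multiplication with $t^\mu$ the kernel is symmetric in \<open>x\<close> and \<open>t\<close>, and it is bounded apart from
  the two weights; so this is Fubini's theorem.
\<close>
lemma hankel_symmetric: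
  fixes f g :: "real ^ 'n \<Rightarrow> complex"
  assumes \<mu>: "\<And>l. 0 \<le> \<mu> $ l"
    and f: "integrable lborel (\<lambda>x. f x * of_real (monomial x \<mu>))" "f \<in> borel_measurable borel"
      "\<And>x. x \<notin> pos_orthant \<Longrightarrow> f x = 0"
    and g: "integrable lborel (\<lambda>x. g x * of_real (monomial x \<mu>))" "g \<in> borel_measurable borel"
      "\<And>x. x \<notin> pos_orthant \<Longrightarrow> g x = 0"
  shows "(LINT t|lborel. g t * of_real (monomial t \<mu>) * hankel_integral r \<mu> \<mu> f t)
    = (LINT x|lborel. f x * of_real (monomial x \<mu>) * hankel_integral r \<mu> \<mu> g x)"
proof -
  define H where "H x t = f x * g t * of_real (monomial t \<mu> * kern r \<mu> \<mu> x t)" for x t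
  note [measurable] = f(2) g(2) borel_measurable_kern(2)[OF \<mu>, of r \<mu>, unfolded split_beta]
  have [measurable]: "(\<lambda>x :: real ^ 'n. x $ l) \<in> borel_measurable borel" for l
    by (intro borel_measurable_continuous_onI continuous_intros)
  have [measurable]: "(\<lambda>x. monomial x \<mu>) \<in> borel_measurable (borel :: (real ^ 'n) measure)"
    unfolding monomial_def by measurable
  have Hm: "case_prod H \<in> borel_measurable (lborel \<Otimes>\<^sub>M lborel)"
    unfolding H_def split_beta by measurable
  define B where "B x t = clifford_bound \<mu> * (cmod (f x * of_real (monomial x \<mu>)) * cmod (g t * of_real (monomial t \<mu>)))" for x t
  have bnd: "cmod (H x t) \<le> B x t" for x t
  proof (cases "x \<in> pos_orthant \<and> t \<in> pos_orthant")
    case True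
    then have "\<bar>kern r \<mu> \<mu> x t\<bar> \<le> clifford_bound \<mu> * monomial x \<mu>"
      using pos_orthant_subset_closed by (intro abs_kern_le_monomial \<mu> r_pos) auto
    then have "cmod (f x) * cmod (g t) * monomial t \<mu> * \<bar>kern r \<mu> \<mu> x t\<bar>
        \<le> cmod (f x) * cmod (g t) * monomial t \<mu> * (clifford_bound \<mu> * monomial x \<mu>)"
      by (intro mult_left_mono mult_nonneg_nonneg monomial_nonneg) auto
    then show ?thesis by (simp add: H_def B_def norm_mult abs_mult monomial_nonneg mult_ac)
  next
    case False
    then have "H x t = 0" using f(3) g(3) by (auto simp: H_def)
    then show ?thesis
      unfolding B_def using clifford_bound_nonneg[OF \<mu>] by (auto intro!: mult_nonneg_nonneg)
  qed
  have iB: "integrable (lborel \<Otimes>\<^sub>M lborel) (case_prod B)"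
  proof (rule lborel_pair.Fubini_integrable)
    show "case_prod B \<in> borel_measurable (lborel \<Otimes>\<^sub>M lborel)"
      unfolding B_def split_beta by measurable
    have B0: "norm (B x t) = B x t" for x t
      unfolding B_def using clifford_bound_nonneg[OF \<mu>] by (auto intro!: mult_nonneg_nonneg)
    show "integrable lborel (\<lambda>x. LINT t|lborel. norm (case_prod B (x, t)))"
      unfolding split_conv B0 unfolding B_def using f(1) g(1) by (auto intro!: integrable_mult_left integrable_mult_right)
    show "AE x in lborel. integrable lborel (\<lambda>t. case_prod B (x, t))"
      unfolding split_conv B_def using g(1) by (auto intro!: integrable_mult_left integrable_mult_right)
  qed
  have iH: "integrable (lborel \<Otimes>\<^sub>M lborel) (case_prod H)"
    by (rule Bochner_Integration.integrable_bound[OF iB Hm]) (use order_trans[OF bnd abs_ge_self] in auto)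
  have "(LINT t|lborel. g t * of_real (monomial t \<mu>) * hankel_integral r \<mu> \<mu> f t) = (LINT t|lborel. LINT x|lborel. H x t)"
    unfolding hankel_integral_def H_def
    by (subst integral_mult_right_zero[symmetric]) (simp add: mult_ac)
  also have "\<dots> = (LINT x|lborel. LINT t|lborel. H x t)"
    by (rule lborel_pair.Fubini_integral[OF iH])
  also have "\<dots> = (LINT x|lborel. f x * of_real (monomial x \<mu>) * hankel_integral r \<mu> \<mu> g x)"
    unfolding hankel_integral_def H_def kern_symmetric
    by (subst integral_mult_right_zero[symmetric]) (simp add: mult_ac)
  finally show ?thesis .
qed

end

lemma has_bochner_integral_powr_exp:
  assumes "0 < s" "0 < b"
  shows "has_bochner_integral lborel (\<lambda>x :: real. indicator {0<..} x * (x powr (s - 1) * exp (- (b * x)))) (Gamma s * b powr (- s))"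
proof -
  have nn: "(\<integral>\<^sup>+x. ennreal (indicator {0..} x * x powr (s - 1) / exp (x :: real)) \<partial>lborel) = ennreal (Gamma s)"
    using Gamma_conv_nn_integral_real[OF assms(1)] by simp
  have "has_bochner_integral lborel (\<lambda>x :: real. indicator {0..} x * x powr (s - 1) / exp (x :: real)) (Gamma s)"
    by (rule has_bochner_integral_nn_integral[OF _ _ _ nn]) (use assms in \<open>auto intro: Gamma_real_nonneg\<close>)
  then have "has_bochner_integral lborel (\<lambda>x :: real. indicator {0..} (0 + b * x) * (0 + b * x) powr (s - 1) / exp (0 + b * x)) (Gamma s /\<^sub>R \<bar>b\<bar>)"
    using assms(2) by (intro lborel_has_bochner_integral_real_affine_iff[THEN iffD1]) auto
  then have "has_bochner_integral lborel (\<lambda>x :: real. b powr (1 - s) * (indicator {0..} (0 + b * x) * (0 + b * x) powr (s - 1) / exp (0 + b * x)))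
      (b powr (1 - s) * (Gamma s /\<^sub>R \<bar>b\<bar>))"
    by (intro has_bochner_integral_mult_right) auto
  also have "b powr (1 - s) * (Gamma s /\<^sub>R \<bar>b\<bar>) = Gamma s * b powr (- s)"
    using assms(2) powr_add[of b "-s" 1] by (simp add: field_simps)
  also have "(\<lambda>x :: real. b powr (1 - s) * (indicator {0..} (0 + b * x) * (0 + b * x) powr (s - 1) / exp (0 + b * x)))
    = (\<lambda>x :: real. indicator {0<..} x * (x powr (s - 1) * exp (- (b * x))))"
  proof
    fix x :: real
    have "b powr (1 - s) * (b * x) powr (s - 1) = x powr (s - 1)" if "0 < x"
      using assms(2) that by (simp add: powr_mult powr_add[symmetric] mult.assoc[symmetric])
    then show "b powr (1 - s) * (indicator {0..} (0 + b * x) * (0 + b * x) powr (s - 1) / exp (0 + b * x))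
      = indicator {0<..} x * (x powr (s - 1) * exp (- (b * x)))"
      using assms(2) by (auto simp: indicator_def exp_minus field_simps zero_le_mult_iff)
  qed
  finally show ?thesis .
qed

text \<open>
  Integrating the power series term by term, the Gamma values in the coefficients cancel against those
  of the integrals, and an exponential series remains.
\<close>
lemma has_bochner_integral_clifford_exp:
  assumes \<mu>: "0 \<le> \<mu>" and b: "0 < b" and c: "0 \<le> c"
  shows "has_bochner_integral lborel
    (\<lambda>x. indicator {0<..} x * (exp (- (b * x)) * (x powr \<mu> * clifford \<mu> (c * x))))
    (b powr (- \<mu> - 1) * exp (- (c / b)))"
proof -
  define F where "F m x = clifford_coeff \<mu> m * c ^ m * (indicator {0<..} x * (x powr (real m + \<mu> + 1 - 1) * exp (- (b * x))))" for m x
  define a where "a m = (- (c / b)) ^ m / fact m" for m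
  have F: "has_bochner_integral lborel (F m) (b powr (- \<mu> - 1) * a m)" for m
  proof -
    have "has_bochner_integral lborel (F m) (clifford_coeff \<mu> m * c ^ m * (Gamma (real m + \<mu> + 1) * b powr (- (real m + \<mu> + 1))))"
      unfolding F_def using has_bochner_integral_powr_exp[of "real m + \<mu> + 1" b] \<mu> b
      by (intro has_bochner_integral_mult_right) auto
    also have "clifford_coeff \<mu> m * c ^ m * (Gamma (real m + \<mu> + 1) * b powr (- (real m + \<mu> + 1))) = b powr (- \<mu> - 1) * a m"
    proof -
      have "Gamma (real m + \<mu> + 1) > 0" using \<mu> by (intro Gamma_real_pos) auto
      moreover have "b powr (- (real m + \<mu> + 1)) = b powr (- \<mu> - 1) * inverse (b ^ m)"
      proof -
        have "- (real m + \<mu> + 1) = (- \<mu> - 1) + - real m" by simp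
        then show ?thesis using b by (simp only: powr_add powr_minus powr_realpow)
      qed
      ultimately show ?thesis
        by (simp add: clifford_coeff_def a_def power_divide power_minus[of "c / b"] field_simps)
    qed
    finally show ?thesis .
  qed
  have absF: "norm (F m x) = \<bar>clifford_coeff \<mu> m * c ^ m\<bar> * (indicator {0<..} x * (x powr (real m + \<mu> + 1 - 1) * exp (- (b * x))))" for m x
    by (simp add: F_def abs_mult)
  have absF_int: "(LINT x|lborel. norm (F m x)) = b powr (- \<mu> - 1) * \<bar>a m\<bar>" for m
  proof -
    have "norm (F m x) = (- 1) ^ m * F m x" for x
      unfolding absF unfolding F_def using \<mu> c
      by (simp add: clifford_coeff_def abs_mult abs_of_nonneg Gamma_real_nonneg power_minus1_even flip: mult.assoc power_mult_distrib)
    then have "(LINT x|lborel. norm (F m x)) = (- 1) ^ m * (b powr (- \<mu> - 1) * a m)"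
      using F[of m] by (simp add: has_bochner_integral_iff)
    also have "\<dots> = b powr (- \<mu> - 1) * \<bar>a m\<bar>"
    proof -
      have "\<bar>a m\<bar> = (c / b) ^ m / fact m" using b c by (simp add: a_def power_abs)
      moreover have "(- 1) ^ m * a m = (c / b) ^ m / fact m"
        unfolding a_def times_divide_eq_right power_mult_distrib[symmetric] by simp
      ultimately show ?thesis by (simp only: mult.left_commute[of "(- 1) ^ m"])
    qed
    finally show ?thesis .
  qed
  have sa: "summable (\<lambda>m. \<bar>a m\<bar>)"
    using summable_norm_exp[of "- (c / b)"] by (simp add: a_def divide_inverse abs_mult mult.commute)
  have pw: "(\<lambda>m. F m x) = (\<lambda>m. (indicator {0<..} x * (x powr \<mu> * exp (- (b * x)))) * (clifford_coeff \<mu> m * (c * x) ^ m))" for x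
    by (rule ext) (auto simp: F_def indicator_def powr_add powr_realpow power_mult_distrib)
  have pwsum: "(\<Sum>m. F m x) = indicator {0<..} x * (exp (- (b * x)) * (x powr \<mu> * clifford \<mu> (c * x)))" for x
    unfolding pw clifford_powser using suminf_mult[OF summable_clifford[OF \<mu>, of "c * x"], of "indicator {0<..} x * (x powr \<mu> * exp (- (b * x)))"]
    by (simp add: mult_ac)
  have 1: "integrable lborel (F m)" for m using F[of m] by (simp add: has_bochner_integral_iff)
  have 2: "AE x in lborel. summable (\<lambda>m. norm (F m x))"
  proof (rule AE_I2)
    fix x show "summable (\<lambda>m. norm (F m x))"
      unfolding fun_cong[OF pw] norm_mult[of "indicator {0<..} x * (x powr \<mu> * exp (- (b * x)))"]
      by (intro summable_mult) (use summable_abs_clifford[OF \<mu>, of "c * x"] in simp)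
  qed
  have 3: "summable (\<lambda>m. LINT x|lborel. norm (F m x))"
    unfolding absF_int by (intro summable_mult sa)
  have "(\<Sum>m. LINT x|lborel. F m x) = b powr (- \<mu> - 1) * exp (- (c / b))"
  proof -
    have "(LINT x|lborel. F m x) = b powr (- \<mu> - 1) * a m" for m
      using F[of m] by (simp add: has_bochner_integral_iff)
    moreover have "a sums exp (- (c / b))"
      using exp_converges[of "- (c / b)"] by (simp add: a_def[abs_def] divide_inverse mult.commute)
    then have "(\<lambda>m. b powr (- \<mu> - 1) * a m) sums (b powr (- \<mu> - 1) * exp (- (c / b)))"
      by (rule sums_mult)
    ultimately show ?thesis by (simp add: sums_iff)
  qed
  then show ?thesis
    using integrable_suminf[OF 1 2 3] integral_suminf[OF 1 2 3]
    unfolding pwsum has_bochner_integral_iff by simp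
qed

text \<open>
  Both the exponential and the kernel are products over the coordinates, which reduces the integral to
  one variable.
\<close>
lemma hankel_expo:
  fixes r b \<mu> :: "real ^ 'n"
  assumes r: "\<And>l. 0 < r $ l" and b: "\<And>l. 0 < b $ l" and \<mu>: "\<And>l. 0 \<le> \<mu> $ l"
  shows "hankel r \<mu> (expo b) = (\<lambda>t. of_real (\<Prod>l\<in>UNIV. b $ l powr (- \<mu> $ l - 1)) * expo (\<chi> l. r $ l / b $ l) t)"
proof
  fix t
  show "hankel r \<mu> (expo b) t = of_real (\<Prod>l\<in>UNIV. b $ l powr (- \<mu> $ l - 1)) * expo (\<chi> l. r $ l / b $ l) t"
  proof (cases "t \<in> pos_orthant")
    case True
    define G where "G l s = indicator {0<..} s * (exp (- (b $ l * s)) * (s powr \<mu> $ l * clifford (\<mu> $ l) (r $ l * t $ l * s)))" for l s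
    have G: "has_bochner_integral lborel (G l) (b $ l powr (- \<mu> $ l - 1) * exp (- (r $ l * t $ l / b $ l)))" for l
      unfolding G_def
      by (rule has_bochner_integral_clifford_exp[OF \<mu> b]) (use r[of l] pos_orthantD[OF True, of l] in auto)
    have eq: "expo b x * of_real (kern r \<mu> \<mu> x t) = of_real (\<Prod>l\<in>UNIV. G l (x $ l))" for x
    proof (cases "x \<in> pos_orthant")
      case True
      then have "expo b x * of_real (kern r \<mu> \<mu> x t) = of_real (\<Prod>l\<in>UNIV. exp (- (b $ l * x $ l)) * (x $ l powr \<mu> $ l * clifford (\<mu> $ l) (r $ l * (x $ l * t $ l))))"
        by (simp add: expo_apply kern_def prod.distrib)
      also have "\<dots> = of_real (\<Prod>l\<in>UNIV. G l (x $ l))"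
        using pos_orthantD[OF True] unfolding G_def
        by (intro arg_cong[where f = of_real] prod.cong refl) (simp add: indicator_def mult_ac)
      finally show ?thesis .
    next
      case False
      then obtain l where "\<not> 0 < x $ l" by (auto simp: pos_orthant_def)
      then have "G l (x $ l) = 0" by (simp add: G_def indicator_def)
      then have "(\<Prod>l\<in>UNIV. G l (x $ l)) = 0" by (intro prod_zero) auto
      then show ?thesis using False by (simp add: expo_outside)
    qed
    have "hankel r \<mu> (expo b) t = of_real (LINT x|lborel. (\<Prod>l\<in>UNIV. G l ((x :: real ^ 'n) $ l)))"
      unfolding hankel_apply[OF True] hankel_integral_def eq by (rule integral_complex_of_real)
    also have "(LINT x|lborel. (\<Prod>l\<in>UNIV. G l ((x :: real ^ 'n) $ l))) = (\<Prod>l\<in>UNIV. b $ l powr (- \<mu> $ l - 1) * exp (- (r $ l * t $ l / b $ l)))"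
      using integral_prod_coordinates(2)[of G] G by (simp add: has_bochner_integral_iff)
    also have "of_real \<dots> = of_real (\<Prod>l\<in>UNIV. b $ l powr (- \<mu> $ l - 1)) * expo (\<chi> l. r $ l / b $ l) t"
      by (simp add: expo_apply[OF True] prod.distrib)
    finally show ?thesis .
  qed (simp add: hankel_outside expo_outside)
qed

section \<open>Square integrable functions and the extension of isometries\<close>

lemma L2_spaceD:
  assumes "f \<in> L2_space M"
  shows "f \<in> borel_measurable M" "integrable M (\<lambda>x. (cmod (f x))\<^sup>2)"
  using assms by (auto simp: L2_space_def)

lemma L2_norm_nonneg: "0 \<le> L2_norm M f"
  by (simp add: L2_norm_def Bochner_Integration.integral_nonneg)

lemma L2_norm_power2: "(L2_norm M f)\<^sup>2 = (LINT x|M. (cmod (f x))\<^sup>2)"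
  by (simp add: L2_norm_def Bochner_Integration.integral_nonneg)

lemma L2_space_dominated:
  assumes "f \<in> borel_measurable M" "integrable M w" "\<And>x. x \<in> space M \<Longrightarrow> (cmod (f x))\<^sup>2 \<le> w x"
  shows "f \<in> L2_space M"
proof -
  have "integrable M (\<lambda>x. (cmod (f x))\<^sup>2)"
    by (rule Bochner_Integration.integrable_bound[OF assms(2)])
      (use assms(1) order_trans[OF assms(3) abs_ge_self] in auto)
  then show ?thesis using assms(1) by (simp add: L2_space_def)
qed

lemma norm_add_power2_le: "(cmod (u + v))\<^sup>2 \<le> 2 * (cmod u)\<^sup>2 + 2 * (cmod v)\<^sup>2"
proof -
  have "(cmod (u + v))\<^sup>2 \<le> (cmod u + cmod v)\<^sup>2"
    by (intro power_mono norm_triangle_ineq) simp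
  also have "\<dots> \<le> 2 * (cmod u)\<^sup>2 + 2 * (cmod v)\<^sup>2"
    using sum_squares_bound[of "cmod u" "cmod v"] by (simp add: power2_sum)
  finally show ?thesis .
qed

lemma L2_space_lincomb:
  assumes f: "f \<in> L2_space M" and g: "g \<in> L2_space M"
  shows "(\<lambda>x. a * f x + b * g x) \<in> L2_space M"
proof (rule L2_space_dominated)
  note [measurable] = L2_spaceD(1)[OF f] L2_spaceD(1)[OF g]
  show "(\<lambda>x. a * f x + b * g x) \<in> borel_measurable M" by measurable
  show "integrable M (\<lambda>x. 2 * (cmod a)\<^sup>2 * (cmod (f x))\<^sup>2 + 2 * (cmod b)\<^sup>2 * (cmod (g x))\<^sup>2)"
    using L2_spaceD(2)[OF f] L2_spaceD(2)[OF g] by auto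
  show "(cmod (a * f x + b * g x))\<^sup>2 \<le> 2 * (cmod a)\<^sup>2 * (cmod (f x))\<^sup>2 + 2 * (cmod b)\<^sup>2 * (cmod (g x))\<^sup>2" for x
    using norm_add_power2_le[of "a * f x" "b * g x"] by (simp add: norm_mult power_mult_distrib)
qed

lemma L2_space_diff: "f \<in> L2_space M \<Longrightarrow> g \<in> L2_space M \<Longrightarrow> (\<lambda>x. f x - g x) \<in> L2_space M"
  using L2_space_lincomb[of f M g 1 "-1"] by simp

lemma L2_norm_cmult: "L2_norm M (\<lambda>x. a * f x) = cmod a * L2_norm M f"
  by (simp add: L2_norm_def norm_mult power_mult_distrib real_sqrt_mult)

text \<open>
  For positive numbers \<open>a\<close>, \<open>b\<close> one has $(|u|+|v|)^2 \le (a+b)(|u|^2/a + |v|^2/b)$.  Integrate this with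
  \<open>a\<close>, \<open>b\<close> slightly larger than the norms, which also covers norms equal to zero.
\<close>
lemma L2_norm_triangle:
  assumes f: "f \<in> L2_space M" and g: "g \<in> L2_space M"
  shows "L2_norm M (\<lambda>x. f x + g x) \<le> L2_norm M f + L2_norm M g"
proof (rule field_le_epsilon)
  fix e :: real assume e: "0 < e"
  define a where "a = L2_norm M f + e / 2"
  define b where "b = L2_norm M g + e / 2"
  have ab: "0 < a" "0 < b" "L2_norm M f \<le> a" "L2_norm M g \<le> b"
    using e L2_norm_nonneg[of M f] L2_norm_nonneg[of M g] by (auto simp: a_def b_def)
  have pt: "(cmod (u + v))\<^sup>2 \<le> (a + b) / a * (cmod u)\<^sup>2 + (a + b) / b * (cmod v)\<^sup>2" for u v
  proof -
    have "(cmod (u + v))\<^sup>2 \<le> (cmod u + cmod v)\<^sup>2"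
      by (intro power_mono norm_triangle_ineq) simp
    also have "\<dots> \<le> (cmod u + cmod v)\<^sup>2 + (b * cmod u - a * cmod v)\<^sup>2 / (a * b)"
      using ab by simp
    also have "\<dots> = (a + b) / a * (cmod u)\<^sup>2 + (a + b) / b * (cmod v)\<^sup>2"
      using ab by (simp add: field_simps power2_eq_square)
    finally show ?thesis .
  qed
  have fg: "(\<lambda>x. f x + g x) \<in> L2_space M" using L2_space_lincomb[OF f g, of 1 1] by simp
  have "(L2_norm M (\<lambda>x. f x + g x))\<^sup>2 \<le> (LINT x|M. (a + b) / a * (cmod (f x))\<^sup>2 + (a + b) / b * (cmod (g x))\<^sup>2)"
    unfolding L2_norm_power2
    using L2_spaceD(2)[OF f] L2_spaceD(2)[OF g] L2_spaceD(2)[OF fg] by (intro integral_mono pt) auto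
  also have "\<dots> = (a + b) / a * (L2_norm M f)\<^sup>2 + (a + b) / b * (L2_norm M g)\<^sup>2"
    unfolding L2_norm_power2 using L2_spaceD(2)[OF f] L2_spaceD(2)[OF g] by simp
  also have "\<dots> \<le> (a + b) / a * a\<^sup>2 + (a + b) / b * b\<^sup>2"
    using ab L2_norm_nonneg[of M f] L2_norm_nonneg[of M g] by (intro add_mono mult_left_mono power_mono) auto
  also have "\<dots> = (a + b)\<^sup>2" using ab by (simp add: field_simps power2_eq_square)
  finally have "L2_norm M (\<lambda>x. f x + g x) \<le> a + b"
    by (rule power2_le_imp_le) (use ab in linarith)
  then show "L2_norm M (\<lambda>x. f x + g x) \<le> L2_norm M f + L2_norm M g + e" by (simp add: a_def b_def)
qed

lemma L2_norm_triangle_diff: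
  assumes "f \<in> L2_space M" "g \<in> L2_space M" "h \<in> L2_space M"
  shows "L2_norm M (\<lambda>x. f x - h x) \<le> L2_norm M (\<lambda>x. f x - g x) + L2_norm M (\<lambda>x. g x - h x)"
  using L2_norm_triangle[OF L2_space_diff[OF assms(1,2)] L2_space_diff[OF assms(2,3)]] by simp

lemma L2_norm_minus_commute: "L2_norm M (\<lambda>x. f x - g x) = L2_norm M (\<lambda>x. g x - f x)"
  by (simp add: L2_norm_def norm_minus_commute)

lemma L2_norm_cong_AE:
  assumes "f \<in> borel_measurable M" "g \<in> borel_measurable M" "AE x in M. f x = g x"
  shows "L2_norm M f = L2_norm M g"
  unfolding L2_norm_def using assms by (intro arg_cong[where f = sqrt] integral_cong_AE) auto

lemma L2_norm_eq_0D:
  assumes f: "f \<in> L2_space M" "L2_norm M f = 0"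
  shows "AE x in M. f x = 0"
proof -
  have "(LINT x|M. (cmod (f x))\<^sup>2) = 0" using f(2) L2_norm_power2[of M f] by simp
  then have "AE x in M. (cmod (f x))\<^sup>2 = 0"
    by (subst (asm) integral_nonneg_eq_0_iff_AE) (use L2_spaceD[OF f(1)] in auto)
  then show ?thesis by simp
qed

lemma L2_norm_tendsto:
  assumes X: "\<And>n. X n \<in> L2_space M" and g: "g \<in> L2_space M"
    and lim: "(\<lambda>n. L2_norm M (\<lambda>x. X n x - g x)) \<longlonglongrightarrow> 0"
  shows "(\<lambda>n. L2_norm M (X n)) \<longlonglongrightarrow> L2_norm M g"
proof -
  have "\<bar>L2_norm M (X n) - L2_norm M g\<bar> \<le> L2_norm M (\<lambda>x. X n x - g x)" for n
    using L2_norm_triangle[OF L2_space_diff[OF X[of n] g] g]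
      L2_norm_triangle[OF L2_space_diff[OF g X[of n]] X[of n]]
    by (simp add: L2_norm_minus_commute[of M "X n" g])
  then have "(\<lambda>n. L2_norm M (X n) - L2_norm M g) \<longlonglongrightarrow> 0"
    by (intro Lim_null_comparison[OF _ lim]) auto
  then show ?thesis by (simp add: LIM_zero_iff)
qed

lemma nn_integral_L2:
  "f \<in> L2_space M \<Longrightarrow> (\<integral>\<^sup>+x. ennreal ((cmod (f x))\<^sup>2) \<partial>M) = ennreal ((L2_norm M f)\<^sup>2)"
  unfolding L2_norm_power2 by (rule nn_integral_eq_integral[OF L2_spaceD(2)]) simp_all

lemma L2_fast_Cauchy_distance:
  assumes X: "\<And>n. X n \<in> L2_space M"
    and fast: "\<And>n. L2_norm M (\<lambda>x. X (Suc n) x - X n x) \<le> (1/2) ^ n"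
  shows "L2_norm M (\<lambda>x. X (N + m) x - X N x) \<le> 2 * (1/2) ^ N"
proof -
  have "L2_norm M (\<lambda>x. X (N + m) x - X N x) \<le> 2 * (1/2) ^ N - 2 * (1/2) ^ (N + m)"
  proof (induction m)
    case 0
    then show ?case by (simp add: L2_norm_def)
  next
    case (Suc m)
    show ?case
      using L2_norm_triangle_diff[OF X[of "N + Suc m"] X[of "N + m"] X[of N]] fast[of "N + m"] Suc
      by simp
  qed
  also have "\<dots> \<le> 2 * (1/2) ^ N" by simp
  finally show ?thesis .
qed

text \<open>
  The Riesz--Fischer argument.  The increments are so small that $\sum_n 2^n |X_{n+1} - X_n|^2$ is
  integrable, hence finite almost everywhere, and there the increments decay geometrically.  Fatou's
  lemma turns the pointwise limit into a limit in norm.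
\<close>
lemma L2_complete:
  assumes X: "\<And>n. X n \<in> L2_space M"
    and fast: "\<And>n. L2_norm M (\<lambda>x. X (Suc n) x - X n x) \<le> (1/2) ^ n"
  shows "\<exists>g\<in>L2_space M. (\<lambda>n. L2_norm M (\<lambda>x. X n x - g x)) \<longlonglongrightarrow> 0"
proof -
  note [measurable] = L2_spaceD(1)[OF X]
  define h where "h n x = X (Suc n) x - X n x" for n x
  have hL: "h n \<in> L2_space M" for n unfolding h_def by (rule L2_space_diff[OF X X])
  have [measurable]: "h n \<in> borel_measurable M" for n unfolding h_def by measurable
  have "(\<integral>\<^sup>+x. (\<Sum>n. ennreal (2 ^ n * (cmod (h n x))\<^sup>2)) \<partial>M) = (\<Sum>n. \<integral>\<^sup>+x. ennreal (2 ^ n * (cmod (h n x))\<^sup>2) \<partial>M)"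
    by (rule nn_integral_suminf) measurable
  also have "\<dots> \<le> (\<Sum>n. ennreal ((1/2) ^ n))"
  proof (rule suminf_le)
    fix n
    have "(\<integral>\<^sup>+x. ennreal (2 ^ n * (cmod (h n x))\<^sup>2) \<partial>M) = ennreal (2 ^ n) * ennreal ((L2_norm M (h n))\<^sup>2)"
      unfolding nn_integral_L2[OF hL, symmetric] by (simp add: ennreal_mult nn_integral_cmult)
    also have "\<dots> \<le> ennreal (2 ^ n) * ennreal (((1/2) ^ n)\<^sup>2)"
      using fast[of n] L2_norm_nonneg[of M "h n"] by (intro mult_left_mono ennreal_leI power_mono) (auto simp: h_def[abs_def])
    also have "\<dots> = ennreal ((1/2) ^ n)"
      by (simp add: ennreal_mult[symmetric] power2_eq_square power_mult_distrib[symmetric] mult.assoc[symmetric])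
    finally show "(\<integral>\<^sup>+x. ennreal (2 ^ n * (cmod (h n x))\<^sup>2) \<partial>M) \<le> ennreal ((1/2) ^ n)" .
  qed auto
  also have "\<dots> = ennreal (\<Sum>n. (1/2) ^ n)" by (rule suminf_ennreal2) (auto intro: summable_geometric)
  also have "\<dots> < \<infinity>" by simp
  finally have fin: "(\<integral>\<^sup>+x. (\<Sum>n. ennreal (2 ^ n * (cmod (h n x))\<^sup>2)) \<partial>M) < \<infinity>" .
  have "(\<lambda>x. \<Sum>n. ennreal (2 ^ n * (cmod (h n x))\<^sup>2)) \<in> borel_measurable M" by measurable
  then have AEfin: "AE x in M. (\<Sum>n. ennreal (2 ^ n * (cmod (h n x))\<^sup>2)) \<noteq> \<infinity>"
    by (rule nn_integral_PInf_AE) (use fin in auto)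
  have conv: "convergent (\<lambda>n. X n x)" if fin: "(\<Sum>n. ennreal (2 ^ n * (cmod (h n x))\<^sup>2)) \<noteq> \<infinity>" for x
  proof -
    have real: "\<exists>C\<ge>0. z = ennreal C" if "z \<noteq> \<infinity>" for z
      using that by (cases z) auto
    obtain C where C: "(\<Sum>n. ennreal (2 ^ n * (cmod (h n x))\<^sup>2)) = ennreal C" "0 \<le> C"
      using real[OF fin] by blast
    have le: "cmod (h n x) \<le> sqrt C * sqrt (1/2) ^ n" for n
    proof -
      have "(\<Sum>k\<in>{n}. ennreal (2 ^ k * (cmod (h k x))\<^sup>2)) \<le> (\<Sum>k. ennreal (2 ^ k * (cmod (h k x))\<^sup>2))"
        by (rule sum_le_suminf) auto
      then have "ennreal (2 ^ n * (cmod (h n x))\<^sup>2) \<le> ennreal C" by (simp add: C)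
      then have "2 ^ n * (cmod (h n x))\<^sup>2 \<le> C" using C(2) by (simp add: ennreal_le_iff)
      then have "(cmod (h n x))\<^sup>2 \<le> C * (1/2) ^ n" by (simp add: field_simps power_one_over)
      then have "sqrt ((cmod (h n x))\<^sup>2) \<le> sqrt (C * (1/2) ^ n)" by (rule real_sqrt_le_mono)
      then show ?thesis by (simp add: real_sqrt_mult real_sqrt_power)
    qed
    have "summable (\<lambda>n. sqrt C * sqrt (1/2) ^ n)"
      by (intro summable_mult summable_geometric) (simp add: real_sqrt_lt_1_iff)
    then have "summable (\<lambda>n. h n x)"
      by (rule summable_comparison_test'[where N = 0]) (rule le)
    then have "convergent (\<lambda>n. \<Sum>k<n. h k x)" by (simp add: summable_iff_convergent)
    then have "convergent (\<lambda>n. X 0 x + (\<Sum>k<n. h k x))" by (simp add: convergent_add_const_iff)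
    moreover have "X 0 x + (\<Sum>k<n. h k x) = X n x" for n
      unfolding h_def by (subst sum_lessThan_telescope) simp
    ultimately show ?thesis by simp
  qed
  have AEc: "AE x in M. convergent (\<lambda>n. X n x)" by (rule eventually_mono[OF AEfin conv])
  define g where "g x = lim (\<lambda>n. X n x)" for x
  have [measurable]: "g \<in> borel_measurable M" unfolding g_def by measurable
  have dist: "(\<integral>\<^sup>+x. ennreal ((cmod (X N x - g x))\<^sup>2) \<partial>M) \<le> ennreal ((2 * (1/2) ^ N)\<^sup>2)" for N
  proof -
    have "(\<integral>\<^sup>+x. ennreal ((cmod (X N x - g x))\<^sup>2) \<partial>M) \<le> (\<integral>\<^sup>+x. liminf (\<lambda>m. ennreal ((cmod (X (N + m) x - X N x))\<^sup>2)) \<partial>M)"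
    proof (rule nn_integral_mono_AE, rule AE_mp[OF AEc], rule AE_I2, rule impI)
      fix x assume "convergent (\<lambda>n. X n x)"
      then have "(\<lambda>m. X (m + N) x) \<longlonglongrightarrow> g x"
        unfolding g_def by (intro LIMSEQ_ignore_initial_segment) (simp add: convergent_LIMSEQ_iff)
      then have "(\<lambda>m. X (N + m) x) \<longlonglongrightarrow> g x" by (simp add: add.commute)
      then have "(\<lambda>m. ennreal ((cmod (X (N + m) x - X N x))\<^sup>2)) \<longlonglongrightarrow> ennreal ((cmod (g x - X N x))\<^sup>2)"
        by (intro tendsto_ennrealI tendsto_power tendsto_norm tendsto_diff tendsto_const)
      from lim_imp_Liminf[OF trivial_limit_sequentially this]
      show "ennreal ((cmod (X N x - g x))\<^sup>2) \<le> liminf (\<lambda>m. ennreal ((cmod (X (N + m) x - X N x))\<^sup>2))"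
        by (simp add: norm_minus_commute)
    qed
    also have "\<dots> \<le> liminf (\<lambda>m. \<integral>\<^sup>+x. ennreal ((cmod (X (N + m) x - X N x))\<^sup>2) \<partial>M)"
      by (rule nn_integral_liminf) measurable
    also have "\<dots> \<le> liminf (\<lambda>m. ennreal ((2 * (1/2) ^ N)\<^sup>2))"
    proof (rule Liminf_mono, rule always_eventually, rule allI)
      fix m
      show "(\<integral>\<^sup>+x. ennreal ((cmod (X (N + m) x - X N x))\<^sup>2) \<partial>M) \<le> ennreal ((2 * (1/2) ^ N)\<^sup>2)"
        unfolding nn_integral_L2[OF L2_space_diff[OF X X]]
        by (intro ennreal_leI power_mono L2_fast_Cauchy_distance X fast L2_norm_nonneg)
    qed
    also have "\<dots> = ennreal ((2 * (1/2) ^ N)\<^sup>2)" by (simp add: Liminf_const)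
    finally show ?thesis .
  qed
  have dL: "(\<lambda>x. X N x - g x) \<in> L2_space M" for N
    unfolding L2_space_def
  proof (intro CollectI conjI integrableI_nonneg)
    show "(\<integral>\<^sup>+x. ennreal ((cmod (X N x - g x))\<^sup>2) \<partial>M) < \<infinity>"
      using dist[of N] by (rule le_less_trans) simp
  qed auto
  have "g \<in> L2_space M" using L2_space_diff[OF X[of 0] dL[of 0]] by simp
  moreover have "(\<lambda>N. L2_norm M (\<lambda>x. X N x - g x)) \<longlonglongrightarrow> 0"
  proof (rule real_tendsto_sandwich[OF _ _ tendsto_const])
    show "\<forall>\<^sub>F N in sequentially. 0 \<le> L2_norm M (\<lambda>x. X N x - g x)"
      by (simp add: L2_norm_nonneg)
    have "L2_norm M (\<lambda>x. X N x - g x) \<le> 2 * (1/2) ^ N" for N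
    proof -
      have "(L2_norm M (\<lambda>x. X N x - g x))\<^sup>2 \<le> (2 * (1/2) ^ N)\<^sup>2"
        using dist[of N] unfolding nn_integral_L2[OF dL] by (simp add: ennreal_le_iff)
      then show ?thesis by (rule power2_le_imp_le) simp
    qed
    then show "\<forall>\<^sub>F N in sequentially. L2_norm M (\<lambda>x. X N x - g x) \<le> 2 * (1/2) ^ N"
      by simp
    show "(\<lambda>N. 2 * (1/2) ^ N :: real) \<longlonglongrightarrow> 0"
      by (intro tendsto_mult_right_zero LIMSEQ_power_zero) simp
  qed
  ultimately show ?thesis by blast
qed

locale L2_dense_isometry =
  fixes M :: "'a measure" and A :: "('a \<Rightarrow> complex) set" and T S :: "('a \<Rightarrow> complex) \<Rightarrow> 'a \<Rightarrow> complex"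
  assumes A_L2: "A \<subseteq> L2_space M"
    and A_lincomb: "\<And>f g a b. f \<in> A \<Longrightarrow> g \<in> A \<Longrightarrow> (\<lambda>x. a * f x + b * g x) \<in> A"
    and dense: "\<And>f e. f \<in> L2_space M \<Longrightarrow> 0 < e \<Longrightarrow> \<exists>g\<in>A. L2_norm M (\<lambda>x. g x - f x) < e"
    and T_A: "\<And>f. f \<in> A \<Longrightarrow> T f \<in> A"
    and T_lin: "linear_on_functions A T"
    and T_isom: "\<And>f. f \<in> A \<Longrightarrow> L2_norm M (T f) = L2_norm M f"
    and ST: "\<And>f. f \<in> A \<Longrightarrow> S (T f) = f"
begin

text \<open>
  The closure of the graph of \<open>T\<close> in the square integrable functions.  It is handled as a relation
  because the values of the extension are determined only up to null sets.
\<close>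
definition extends_to :: "('a \<Rightarrow> complex) \<Rightarrow> ('a \<Rightarrow> complex) \<Rightarrow> bool" where
  "extends_to f g \<longleftrightarrow> f \<in> L2_space M \<and> g \<in> L2_space M \<and> (\<exists>X. (\<forall>n. X n \<in> A) \<and>
     (\<lambda>n. L2_norm M (\<lambda>x. X n x - f x)) \<longlonglongrightarrow> 0 \<and> (\<lambda>n. L2_norm M (\<lambda>x. T (X n) x - g x)) \<longlonglongrightarrow> 0)"

definition extension :: "('a \<Rightarrow> complex) \<Rightarrow> 'a \<Rightarrow> complex" where
  "extension f = (SOME g. extends_to f g)"

lemma in_L2: "f \<in> A \<Longrightarrow> f \<in> L2_space M"
  using A_L2 by blast

lemma T_lincomb: "f \<in> A \<Longrightarrow> g \<in> A \<Longrightarrow> T (\<lambda>x. a * f x + b * g x) = (\<lambda>x. a * T f x + b * T g x)"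
  using T_lin unfolding linear_on_functions_def by blast

lemma T_diff: "f \<in> A \<Longrightarrow> g \<in> A \<Longrightarrow> T (\<lambda>x. f x - g x) = (\<lambda>x. T f x - T g x)"
  using T_lincomb[of f g 1 "-1"] by simp

lemma A_diff: "f \<in> A \<Longrightarrow> g \<in> A \<Longrightarrow> (\<lambda>x. f x - g x) \<in> A"
  using A_lincomb[of f g 1 "-1"] by simp

lemma extends_to_ex:
  assumes f: "f \<in> L2_space M"
  shows "\<exists>g. extends_to f g"
proof -
  have "\<forall>n. \<exists>g\<in>A. L2_norm M (\<lambda>x. g x - f x) < (1/2) ^ n / 4"
    by (intro allI dense[OF f]) simp
  then obtain X where X: "\<And>n. X n \<in> A" "\<And>n. L2_norm M (\<lambda>x. X n x - f x) < (1/2) ^ n / 4"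
    by metis
  have "L2_norm M (\<lambda>x. T (X (Suc n)) x - T (X n) x) \<le> (1/2) ^ n" for n
  proof -
    have "L2_norm M (\<lambda>x. T (X (Suc n)) x - T (X n) x) = L2_norm M (\<lambda>x. X (Suc n) x - X n x)"
      unfolding T_diff[OF X(1) X(1), symmetric] by (rule T_isom[OF A_diff[OF X(1) X(1)]])
    also have "\<dots> \<le> L2_norm M (\<lambda>x. X (Suc n) x - f x) + L2_norm M (\<lambda>x. f x - X n x)"
      by (intro L2_norm_triangle_diff in_L2 X f)
    also have "\<dots> \<le> (1/2) ^ Suc n / 4 + (1/2) ^ n / 4"
      using X(2)[of n] X(2)[of "Suc n"] by (simp add: L2_norm_minus_commute[of M f])
    also have "\<dots> \<le> (1/2) ^ n" by simp
    finally show ?thesis .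
  qed
  then obtain g where "g \<in> L2_space M" "(\<lambda>n. L2_norm M (\<lambda>x. T (X n) x - g x)) \<longlonglongrightarrow> 0"
    using L2_complete[of "\<lambda>n. T (X n)" M] in_L2[OF T_A[OF X(1)]] by blast
  moreover have "(\<lambda>n. L2_norm M (\<lambda>x. X n x - f x)) \<longlonglongrightarrow> 0"
  proof (rule real_tendsto_sandwich[OF _ _ tendsto_const])
    show "(\<lambda>n. (1/2) ^ n / 4 :: real) \<longlonglongrightarrow> 0"
      by (intro tendsto_divide_zero LIMSEQ_power_zero) simp
  qed (use X(2) L2_norm_nonneg in \<open>auto intro!: always_eventually intro: less_imp_le\<close>)
  ultimately show ?thesis unfolding extends_to_def using X(1) f by blast
qed

lemma extends_to_extension: "f \<in> L2_space M \<Longrightarrow> extends_to f (extension f)"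
  unfolding extension_def by (rule someI_ex[OF extends_to_ex])

lemma extends_to_norm:
  assumes "extends_to f g"
  shows "L2_norm M g = L2_norm M f"
proof -
  obtain X where X: "\<And>n. X n \<in> A" "(\<lambda>n. L2_norm M (\<lambda>x. X n x - f x)) \<longlonglongrightarrow> 0"
      "(\<lambda>n. L2_norm M (\<lambda>x. T (X n) x - g x)) \<longlonglongrightarrow> 0"
    and fg: "f \<in> L2_space M" "g \<in> L2_space M" using assms unfolding extends_to_def by blast
  have "(\<lambda>n. L2_norm M (X n)) \<longlonglongrightarrow> L2_norm M f"
    by (rule L2_norm_tendsto[OF in_L2[OF X(1)] fg(1) X(2)])
  moreover have "(\<lambda>n. L2_norm M (T (X n))) \<longlonglongrightarrow> L2_norm M g"
    by (rule L2_norm_tendsto[OF in_L2[OF T_A[OF X(1)]] fg(2) X(3)])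
  ultimately show ?thesis unfolding T_isom[OF X(1)] by (metis LIMSEQ_unique)
qed

lemma L2_tendsto_lincomb:
  assumes "\<And>n. X n \<in> L2_space M" "\<And>n. Y n \<in> L2_space M" "f \<in> L2_space M" "g \<in> L2_space M"
    and "(\<lambda>n. L2_norm M (\<lambda>x. X n x - f x)) \<longlonglongrightarrow> 0" "(\<lambda>n. L2_norm M (\<lambda>x. Y n x - g x)) \<longlonglongrightarrow> 0"
  shows "(\<lambda>n. L2_norm M (\<lambda>x. (a * X n x + b * Y n x) - (a * f x + b * g x))) \<longlonglongrightarrow> 0"
proof (rule real_tendsto_sandwich[OF _ _ tendsto_const])
  have "(\<lambda>n. cmod a * L2_norm M (\<lambda>x. X n x - f x) + cmod b * L2_norm M (\<lambda>x. Y n x - g x)) \<longlonglongrightarrow> cmod a * 0 + cmod b * 0"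
    by (intro tendsto_intros assms)
  then show "(\<lambda>n. cmod a * L2_norm M (\<lambda>x. X n x - f x) + cmod b * L2_norm M (\<lambda>x. Y n x - g x)) \<longlonglongrightarrow> 0" by simp
  have "L2_norm M (\<lambda>x. (a * X n x + b * Y n x) - (a * f x + b * g x))
      \<le> cmod a * L2_norm M (\<lambda>x. X n x - f x) + cmod b * L2_norm M (\<lambda>x. Y n x - g x)" for n
  proof -
    have d: "(\<lambda>x. X n x - f x) \<in> L2_space M" "(\<lambda>x. Y n x - g x) \<in> L2_space M"
      by (intro L2_space_diff assms)+
    have "L2_norm M (\<lambda>x. a * (X n x - f x) + b * (Y n x - g x))
        \<le> L2_norm M (\<lambda>x. a * (X n x - f x)) + L2_norm M (\<lambda>x. b * (Y n x - g x))"
      using L2_space_lincomb[OF d, where b = 0] L2_space_lincomb[OF d, where a = 0]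
      by (intro L2_norm_triangle) auto
    then show ?thesis unfolding L2_norm_cmult by (simp add: algebra_simps)
  qed
  then show "\<forall>\<^sub>F n in sequentially. L2_norm M (\<lambda>x. (a * X n x + b * Y n x) - (a * f x + b * g x))
      \<le> cmod a * L2_norm M (\<lambda>x. X n x - f x) + cmod b * L2_norm M (\<lambda>x. Y n x - g x)" by simp
qed (simp add: L2_norm_nonneg)

lemma extends_to_lincomb:
  assumes "extends_to f f'" "extends_to g g'"
  shows "extends_to (\<lambda>x. a * f x + b * g x) (\<lambda>x. a * f' x + b * g' x)"
proof -
  obtain X where X: "\<And>n. X n \<in> A" "(\<lambda>n. L2_norm M (\<lambda>x. X n x - f x)) \<longlonglongrightarrow> 0"
      "(\<lambda>n. L2_norm M (\<lambda>x. T (X n) x - f' x)) \<longlonglongrightarrow> 0"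
    and f: "f \<in> L2_space M" "f' \<in> L2_space M" using assms(1) unfolding extends_to_def by blast
  obtain Y where Y: "\<And>n. Y n \<in> A" "(\<lambda>n. L2_norm M (\<lambda>x. Y n x - g x)) \<longlonglongrightarrow> 0"
      "(\<lambda>n. L2_norm M (\<lambda>x. T (Y n) x - g' x)) \<longlonglongrightarrow> 0"
    and g: "g \<in> L2_space M" "g' \<in> L2_space M" using assms(2) unfolding extends_to_def by blast
  show ?thesis
    unfolding extends_to_def
  proof (intro conjI L2_space_lincomb f g exI[of _ "\<lambda>n x. a * X n x + b * Y n x"] allI A_lincomb X Y)
    show "(\<lambda>n. L2_norm M (\<lambda>x. (a * X n x + b * Y n x) - (a * f x + b * g x))) \<longlonglongrightarrow> 0"
      by (intro L2_tendsto_lincomb in_L2 X Y f g)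
    show "(\<lambda>n. L2_norm M (\<lambda>x. T (\<lambda>x. a * X n x + b * Y n x) x - (a * f' x + b * g' x))) \<longlonglongrightarrow> 0"
      unfolding T_lincomb[OF X(1) Y(1)] by (intro L2_tendsto_lincomb in_L2 T_A X Y f g)
  qed
qed

lemma extends_to_unique:
  assumes "extends_to f f'" "extends_to g g'" "AE x in M. f x = g x"
  shows "AE x in M. f' x = g' x"
proof -
  have ext: "extends_to (\<lambda>x. 1 * f x + (- 1) * g x) (\<lambda>x. 1 * f' x + (- 1) * g' x)"
    by (rule extends_to_lincomb[OF assms(1,2)])
  then have d: "(\<lambda>x. 1 * f x + (- 1) * g x) \<in> L2_space M" "(\<lambda>x. 1 * f' x + (- 1) * g' x) \<in> L2_space M"
    unfolding extends_to_def by blast+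
  have "L2_norm M (\<lambda>x. 1 * f x + (- 1) * g x) = L2_norm M (\<lambda>x. 0)"
    by (rule L2_norm_cong_AE) (use L2_spaceD(1)[OF d(1)] assms(3) in auto)
  then have "L2_norm M (\<lambda>x. 1 * f' x + (- 1) * g' x) = 0"
    using extends_to_norm[OF ext] by (simp add: L2_norm_def)
  from L2_norm_eq_0D[OF d(2) this] show ?thesis by auto
qed

lemma extends_to_T: "f \<in> A \<Longrightarrow> extends_to f (T f)"
  unfolding extends_to_def using in_L2 T_A
  by (auto intro!: exI[of _ "\<lambda>n. f"] simp: L2_norm_def)

end

text \<open>
  The closures of the graphs of \<open>T\<close> and of its inverse \<open>S\<close> are converse to each other.  This makes the
  two extensions mutually inverse, and in particular surjective.
\<close>
lemma L2_isometry_pair_extension: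
  fixes M :: "'a measure"
  assumes TS: "L2_dense_isometry M A T S" and ST: "L2_dense_isometry M A S T"
  shows "\<exists>U V. extends_to_L2_isometry M A T U \<and> extends_to_L2_isometry M A S V \<and> L2_mutually_inverse M U V"
proof -
  have flip: "L2_dense_isometry.extends_to M A S g f"
    if TS: "L2_dense_isometry M A T S" and ST: "L2_dense_isometry M A S T"
      and "L2_dense_isometry.extends_to M A T f g" for T S f g
  proof -
    interpret T: L2_dense_isometry M A T S by fact
    interpret S: L2_dense_isometry M A S T by fact
    obtain X where X: "\<And>n. X n \<in> A" "(\<lambda>n. L2_norm M (\<lambda>x. X n x - f x)) \<longlonglongrightarrow> 0"
        "(\<lambda>n. L2_norm M (\<lambda>x. T (X n) x - g x)) \<longlonglongrightarrow> 0"
      and "f \<in> L2_space M" "g \<in> L2_space M"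
      using \<open>T.extends_to f g\<close> unfolding T.extends_to_def by blast
    then show ?thesis
      unfolding S.extends_to_def by (auto intro!: exI[of _ "\<lambda>n. T (X n)"] simp: T.T_A T.ST)
  qed
  have inv: "AE x in M. L2_dense_isometry.extension M A S (L2_dense_isometry.extension M A T f) x = f x"
    if TS: "L2_dense_isometry M A T S" and ST: "L2_dense_isometry M A S T" and f: "f \<in> L2_space M" for T S f
  proof -
    interpret T: L2_dense_isometry M A T S by fact
    interpret S: L2_dense_isometry M A S T by fact
    have e: "T.extends_to f (T.extension f)" by (rule T.extends_to_extension[OF f])
    then have "T.extension f \<in> L2_space M" unfolding T.extends_to_def by blast
    then show ?thesis
      by (intro S.extends_to_unique[OF S.extends_to_extension flip[OF TS ST e]]) auto
  qed
  have ext: "extends_to_L2_isometry M A T (L2_dense_isometry.extension M A T)"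
    if TS: "L2_dense_isometry M A T S" and ST: "L2_dense_isometry M A S T" for T S
  proof -
    interpret T: L2_dense_isometry M A T S by fact
    interpret S: L2_dense_isometry M A S T by fact
    have L2: "T.extension f \<in> L2_space M" if "f \<in> L2_space M" for f
      using T.extends_to_extension[OF that] unfolding T.extends_to_def by blast
    have L2': "S.extension f \<in> L2_space M" if "f \<in> L2_space M" for f
      using S.extends_to_extension[OF that] unfolding S.extends_to_def by blast
    show ?thesis
      unfolding extends_to_L2_isometry_def
    proof (intro conjI ballI allI impI)
      show "AE x in M. T.extension f x = T f x" if "f \<in> A" for f
        by (rule T.extends_to_unique[OF T.extends_to_extension T.extends_to_T]) (use that T.in_L2 in auto)
      show "AE x in M. T.extension f x = T.extension g x"
        if "f \<in> L2_space M" "g \<in> L2_space M" "AE x in M. f x = g x" for f g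
        by (rule T.extends_to_unique[OF T.extends_to_extension T.extends_to_extension]) (use that in auto)
      show "AE x in M. T.extension (\<lambda>y. a * f y + b * g y) x = a * T.extension f x + b * T.extension g x"
        if "f \<in> L2_space M" "g \<in> L2_space M" for f g a b
        by (rule T.extends_to_unique[OF T.extends_to_extension T.extends_to_lincomb[OF T.extends_to_extension T.extends_to_extension]])
          (use that L2_space_lincomb in auto)
      show "L2_norm M (T.extension f) = L2_norm M f" if "f \<in> L2_space M" for f
        by (rule T.extends_to_norm[OF T.extends_to_extension[OF that]])
      show "\<exists>f\<in>L2_space M. AE x in M. T.extension f x = g x" if "g \<in> L2_space M" for g
        using inv[OF ST TS that] L2'[OF that] by blast
    qed (use T.A_L2 L2 in auto)
  qed
  show ?thesis
    using ext[OF TS ST] ext[OF ST TS] inv[OF TS ST] inv[OF ST TS]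
    unfolding L2_mutually_inverse_def by blast
qed

section \<open>Exponentials in the weighted space\<close>

lemma borel_measurable_monomial [measurable]:
  "(\<lambda>x :: real ^ 'n. monomial x \<mu>) \<in> borel_measurable borel"
proof -
  have [measurable]: "(\<lambda>x :: real ^ 'n. x $ l) \<in> borel_measurable borel" for l
    by (intro borel_measurable_continuous_onI continuous_intros)
  show ?thesis unfolding monomial_def by measurable
qed

lemma pos_orthant_borel [measurable]: "(pos_orthant :: (real ^ 'n) set) \<in> sets borel"
  by (rule borel_open[OF open_pos_orthant])

lemma pos_orthant_lebesgue: "(pos_orthant :: (real ^ 'n) set) \<in> sets lebesgue"
  by (rule sets_completionI_sets) (simp add: pos_orthant_borel)

lemma borel_imp_lebesgue_on:
  fixes f :: "real ^ 'n \<Rightarrow> 'b::euclidean_space"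
  assumes "f \<in> borel_measurable borel"
  shows "f \<in> borel_measurable (lebesgue_on S)"
  using assms by (intro measurable_restrict_space1 measurable_completion) simp

lemma space_weighted: "space (weighted_measure \<mu>) = pos_orthant"
  by (simp add: weighted_measure_def)

lemma measurable_weighted_iff: "f \<in> borel_measurable (weighted_measure \<mu>) \<longleftrightarrow> f \<in> borel_measurable (lebesgue_on pos_orthant)"
  by (simp add: weighted_measure_def)

lemma borel_imp_weighted:
  fixes f :: "real ^ 'n \<Rightarrow> 'b::euclidean_space"
  shows "f \<in> borel_measurable borel \<Longrightarrow> f \<in> borel_measurable (weighted_measure \<mu>)"
  unfolding measurable_weighted_iff by (rule borel_imp_lebesgue_on)

lemma lebesgue_on_orthant_integral:
  fixes h :: "real ^ 'n \<Rightarrow> 'b::euclidean_space"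
  assumes [measurable]: "h \<in> borel_measurable borel" and h: "\<And>x. x \<notin> pos_orthant \<Longrightarrow> h x = 0"
  shows "integrable (lebesgue_on pos_orthant) h \<longleftrightarrow> integrable lborel h"
    and "integral\<^sup>L (lebesgue_on pos_orthant) h = integral\<^sup>L lborel h"
proof -
  have eq: "(\<lambda>x. indicator pos_orthant x *\<^sub>R h x) = h" using h by (auto simp: indicator_def)
  show "integrable (lebesgue_on pos_orthant) h \<longleftrightarrow> integrable lborel h"
    by (subst integrable_restrict_space) (simp_all add: eq pos_orthant_lebesgue integrable_completion)
  show "integral\<^sup>L (lebesgue_on pos_orthant) h = integral\<^sup>L lborel h"
    by (subst integral_restrict_space) (simp_all add: eq pos_orthant_lebesgue integral_completion)
qed

lemma weighted_integral:
  fixes h :: "real ^ 'n \<Rightarrow> real"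
  assumes [measurable]: "h \<in> borel_measurable borel" and h: "\<And>x. x \<notin> pos_orthant \<Longrightarrow> h x = 0"
  shows "integrable (weighted_measure \<mu>) h \<longleftrightarrow> integrable lborel (\<lambda>x. monomial x \<mu> * h x)"
    and "integral\<^sup>L (weighted_measure \<mu>) h = (LINT x|lborel. monomial x \<mu> * h x)"
proof -
  have m: "h \<in> borel_measurable (lebesgue_on pos_orthant)" "(\<lambda>x. monomial x \<mu>) \<in> borel_measurable (lebesgue_on pos_orthant)"
    by (intro borel_imp_lebesgue_on; measurable)+
  show "integrable (weighted_measure \<mu>) h \<longleftrightarrow> integrable lborel (\<lambda>x. monomial x \<mu> * h x)"
    unfolding weighted_measure_def
    by (subst integrable_density[OF m]) (simp_all add: monomial_nonneg h lebesgue_on_orthant_integral(1))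
  show "integral\<^sup>L (weighted_measure \<mu>) h = (LINT x|lborel. monomial x \<mu> * h x)"
    unfolding weighted_measure_def
    by (subst integral_density[OF m]) (simp_all add: monomial_nonneg h lebesgue_on_orthant_integral(2))
qed

lemma schwartz_weighted_integrable:
  fixes f g :: "real ^ 'n \<Rightarrow> complex"
  assumes f: "f \<in> orthant_schwartz" and g: "g \<in> orthant_schwartz" and \<mu>: "\<And>l. 0 \<le> \<mu> $ l"
  shows "integrable lborel (\<lambda>x. f x * of_real (monomial x \<mu>))"
    and "integrable lborel (\<lambda>x. f x * (g x * of_real (monomial x \<mu>)))"
proof -
  note [measurable] = schwartz_borel_measurable[OF g]
  obtain N where N: "\<And>l. \<mu> $ l \<le> real N" using ex_growth_exponent by blast
  have bnd: "cmod (of_real (monomial x \<mu>)) \<le> 1 * growth N x" if "x \<in> pos_orthant" for x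
    using monomial_le_growth[OF N \<mu> that] monomial_nonneg[of x \<mu>] by simp
  show "integrable lborel (\<lambda>x. f x * of_real (monomial x \<mu>))"
    by (rule schwartz_integrable(1)[OF f _ bnd]) auto
  have g0: "cmod (g x) \<le> growth_norm 0 g" if "x \<in> pos_orthant" for x
    using growth_norm_upper[OF g that, of 0] by (simp add: growth_def)
  have "0 \<le> growth_norm 0 g"
    unfolding growth_norm_def by (intro mult_nonneg_nonneg sum_nonneg seminorm_nonneg g) auto
  moreover have "cmod (g x * of_real (monomial x \<mu>)) \<le> growth_norm 0 g * growth N x" if "x \<in> pos_orthant" for x
    using mult_mono[OF g0[OF that] bnd[OF that]] \<open>0 \<le> growth_norm 0 g\<close> by (simp add: norm_mult)
  ultimately show "integrable lborel (\<lambda>x. f x * (g x * of_real (monomial x \<mu>)))"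
    by (intro schwartz_integrable(1)[OF f]) auto
qed

lemma schwartz_weighted_square_integrable:
  fixes f :: "real ^ 'n \<Rightarrow> complex"
  assumes f: "f \<in> orthant_schwartz" and \<mu>: "\<And>l. 0 \<le> \<mu> $ l"
  shows "integrable lborel (\<lambda>x. monomial x \<mu> * (cmod (f x))\<^sup>2)"
proof -
  have "integrable lborel (\<lambda>x. cmod (f x * (f x * of_real (monomial x \<mu>))))"
    by (intro integrable_norm schwartz_weighted_integrable f \<mu>)
  then show ?thesis by (simp add: norm_mult power2_eq_square monomial_nonneg mult_ac)
qed

lemma schwartz_L2:
  fixes f :: "real ^ 'n \<Rightarrow> complex"
  assumes f: "f \<in> orthant_schwartz" and \<mu>: "\<And>l. 0 \<le> \<mu> $ l"
  shows "f \<in> L2_space (weighted_measure \<mu>)"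
    and "(L2_norm (weighted_measure \<mu>) f)\<^sup>2 = (LINT x|lborel. monomial x \<mu> * (cmod (f x))\<^sup>2)"
proof -
  note [measurable] = schwartz_borel_measurable[OF f]
  show "f \<in> L2_space (weighted_measure \<mu>)"
    unfolding L2_space_def
  proof (intro CollectI conjI)
    show "f \<in> borel_measurable (weighted_measure \<mu>)" by (rule borel_imp_weighted) measurable
    show "integrable (weighted_measure \<mu>) (\<lambda>x. (cmod (f x))\<^sup>2)"
      by (subst weighted_integral(1)) (use schwartz_weighted_square_integrable[OF f \<mu>] schwartz_zero[OF f] in auto)
  qed
  show "(L2_norm (weighted_measure \<mu>) f)\<^sup>2 = (LINT x|lborel. monomial x \<mu> * (cmod (f x))\<^sup>2)"
    unfolding L2_norm_power2 by (subst weighted_integral(2)) (use schwartz_zero[OF f] in auto)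
qed

inductive_set expo_span :: "(real ^ 'n \<Rightarrow> complex) set" where
  expo: "(\<And>l. 0 < b $ l) \<Longrightarrow> (\<lambda>x. c * expo b x) \<in> expo_span"
| add: "f \<in> expo_span \<Longrightarrow> g \<in> expo_span \<Longrightarrow> (\<lambda>x. f x + g x) \<in> expo_span"

lemma expo_span_schwartz: "f \<in> expo_span \<Longrightarrow> f \<in> orthant_schwartz"
  by (induction rule: expo_span.induct) (auto intro: schwartz_expo_aux schwartz_add)

lemma expo_span_cmult: "f \<in> expo_span \<Longrightarrow> (\<lambda>x. a * f x) \<in> expo_span"
proof (induction rule: expo_span.induct)
  case (expo b c)
  then show ?case using expo_span.expo[of b "a * c"] by (simp add: mult.assoc)
next
  case (add f g)
  then show ?case using expo_span.add by (simp add: distrib_left)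
qed

lemma expo_span_sum:
  assumes "finite I" "I \<noteq> {}" "\<And>i. i \<in> I \<Longrightarrow> f i \<in> expo_span"
  shows "(\<lambda>x. \<Sum>i\<in>I. f i x) \<in> expo_span"
  using assms by (induction I rule: finite_ne_induct) (auto intro: expo_span.add)

definition exp_vec :: "real ^ 'n \<Rightarrow> real ^ 'n" where
  "exp_vec x = (\<chi> l. exp (- (x $ l)))"

lemma expo_axis:
  "of_real (exp_vec x $ l) * expo b x = expo (b + axis l 1) x"
proof (cases "x \<in> pos_orthant")
  case True
  have "(\<Prod>i\<in>UNIV. exp (- ((b + axis l 1) $ i * x $ i)))
      = (\<Prod>i\<in>UNIV. (if i = l then exp (- (x $ l)) else 1) * exp (- (b $ i * x $ i)))"
    by (intro prod.cong refl) (simp add: axis_def distrib_right exp_add[symmetric])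
  then have P: "(\<Prod>i\<in>UNIV. exp (- ((b + axis l 1) $ i * x $ i)))
      = exp (- (x $ l)) * (\<Prod>i\<in>UNIV. exp (- (b $ i * x $ i)))"
    by (simp only: prod.distrib) simp
  show ?thesis unfolding expo_apply[OF True] P exp_vec_def by simp
qed (simp add: expo_outside)

lemma expo_span_mult_coord:
  assumes "f \<in> expo_span"
  shows "(\<lambda>x. of_real (exp_vec x $ l) * f x) \<in> expo_span"
  using assms
proof (induction rule: expo_span.induct)
  case (expo b c)
  have "0 < (b + axis l 1) $ i" for i using expo[of i] expo[of l] unfolding axis_add_nth by auto
  then have "(\<lambda>x. c * expo (b + axis l 1) x) \<in> expo_span" by (rule expo_span.expo)
  then show ?case unfolding expo_axis[symmetric] by (simp add: mult.left_commute)
next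
  case (add f g)
  then show ?case using expo_span.add by (simp add: distrib_left)
qed

text \<open>
  In the variables \<open>exp_vec x\<close> the exponentials are monomials.  Since the claim is about all \<open>f\<close> in the
  span, a product of polynomials is dealt with by applying the hypotheses one after the other.
\<close>
lemma expo_span_mult_polynomial:
  assumes "real_polynomial_function p" "f \<in> expo_span"
  shows "(\<lambda>x. of_real (p (exp_vec x)) * f x) \<in> expo_span"
  using assms
proof (induction arbitrary: f rule: real_polynomial_function.induct)
  case (linear p)
  define c where "c l = p (axis l 1)" for l
  have p: "p y = (\<Sum>l\<in>UNIV. y $ l * c l)" for y
  proof -
    have "(\<Sum>l\<in>UNIV. y $ l *\<^sub>R axis l 1) = y"
      using basis_expansion[of y] by (simp add: scalar_mult_eq_scaleR)
    then have "p y = p (\<Sum>l\<in>UNIV. y $ l *\<^sub>R axis l 1)" by simp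
    then show ?thesis
      using linear(1)
      by (simp add: linear_sum[OF bounded_linear.linear] linear_cmul[OF bounded_linear.linear] c_def)
  qed
  have "(\<lambda>x. \<Sum>l\<in>UNIV. of_real (c l) * (of_real (exp_vec x $ l) * f x)) \<in> expo_span"
    by (intro expo_span_sum expo_span_cmult expo_span_mult_coord linear) auto
  then show ?case unfolding p by (simp add: sum_distrib_left sum_distrib_right mult_ac)
next
  case (const c)
  then show ?case by (rule expo_span_cmult)
next
  case (add p q)
  then show ?case using expo_span.add[OF add.IH(1) add.IH(2)] by (simp add: distrib_right)
next
  case (mult p q)
  then show ?case by (simp add: mult.assoc)
qed

text \<open>
  In the variables $y_l = e^{-x_l}$ the function $h(x)\, e^{\sum_l x_l}$ extends continuously to the cube
  $[0,1]^d$, and the Stone--Weierstrass theorem approximates it by polynomials in \<open>y\<close>.  Replacing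
  $y_l$ by $\max(y_l, e^{-R})$ yields such an extension, as \<open>h\<close> vanishes where some $x_l \ge R$.
\<close>
lemma expo_span_uniform_approx:
  fixes h :: "real ^ 'n \<Rightarrow> complex"
  assumes h: "continuous_on UNIV h" and R: "\<And>x l. R \<le> x $ l \<Longrightarrow> h x = 0" and e: "0 < e"
  shows "\<exists>g\<in>expo_span. \<forall>x\<in>pos_orthant. cmod (h x - g x) \<le> e * cmod (expo 1 x)"
proof -
  \<comment> \<open>\<open>\<psi>\<close> inverts \<open>exp_vec\<close> where all coordinates are at most \<open>R\<close>\<close>
  define m where "m y = (\<chi> l. max (y $ l) (exp (- R)))" for y :: "real ^ 'n"
  define \<psi> where "\<psi> y = (\<chi> l. - ln (m y $ l))" for y :: "real ^ 'n"
  define \<phi> where "\<phi> y = h (\<psi> y) * of_real (\<Prod>l\<in>UNIV. inverse (m y $ l))" for y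
  have mpos: "0 < m y $ l" for y l by (simp add: m_def less_max_iff_disj)
  have cm: "continuous_on UNIV (\<lambda>y. m y $ l)" for l unfolding m_def by (simp, intro continuous_intros)
  have mne: "m y $ l \<noteq> 0" for y l using mpos[of y l] by simp
  have "continuous_on UNIV (\<lambda>y. - ln (m y $ l))" for l
    by (intro continuous_on_minus continuous_on_ln cm ballI mne)
  then have "continuous_on UNIV \<psi>"
    unfolding \<psi>_def by (rule continuous_on_vec_lambda)
  then have ch: "continuous_on UNIV (\<lambda>y. h (\<psi> y))" using h continuous_on_compose2 by blast
  have ci: "continuous_on UNIV (\<lambda>y. inverse (m y $ l))" for l
    by (intro continuous_on_inverse cm ballI mne)
  have c\<phi>: "continuous_on UNIV \<phi>"
    unfolding \<phi>_def by (intro continuous_on_mult ch continuous_on_of_real continuous_on_prod ci)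
  have comp: "compact (cbox 0 1 :: (real ^ 'n) set)" by (rule compact_cbox)
  obtain q where q: "polynomial_function q" "\<And>y. y \<in> cbox 0 1 \<Longrightarrow> norm (\<phi> y - q y) < e"
    using Stone_Weierstrass_polynomial_function[OF comp continuous_on_subset[OF c\<phi>] e] by blast
  have qR: "real_polynomial_function (\<lambda>y. Re (q y))" "real_polynomial_function (\<lambda>y. Im (q y))"
    using q(1) bounded_linear_Re bounded_linear_Im unfolding polynomial_function_def o_def by auto
  have 1: "(\<lambda>x. 1 * expo 1 x) \<in> expo_span" by (rule expo_span.expo) simp
  define g where "g x = q (exp_vec x) * expo 1 x" for x
  have "(\<lambda>x. of_real (Re (q (exp_vec x))) * (1 * expo 1 x) + \<i> * (of_real (Im (q (exp_vec x))) * (1 * expo 1 x))) \<in> expo_span"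
    by (intro expo_span.add expo_span_cmult expo_span_mult_polynomial[OF qR(1)] expo_span_mult_polynomial[OF qR(2)] 1)
  moreover have "of_real (Re w) * v + \<i> * (of_real (Im w) * v) = w * v" for w v
    by (simp add: complex_eq[of w, symmetric] distrib_right[symmetric] mult.assoc[symmetric])
  ultimately have "g \<in> expo_span" by (simp add: g_def[abs_def])
  moreover have "cmod (h x - g x) \<le> e * cmod (expo 1 x)" if x: "x \<in> pos_orthant" for x
  proof -
    have in_box: "exp_vec x \<in> cbox 0 1"
      using pos_orthantD[OF x] by (auto simp: exp_vec_def mem_box_cart less_imp_le)
    have "h x = \<phi> (exp_vec x) * expo 1 x"
    proof (cases "\<exists>l. R \<le> x $ l")
      case True
      then obtain l where l: "R \<le> x $ l" by blast
      then have "R \<le> \<psi> (exp_vec x) $ l" by (simp add: \<psi>_def m_def exp_vec_def max_def)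
      then show ?thesis using R[OF l] R[of "\<psi> (exp_vec x)" l] by (simp add: \<phi>_def)
    next
      case False
      then have m: "m (exp_vec x) $ l = exp (- (x $ l))" for l
        by (auto simp: m_def exp_vec_def max_def not_le) (meson le_less_trans less_imp_le not_le)
      then have "\<psi> (exp_vec x) = x" by (simp add: \<psi>_def vec_eq_iff)
      moreover have "(\<Prod>l\<in>UNIV. inverse (exp (- (x $ l)))) * (\<Prod>l\<in>UNIV. exp (- (x $ l))) = 1"
        unfolding prod.distrib[symmetric] by simp
      then have "complex_of_real (\<Prod>l\<in>UNIV. inverse (exp (- (x $ l)))) * expo 1 x = 1"
        unfolding expo_apply[OF x] of_real_mult[symmetric] by simp
      ultimately show ?thesis unfolding \<phi>_def m by (simp add: mult.assoc)
    qed
    then have "h x - g x = (\<phi> (exp_vec x) - q (exp_vec x)) * expo 1 x"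
      by (simp add: g_def algebra_simps)
    then show ?thesis
      using q(2)[OF in_box] by (simp add: norm_mult mult_right_mono)
  qed
  ultimately show ?thesis by blast
qed

lemma L2_dominated_convergence:
  assumes [measurable]: "f \<in> borel_measurable M" "\<And>n. X n \<in> borel_measurable M"
    and w: "integrable M (\<lambda>x. (w x)\<^sup>2)"
    and bnd: "\<And>n x. x \<in> space M \<Longrightarrow> cmod (X n x) \<le> w x" "\<And>x. x \<in> space M \<Longrightarrow> cmod (f x) \<le> w x"
    and lim: "AE x in M. (\<lambda>n. X n x) \<longlonglongrightarrow> f x"
  shows "(\<lambda>n. L2_norm M (\<lambda>x. X n x - f x)) \<longlonglongrightarrow> 0"
proof -
  have "(\<lambda>n. LINT x|M. (cmod (X n x - f x))\<^sup>2) \<longlonglongrightarrow> (LINT x|M. 0)"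
  proof (rule integral_dominated_convergence[where w = "\<lambda>x. 4 * (w x)\<^sup>2"])
    show "integrable M (\<lambda>x. 4 * (w x)\<^sup>2)" using w by simp
    show "AE x in M. (\<lambda>n. (cmod (X n x - f x))\<^sup>2) \<longlonglongrightarrow> 0"
    proof (rule eventually_mono[OF lim])
      fix x assume "(\<lambda>n. X n x) \<longlonglongrightarrow> f x"
      then have "(\<lambda>n. (cmod (X n x - f x))\<^sup>2) \<longlonglongrightarrow> (cmod (f x - f x))\<^sup>2"
        by (intro tendsto_intros)
      then show "(\<lambda>n. (cmod (X n x - f x))\<^sup>2) \<longlonglongrightarrow> 0" by simp
    qed
    show "AE x in M. norm ((cmod (X n x - f x))\<^sup>2) \<le> 4 * (w x)\<^sup>2" for n
    proof (rule AE_I2)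
      fix x assume x: "x \<in> space M"
      have "cmod (X n x - f x) \<le> 2 * w x"
        using norm_triangle_ineq4[of "X n x" "f x"] bnd(1)[OF x, of n] bnd(2)[OF x] by linarith
      then have "(cmod (X n x - f x))\<^sup>2 \<le> (2 * w x)\<^sup>2" by (rule power_mono) simp
      then show "norm ((cmod (X n x - f x))\<^sup>2) \<le> 4 * (w x)\<^sup>2" by (simp add: power_mult_distrib)
    qed
  qed measurable
  then have "(\<lambda>n. sqrt (LINT x|M. (cmod (X n x - f x))\<^sup>2)) \<longlonglongrightarrow> sqrt 0"
    by (intro tendsto_real_sqrt) simp
  then show ?thesis by (simp add: L2_norm_def)
qed

lemma L2_norm_mono:
  assumes "f \<in> L2_space M" "g \<in> L2_space M" "\<And>x. x \<in> space M \<Longrightarrow> cmod (f x) \<le> cmod (g x)"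
  shows "L2_norm M f \<le> L2_norm M g"
  unfolding L2_norm_def using L2_spaceD(2)[OF assms(1)] L2_spaceD(2)[OF assms(2)]
  by (intro real_sqrt_le_mono integral_mono power_mono assms(3)) auto

lemma AE_weighted:
  assumes "negligible N"
  shows "AE x in weighted_measure \<mu>. x \<notin> N"
proof -
  have "AE x in lebesgue. x \<notin> N"
    using assms by (intro AE_not_in) (simp add: negligible_iff_null_sets)
  then have "AE x in lebesgue_on pos_orthant. x \<notin> N"
    by (subst AE_restrict_space_iff) (auto simp: pos_orthant_lebesgue elim: eventually_mono)
  moreover have "(\<lambda>t. ennreal (monomial t \<mu>)) \<in> borel_measurable (lebesgue_on pos_orthant)"
    using borel_imp_lebesgue_on[OF borel_measurable_monomial] by measurable
  ultimately show ?thesis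
    unfolding weighted_measure_def by (subst AE_density) (auto elim: eventually_mono)
qed

text \<open>
  A measurable function is almost everywhere a limit of continuous functions.  Clipping their values to
  modulus \<open>B\<close> and cutting them off beyond \<open>b\<close> does not change the limit and makes the convergence
  dominated, so that it holds in norm; then the uniform approximation applies.
\<close>
lemma expo_span_dense_bounded:
  fixes \<mu> :: "real ^ 'n" and F :: "real ^ 'n \<Rightarrow> complex"
  assumes \<mu>: "\<And>l. 0 \<le> \<mu> $ l" and F: "F \<in> L2_space (weighted_measure \<mu>)"
    and B: "0 < B" "\<And>x. x \<in> pos_orthant \<Longrightarrow> cmod (F x) \<le> B"
    and b: "0 < b" "\<And>x l. x \<in> pos_orthant \<Longrightarrow> b < x $ l \<Longrightarrow> F x = 0"
    and e: "0 < e"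
  shows "\<exists>g\<in>expo_span. L2_norm (weighted_measure \<mu>) (\<lambda>x. g x - F x) < e"
proof -
  let ?M = "weighted_measure \<mu>"
  have "F measurable_on pos_orthant"
    using L2_spaceD(1)[OF F] measurable_on_iff_borel_measurable[OF pos_orthant_lebesgue, where f = F]
    by (simp add: measurable_weighted_iff)
  then obtain N G where N: "negligible N" and G: "\<And>k. continuous_on UNIV (G k)"
    and lim: "\<And>x. x \<notin> N \<Longrightarrow> (\<lambda>k. G k x) \<longlonglongrightarrow> (if x \<in> pos_orthant then F x else 0)"
    unfolding measurable_on_def by blast
  define tent where "tent x = (\<Prod>l\<in>UNIV. max 0 (min 1 (2 - x $ l / b)))" for x :: "real ^ 'n"
  define clip where "clip w = w * of_real (B / max B (cmod w))" for w
  define H where "H k x = of_real (tent x) * clip (G k x)" for k x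
  have clip_le: "cmod (clip w) \<le> B" for w
  proof -
    have m: "0 < max B (cmod w)" "cmod w \<le> max B (cmod w)" using B(1) by auto
    have "cmod (clip w) = cmod w * (B / max B (cmod w))"
      unfolding clip_def norm_mult norm_of_real using m B(1) by simp
    also have "\<dots> \<le> max B (cmod w) * (B / max B (cmod w))"
      using m B(1) by (intro mult_right_mono) auto
    also have "\<dots> = B" using m by simp
    finally show ?thesis .
  qed
  have clip_id: "clip w = w" if "cmod w \<le> B" for w
    using B(1) that by (simp add: clip_def max_def)
  have cclip: "isCont clip w" for w
    unfolding clip_def using B(1) by (intro continuous_intros) (auto simp: max_def)
  have ctent: "continuous_on UNIV tent"
    unfolding tent_def using b(1) by (intro continuous_intros) auto
  have tent01: "0 \<le> tent x" "tent x \<le> 1" for x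
    unfolding tent_def by (intro prod_nonneg prod_le_1; auto)+
  have tent_0: "tent x = 0" if "2 * b \<le> x $ l" for x l
  proof -
    have "max 0 (min 1 (2 - x $ l / b)) = 0" using that b(1) by (simp add: field_simps)
    then show ?thesis unfolding tent_def by (intro prod_zero) auto
  qed
  have tent_1: "tent x = 1" if "\<And>l. x $ l \<le> b" for x
    unfolding tent_def using that b(1) by (intro prod.neutral) (simp add: field_simps)
  have cH: "continuous_on UNIV (H k)" for k
  proof -
    have "continuous_on UNIV clip" using cclip by (simp add: continuous_at_imp_continuous_on)
    then have "continuous_on UNIV (\<lambda>x. clip (G k x))" using G continuous_on_compose2 by blast
    then show ?thesis unfolding H_def by (intro continuous_on_mult continuous_on_of_real ctent)
  qed
  have E: "expo 1 \<in> orthant_schwartz" by (rule schwartz_expo) simp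
  have EL: "expo 1 \<in> L2_space ?M" by (rule schwartz_L2(1)[OF E \<mu>])
  \<comment> \<open>on the support of the cut-off the exponential \<open>expo 1\<close> is at least \<open>exp (- 2 * b * CARD('n))\<close>\<close>
  define c where "c = B * exp (2 * b * CARD('n))"
  have w: "B * indicator {x. \<forall>l. x $ l \<le> 2 * b} x \<le> c * cmod (expo 1 x)" if x: "x \<in> pos_orthant" for x :: "real ^ 'n"
  proof (cases "\<forall>l. x $ l \<le> 2 * b")
    case True
    have "exp (- (2 * b * CARD('n))) = (\<Prod>l\<in>(UNIV :: 'n set). exp (- (2 * b)))"
      by (simp add: exp_of_nat_mult[symmetric] mult.commute)
    also have "\<dots> \<le> (\<Prod>l\<in>UNIV. exp (- (x $ l)))"
      using True by (intro prod_mono) auto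
    also have "\<dots> = cmod (expo 1 x)" using x by (simp add: norm_expo)
    finally have "B * (exp (2 * b * CARD('n)) * exp (- (2 * b * CARD('n)))) \<le> c * cmod (expo 1 x)"
      unfolding c_def using B(1) by (simp add: mult.assoc)
    then show ?thesis using True by (simp add: exp_minus)
  qed (use B(1) in \<open>auto simp: c_def\<close>)
  have Hb: "cmod (H k x) \<le> c * cmod (expo 1 x)" if x: "x \<in> pos_orthant" for k x
  proof -
    have "cmod (H k x) \<le> B * indicator {x. \<forall>l. x $ l \<le> 2 * b} x"
    proof (cases "\<forall>l. x $ l \<le> 2 * b")
      case True
      then show ?thesis
        using mult_mono[OF tent01(2)[of x] clip_le[of "G k x"]] tent01(1)[of x] by (simp add: H_def norm_mult)
    next
      case False
      then have "tent x = 0" using tent_0[of x] by (meson less_imp_le not_le)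
      then show ?thesis by (simp add: H_def B(1) less_imp_le)
    qed
    then show ?thesis using w[OF x] by linarith
  qed
  have Fb: "cmod (F x) \<le> c * cmod (expo 1 x)" if x: "x \<in> pos_orthant" for x
  proof (cases "\<forall>l. x $ l \<le> b")
    case True
    then have "\<forall>l. x $ l \<le> 2 * b" using b(1) by (metis add_increasing less_imp_le mult_2)
    then show ?thesis using B(2)[OF x] w[OF x] by simp
  next
    case False
    then have "F x = 0" using b(2)[OF x] by (meson not_le)
    then show ?thesis using B(1) by (simp add: c_def)
  qed
  have Hm: "H k \<in> borel_measurable borel" for k by (rule borel_measurable_continuous_onI[OF cH])
  have HM: "H k \<in> borel_measurable ?M" for k by (rule borel_imp_weighted[OF Hm])
  have wi: "integrable ?M (\<lambda>x. (c * cmod (expo 1 x))\<^sup>2)"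
    using L2_spaceD(2)[OF EL] by (simp add: power_mult_distrib)
  have conv: "(\<lambda>k. L2_norm ?M (\<lambda>x. H k x - F x)) \<longlonglongrightarrow> 0"
  proof (rule L2_dominated_convergence[OF L2_spaceD(1)[OF F] HM wi])
    have "AE x in ?M. x \<in> space ?M \<and> x \<notin> N" using AE_weighted[OF N, of \<mu>] by (auto elim: eventually_mono)
    then show "AE x in ?M. (\<lambda>k. H k x) \<longlonglongrightarrow> F x"
    proof (rule eventually_mono)
      fix x assume "x \<in> space ?M \<and> x \<notin> N"
      then have x: "x \<in> pos_orthant" "x \<notin> N" by (auto simp: space_weighted)
      have "(\<lambda>k. H k x) \<longlonglongrightarrow> of_real (tent x) * clip (F x)"
        unfolding H_def using lim[OF x(2)] x(1)
        by (intro tendsto_intros isCont_tendsto_compose[OF cclip]) auto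
      also have "of_real (tent x) * clip (F x) = F x"
      proof (cases "\<forall>l. x $ l \<le> b")
        case True
        then show ?thesis using tent_1[of x] clip_id[OF B(2)[OF x(1)]] by simp
      next
        case False
        then have "F x = 0" using b(2)[OF x(1)] by (meson not_le)
        then show ?thesis by (simp add: clip_def)
      qed
      finally show "(\<lambda>k. H k x) \<longlonglongrightarrow> F x" .
    qed
  qed (use Hb Fb in \<open>auto simp: space_weighted\<close>)
  then obtain k where k: "L2_norm ?M (\<lambda>x. H k x - F x) < e / 2"
    using e by (auto simp: lim_sequentially dist_real_def abs_of_nonneg[OF L2_norm_nonneg] dest!: spec[of _ "e/2"])
  have HL: "H k \<in> L2_space ?M"
  proof (rule L2_space_dominated[OF HM wi])
    show "(cmod (H k x))\<^sup>2 \<le> (c * cmod (expo 1 x))\<^sup>2" if "x \<in> space ?M" for x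
      using that Hb by (intro power_mono) (auto simp: space_weighted)
  qed
  define \<epsilon> where "\<epsilon> = e / 4 / (L2_norm ?M (expo 1) + 1)"
  have \<epsilon>: "0 < \<epsilon>" using e L2_norm_nonneg[of ?M "expo 1"] by (simp add: \<epsilon>_def)
  have H0: "H k x = 0" if "2 * b \<le> x $ l" for x l using tent_0[OF that] by (simp add: H_def)
  obtain g where g: "g \<in> expo_span" "\<And>x. x \<in> pos_orthant \<Longrightarrow> cmod (H k x - g x) \<le> \<epsilon> * cmod (expo 1 x)"
  proof -
    have "\<exists>g\<in>expo_span. \<forall>x\<in>pos_orthant. cmod (H k x - g x) \<le> \<epsilon> * cmod (expo 1 x)"
      by (rule expo_span_uniform_approx[OF cH _ \<epsilon>]) (erule H0)
    then show thesis using that by blast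
  qed
  have gL: "g \<in> L2_space ?M" by (rule schwartz_L2(1)[OF expo_span_schwartz[OF g(1)] \<mu>])
  have "L2_norm ?M (\<lambda>x. H k x - g x) \<le> L2_norm ?M (\<lambda>x. of_real \<epsilon> * expo 1 x)"
    using g(2) \<epsilon> L2_space_lincomb[OF EL EL, of "of_real \<epsilon>" 0]
    by (intro L2_norm_mono L2_space_diff HL gL) (auto simp: space_weighted norm_mult)
  also have "\<dots> = \<epsilon> * L2_norm ?M (expo 1)" using \<epsilon> by (simp add: L2_norm_cmult)
  also have "\<dots> \<le> e / 4"
    using e L2_norm_nonneg[of ?M "expo 1"] by (simp add: \<epsilon>_def field_simps)
  finally have "L2_norm ?M (\<lambda>x. g x - H k x) \<le> e / 4" by (simp add: L2_norm_minus_commute)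
  then have "L2_norm ?M (\<lambda>x. g x - F x) < e"
    using L2_norm_triangle_diff[OF gL HL F] k e by linarith
  then show ?thesis using g(1) by blast
qed

lemma expo_span_dense:
  fixes \<mu> :: "real ^ 'n" and f :: "real ^ 'n \<Rightarrow> complex"
  assumes \<mu>: "\<And>l. 0 \<le> \<mu> $ l" and f: "f \<in> L2_space (weighted_measure \<mu>)" and e: "0 < e"
  shows "\<exists>g\<in>expo_span. L2_norm (weighted_measure \<mu>) (\<lambda>x. g x - f x) < e"
proof -
  let ?M = "weighted_measure \<mu>"
  note [measurable] = L2_spaceD(1)[OF f]
  have [measurable]: "(\<lambda>x. x $ l) \<in> borel_measurable ?M" for l
    by (intro borel_imp_weighted borel_measurable_continuous_onI continuous_intros)
  define F where "F n x = (if cmod (f x) \<le> real n + 1 \<and> (\<forall>l. x $ l \<le> real n + 1) then f x else 0)" for n x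
  have [measurable]: "F n \<in> borel_measurable ?M" for n unfolding F_def by measurable
  have Fle: "cmod (F n x) \<le> cmod (f x)" for n x by (simp add: F_def)
  have FL: "F n \<in> L2_space ?M" for n
    by (rule L2_space_dominated[OF _ L2_spaceD(2)[OF f]]) (auto intro!: power_mono Fle)
  have "(\<lambda>n. L2_norm ?M (\<lambda>x. F n x - f x)) \<longlonglongrightarrow> 0"
  proof (rule L2_dominated_convergence[where w = "\<lambda>x. cmod (f x)"])
    show "AE x in ?M. (\<lambda>n. F n x) \<longlonglongrightarrow> f x"
    proof (rule AE_I2, rule tendsto_eventually)
      fix x
      obtain n0 where n0: "cmod (f x) + (\<Sum>l\<in>UNIV. \<bar>x $ l\<bar>) \<le> real n0" using real_arch_simple by blast
      have "F n x = f x" if "n0 \<le> n" for n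
      proof -
        have "x $ l \<le> (\<Sum>l\<in>UNIV. \<bar>x $ l\<bar>)" for l
          using member_le_sum[of l UNIV "\<lambda>l. \<bar>x $ l\<bar>"] by (simp add: abs_le_iff)
        moreover have "real n0 \<le> real n" using that by simp
        moreover have "0 \<le> (\<Sum>l\<in>UNIV. \<bar>x $ l\<bar>)" by (simp add: sum_nonneg)
        ultimately have "cmod (f x) \<le> real n" "\<And>l. x $ l \<le> real n"
          using n0 norm_ge_zero[of "f x"] by (linarith, smt (verit))
        then have "cmod (f x) \<le> real n + 1" "\<And>l. x $ l \<le> real n + 1"
          by (simp, meson add_increasing2 zero_le_one)
        then show ?thesis by (simp add: F_def)
      qed
      then show "\<forall>\<^sub>F n in sequentially. F n x = f x" by (auto simp: eventually_sequentially)
    qed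
  qed (use L2_spaceD[OF f] Fle in auto)
  then obtain n where n: "L2_norm ?M (\<lambda>x. F n x - f x) < e / 2"
    using e by (auto simp: lim_sequentially dist_real_def abs_of_nonneg[OF L2_norm_nonneg] dest!: spec[of _ "e/2"])
  obtain g where g: "g \<in> expo_span" "L2_norm ?M (\<lambda>x. g x - F n x) < e / 2"
  proof -
    have "\<exists>g\<in>expo_span. L2_norm ?M (\<lambda>x. g x - F n x) < e / 2"
      by (rule expo_span_dense_bounded[OF \<mu> FL, where B = "real n + 1" and b = "real n + 1"])
        (use e in \<open>auto simp: F_def\<close>, meson not_le)
    then show thesis using that by blast
  qed
  have gL: "g \<in> L2_space ?M" by (rule schwartz_L2(1)[OF expo_span_schwartz[OF g(1)] \<mu>])
  have "L2_norm ?M (\<lambda>x. g x - f x) < e"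
    using L2_norm_triangle_diff[OF gL FL f, of n] g(2) n by linarith
  then show ?thesis using g(1) by blast
qed

section \<open>Inversion and Parseval's identity\<close>

lemma schwartz_eq_0_if_L2_norm_eq_0:
  fixes h :: "real ^ 'n \<Rightarrow> complex"
  assumes h: "h \<in> orthant_schwartz" and \<mu>: "\<And>l. 0 \<le> \<mu> $ l"
    and z: "L2_norm (weighted_measure \<mu>) h = 0"
  shows "h = (\<lambda>x. 0)"
proof -
  define S where "S = {x \<in> pos_orthant. h x \<noteq> 0}"
  have "open S"
  proof -
    have "open (h -` (- {0}) \<inter> pos_orthant)"
      using continuous_on_open_vimage[OF open_pos_orthant, of h]
        rapidly_decreasing_continuous[OF schwartz_rapidly_decreasing[OF h]] by (metis open_Compl closed_singleton)
    also have "h -` (- {0}) \<inter> pos_orthant = S" by (auto simp: S_def)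
    finally show ?thesis .
  qed
  have "(LINT x|lborel. monomial x \<mu> * (cmod (h x))\<^sup>2) = 0"
    using schwartz_L2(2)[OF h \<mu>] z by simp
  then have "AE x in lborel. monomial x \<mu> * (cmod (h x))\<^sup>2 = 0"
    by (subst (asm) integral_nonneg_eq_0_iff_AE)
      (auto intro: schwartz_weighted_square_integrable[OF h \<mu>] simp: monomial_nonneg)
  then have "AE x in lborel. x \<notin> S"
  proof (rule eventually_mono)
    fix x assume "monomial x \<mu> * (cmod (h x))\<^sup>2 = 0"
    then show "x \<notin> S" using monomial_pos[of x \<mu>] by (auto simp: S_def)
  qed
  then have "S \<in> null_sets lborel"
    using \<open>open S\<close> by (subst AE_iff_null_sets) auto
  then have "negligible S" by (simp add: negligible_iff_null_sets null_sets_completionI)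
  then have "S = {}" using \<open>open S\<close> open_not_negligible by blast
  then show ?thesis using schwartz_zero[OF h] by (auto simp: S_def fun_eq_iff)
qed

lemma borel_measurable_cnj [measurable (raw)]:
  assumes "f \<in> borel_measurable M"
  shows "(\<lambda>x. cnj (f x)) \<in> borel_measurable M"
  using measurable_compose[OF assms borel_measurable_continuous_onI[OF continuous_on_cnj[OF continuous_on_id]]]
  by simp

text \<open>
  For \<open>g\<close> in the span of the exponentials the mixed term in the square of the distance from \<open>g\<close> to the
  conjugate of \<open>h\<close> vanishes, so that distance is at least the norm of \<open>h\<close>.  By density it can be made
  arbitrarily small.
\<close>
lemma schwartz_orthogonal_expo:
  fixes h :: "real ^ 'n \<Rightarrow> complex"
  assumes h: "h \<in> orthant_schwartz" and \<mu>: "\<And>l. 0 \<le> \<mu> $ l"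
    and orth: "\<And>b. (\<And>l. 0 < b $ l) \<Longrightarrow> (LINT x|lborel. h x * (expo b x * of_real (monomial x \<mu>))) = 0"
  shows "h = (\<lambda>x. 0)"
proof (rule schwartz_eq_0_if_L2_norm_eq_0[OF h \<mu>])
  let ?M = "weighted_measure \<mu>"
  have span: "(LINT x|lborel. h x * (g x * of_real (monomial x \<mu>))) = 0" if "g \<in> expo_span" for g
    using that
  proof (induction rule: expo_span.induct)
    case (expo b c)
    have "(LINT x|lborel. h x * (c * expo b x * of_real (monomial x \<mu>)))
        = (LINT x|lborel. c * (h x * (expo b x * of_real (monomial x \<mu>))))"
      by (simp add: mult_ac)
    also have "\<dots> = 0" using orth[OF expo] by simp
    finally show ?case .
  next
    case (add f g)
    have "(LINT x|lborel. h x * ((f x + g x) * of_real (monomial x \<mu>)))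
        = (LINT x|lborel. h x * (f x * of_real (monomial x \<mu>)) + h x * (g x * of_real (monomial x \<mu>)))"
      by (simp add: algebra_simps)
    then show ?case
      using schwartz_weighted_integrable(2)[OF h expo_span_schwartz[OF add.hyps(1)] \<mu>]
        schwartz_weighted_integrable(2)[OF h expo_span_schwartz[OF add.hyps(2)] \<mu>] add.IH by simp
  qed
  note [measurable] = schwartz_borel_measurable[OF h]
  have hL: "h \<in> L2_space ?M" by (rule schwartz_L2(1)[OF h \<mu>])
  have cL: "(\<lambda>x. cnj (h x)) \<in> L2_space ?M"
    using L2_spaceD[OF hL] borel_measurable_cnj by (auto simp: L2_space_def)
  have le: "L2_norm ?M h \<le> e" if e: "0 < e" for e
  proof -
    obtain g where g: "g \<in> expo_span" "L2_norm ?M (\<lambda>x. g x - cnj (h x)) < e"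
      using expo_span_dense[OF \<mu> cL e] by blast
    note gS = expo_span_schwartz[OF g(1)]
    note [measurable] = schwartz_borel_measurable[OF gS]
    have ig: "integrable lborel (\<lambda>x. monomial x \<mu> * (cmod (g x))\<^sup>2)"
      and ih: "integrable lborel (\<lambda>x. monomial x \<mu> * (cmod (h x))\<^sup>2)"
      by (intro schwartz_weighted_square_integrable gS h \<mu>)+
    define \<rho> where "\<rho> x = Re (h x * (g x * of_real (monomial x \<mu>)))" for x
    have i\<rho>: "integrable lborel \<rho>"
      unfolding \<rho>_def by (intro integrable_Re schwartz_weighted_integrable(2) h gS \<mu>)
    have \<rho>0: "integral\<^sup>L lborel \<rho> = 0"
      unfolding \<rho>_def integral_Re[OF schwartz_weighted_integrable(2)[OF h gS \<mu>]] span[OF g(1)] by simp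
    have pt: "monomial x \<mu> * (cmod (g x - cnj (h x)))\<^sup>2 = monomial x \<mu> * (cmod (g x))\<^sup>2
        + monomial x \<mu> * (cmod (h x))\<^sup>2 - 2 * \<rho> x" for x
    proof -
      have sq: "(cmod (a - cnj b))\<^sup>2 = (cmod a)\<^sup>2 + (cmod b)\<^sup>2 - 2 * Re (b * a)" for a b :: complex
        unfolding cmod_power2 by (simp add: power2_eq_square algebra_simps)
      show ?thesis unfolding sq \<rho>_def by (simp add: algebra_simps)
    qed
    have "(LINT x|lborel. monomial x \<mu> * (cmod (h x))\<^sup>2)
        \<le> (LINT x|lborel. monomial x \<mu> * (cmod (g x))\<^sup>2) + (LINT x|lborel. monomial x \<mu> * (cmod (h x))\<^sup>2)"
      by (simp add: Bochner_Integration.integral_nonneg monomial_nonneg)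
    also have "\<dots> = (LINT x|lborel. monomial x \<mu> * (cmod (g x - cnj (h x)))\<^sup>2)"
      unfolding pt using ig ih i\<rho> \<rho>0 by simp
    also have "\<dots> = (L2_norm ?M (\<lambda>x. g x - cnj (h x)))\<^sup>2"
      unfolding L2_norm_power2
      by (subst weighted_integral(2)) (use schwartz_zero[OF h] schwartz_zero[OF gS] in auto)
    also have "\<dots> \<le> e\<^sup>2" using g(2) by (intro power_mono L2_norm_nonneg) auto
    finally have "(L2_norm ?M h)\<^sup>2 \<le> e\<^sup>2" unfolding schwartz_L2(2)[OF h \<mu>] .
    then show ?thesis by (rule power2_le_imp_le) (use e in simp)
  qed
  have "L2_norm ?M h \<le> 0" by (rule field_le_epsilon) (simp add: le)
  then show "L2_norm ?M h = 0" using L2_norm_nonneg[of ?M h] by simp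
qed

lemma schwartz_hankel_symmetric:
  fixes f g :: "real ^ 'n \<Rightarrow> complex"
  assumes r: "\<And>l. 0 < r $ l" and \<mu>: "\<And>l. 0 \<le> \<mu> $ l"
    and f: "f \<in> orthant_schwartz" and g: "g \<in> orthant_schwartz"
  shows "(LINT x|lborel. hankel r \<mu> f x * (g x * of_real (monomial x \<mu>)))
    = (LINT x|lborel. f x * (hankel r \<mu> g x * of_real (monomial x \<mu>)))"
proof -
  have "(LINT t|lborel. g t * of_real (monomial t \<mu>) * hankel_integral r \<mu> \<mu> f t)
    = (LINT x|lborel. f x * of_real (monomial x \<mu>) * hankel_integral r \<mu> \<mu> g x)"
    by (rule hankel_symmetric[OF r \<mu>])
      (use f g \<mu> in \<open>auto intro: schwartz_weighted_integrable(1) schwartz_borel_measurable schwartz_zero\<close>)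
  moreover have "g t * of_real (monomial t \<mu>) * hankel_integral r \<mu> \<mu> f t = hankel r \<mu> f t * (g t * of_real (monomial t \<mu>))" for t
    using schwartz_zero[OF g, of t] by (cases "t \<in> pos_orthant") (auto simp: hankel_apply)
  moreover have "f t * of_real (monomial t \<mu>) * hankel_integral r \<mu> \<mu> g t = f t * (hankel r \<mu> g t * of_real (monomial t \<mu>))" for t
    using schwartz_zero[OF f, of t] by (cases "t \<in> pos_orthant") (auto simp: hankel_apply)
  ultimately show ?thesis by simp
qed

text \<open>
  On the exponential with rate \<open>b\<close> the transform is explicit and changes the rate to $r/b$; applied
  twice it restores \<open>b\<close>.  Moving both transforms to the exponential by symmetry shows that the
  difference of the two sides is orthogonal to all exponentials.
\<close>
lemma hankel_hankel:
  fixes f :: "real ^ 'n \<Rightarrow> complex"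
  assumes r: "\<And>l. 0 < r $ l" and \<mu>: "\<And>l. 0 \<le> \<mu> $ l" and f: "f \<in> orthant_schwartz"
  shows "hankel r \<mu> (hankel r \<mu> f) = (\<lambda>x. of_real (\<Prod>l\<in>UNIV. r $ l powr (- \<mu> $ l - 1)) * f x)"
proof -
  define c where "c = complex_of_real (\<Prod>l\<in>UNIV. r $ l powr (- \<mu> $ l - 1))"
  let ?H = "hankel r \<mu>"
  have S: "?H f \<in> orthant_schwartz" if "f \<in> orthant_schwartz" for f
    by (rule schwartz_hankel[OF r that \<mu>])
  define h where "h x = 1 * ?H (?H f) x + (- c) * f x" for x
  have "h = (\<lambda>x. 0)"
  proof (rule schwartz_orthogonal_expo[OF _ \<mu>])
    show "h \<in> orthant_schwartz" unfolding h_def by (intro schwartz_lincomb(1) S f)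
    fix b :: "real ^ 'n" assume b: "\<And>l. 0 < b $ l"
    define P where "P b = complex_of_real (\<Prod>l\<in>UNIV. b $ l powr (- \<mu> $ l - 1))" for b :: "real ^ 'n"
    define b' where "b' = (\<chi> l. r $ l / b $ l)"
    have b': "\<And>l. 0 < b' $ l" using r b by (simp add: b'_def)
    have b'': "(\<chi> l. r $ l / b' $ l) = b" using r b by (simp add: b'_def vec_eq_iff less_imp_neq[symmetric])
    have eb: "expo b \<in> orthant_schwartz" "expo b' \<in> orthant_schwartz" by (intro schwartz_expo b b')+
    have He: "?H (expo b) = (\<lambda>t. P b * expo b' t)" "?H (expo b') = (\<lambda>t. P b' * expo b t)"
      using hankel_expo[OF r b \<mu>] hankel_expo[OF r b' \<mu>] unfolding b'' by (simp_all add: P_def b'_def)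
    have PP: "P b * P b' = c"
      unfolding P_def c_def b'_def of_real_mult[symmetric] prod.distrib[symmetric]
      using r b by (simp add: powr_mult[symmetric] less_imp_neq[symmetric] less_imp_le)
    have "(LINT x|lborel. ?H (?H f) x * (expo b x * of_real (monomial x \<mu>)))
        = (LINT x|lborel. ?H f x * (P b * expo b' x * of_real (monomial x \<mu>)))"
      unfolding schwartz_hankel_symmetric[OF r \<mu> S[OF f] eb(1)] He ..
    also have "\<dots> = P b * (LINT x|lborel. ?H f x * (expo b' x * of_real (monomial x \<mu>)))"
      by (subst integral_mult_right_zero[symmetric]) (simp add: mult_ac)
    also have "(LINT x|lborel. ?H f x * (expo b' x * of_real (monomial x \<mu>)))
        = (LINT x|lborel. f x * (P b' * expo b x * of_real (monomial x \<mu>)))"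
      unfolding schwartz_hankel_symmetric[OF r \<mu> f eb(2)] He ..
    also have "\<dots> = P b' * (LINT x|lborel. f x * (expo b x * of_real (monomial x \<mu>)))"
      by (subst integral_mult_right_zero[symmetric]) (simp add: mult_ac)
    finally have eq: "(LINT x|lborel. ?H (?H f) x * (expo b x * of_real (monomial x \<mu>)))
        = c * (LINT x|lborel. f x * (expo b x * of_real (monomial x \<mu>)))"
      by (simp add: PP[symmetric] mult.assoc)
    have "(LINT x|lborel. h x * (expo b x * of_real (monomial x \<mu>)))
        = (LINT x|lborel. ?H (?H f) x * (expo b x * of_real (monomial x \<mu>)) - c * (f x * (expo b x * of_real (monomial x \<mu>))))"
      unfolding h_def by (simp add: algebra_simps)
    also have "\<dots> = 0"
      using schwartz_weighted_integrable(2)[OF S[OF S[OF f]] eb(1) \<mu>] schwartz_weighted_integrable(2)[OF f eb(1) \<mu>] eq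
      by simp
    finally show "(LINT x|lborel. h x * (expo b x * of_real (monomial x \<mu>))) = 0" .
  qed
  then show ?thesis by (auto simp: h_def fun_eq_iff c_def)
qed

text \<open>
  Symmetry moves the transform from the conjugate of \<open>hankel r \<mu> f\<close> to \<open>hankel r \<mu> f\<close>, where the inversion
  formula removes both.
\<close>
lemma hankel_parseval:
  fixes f :: "real ^ 'n \<Rightarrow> complex"
  assumes r: "\<And>l. 0 < r $ l" and \<mu>: "\<And>l. 0 \<le> \<mu> $ l" and f: "f \<in> orthant_schwartz"
  shows "L2_norm (weighted_measure \<mu>) (hankel r \<mu> f)
    = sqrt (\<Prod>l\<in>UNIV. r $ l powr (- \<mu> $ l - 1)) * L2_norm (weighted_measure \<mu>) f"
proof -
  define c where "c = (\<Prod>l\<in>UNIV. r $ l powr (- \<mu> $ l - 1))"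
  have c: "0 \<le> c" unfolding c_def by (intro prod_nonneg) auto
  let ?H = "hankel r \<mu>" and ?M = "weighted_measure \<mu>"
  have Hf: "?H f \<in> orthant_schwartz" by (rule schwartz_hankel[OF r f \<mu>])
  note [measurable] = schwartz_borel_measurable[OF f]
  have norm_eq: "of_real ((L2_norm ?M g)\<^sup>2) = (LINT x|lborel. of_real (monomial x \<mu>) * (g x * cnj (g x)))"
    if "g \<in> orthant_schwartz" for g
    unfolding schwartz_L2(2)[OF that \<mu>] complex_norm_square[symmetric] of_real_mult[symmetric]
    by (rule integral_complex_of_real[symmetric])
  have cnj_int: "hankel_integral r \<mu> \<mu> (\<lambda>x. cnj (f x)) t = cnj (hankel_integral r \<mu> \<mu> f t)" for t
  proof -
    have "(LINT x|lborel. cnj (f x * of_real (kern r \<mu> \<mu> x t))) = cnj (hankel_integral r \<mu> \<mu> f t)"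
      unfolding hankel_integral_def by (rule Bochner_Integration.integral_cnj)
    then show ?thesis by (simp add: hankel_integral_def)
  qed
  have "of_real ((L2_norm ?M (?H f))\<^sup>2) = (LINT x|lborel. of_real (monomial x \<mu>) * (?H f x * cnj (?H f x)))"
    by (rule norm_eq[OF Hf])
  also have "\<dots> = (LINT x|lborel. ?H f x * of_real (monomial x \<mu>) * hankel_integral r \<mu> \<mu> (\<lambda>x. cnj (f x)) x)"
  proof (rule Bochner_Integration.integral_cong[OF refl])
    fix x show "of_real (monomial x \<mu>) * (?H f x * cnj (?H f x)) = ?H f x * of_real (monomial x \<mu>) * hankel_integral r \<mu> \<mu> (\<lambda>x. cnj (f x)) x"
      by (cases "x \<in> pos_orthant") (simp_all add: hankel_outside hankel_apply cnj_int)
  qed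
  also have "\<dots> = (LINT x|lborel. cnj (f x) * of_real (monomial x \<mu>) * hankel_integral r \<mu> \<mu> (?H f) x)"
  proof (rule hankel_symmetric[OF r \<mu>])
    have "integrable lborel (\<lambda>x. cnj (f x * of_real (monomial x \<mu>)))"
      using schwartz_weighted_integrable(1)[OF f f \<mu>] by (intro integrable_cnj) 
    then show "integrable lborel (\<lambda>x. cnj (f x) * of_real (monomial x \<mu>))" by simp
    show "(\<lambda>x. cnj (f x)) \<in> borel_measurable borel"
      by (rule borel_measurable_cnj[OF schwartz_borel_measurable[OF f]])
  qed (use schwartz_weighted_integrable(1)[OF Hf Hf \<mu>] schwartz_zero[OF f] schwartz_borel_measurable[OF Hf] in
      \<open>auto simp: hankel_outside\<close>)
  also have "\<dots> = (LINT x|lborel. of_real c * (of_real (monomial x \<mu>) * (f x * cnj (f x))))"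
  proof (rule Bochner_Integration.integral_cong[OF refl])
    fix x show "cnj (f x) * of_real (monomial x \<mu>) * hankel_integral r \<mu> \<mu> (?H f) x = of_real c * (of_real (monomial x \<mu>) * (f x * cnj (f x)))"
    proof (cases "x \<in> pos_orthant")
      case True
      show ?thesis
        using fun_cong[OF hankel_hankel[OF r \<mu> f], of x]
        unfolding hankel_apply[OF True, of r \<mu> "?H f"] c_def by (simp add: mult_ac)
    qed (simp add: schwartz_zero[OF f])
  qed
  also have "\<dots> = of_real (c * (L2_norm ?M f)\<^sup>2)"
    unfolding integral_mult_right_zero norm_eq[OF f, symmetric] by simp
  finally have "(L2_norm ?M (?H f))\<^sup>2 = c * (L2_norm ?M f)\<^sup>2" by (simp only: of_real_eq_iff)
  then have "sqrt ((L2_norm ?M (?H f))\<^sup>2) = sqrt (c * (L2_norm ?M f)\<^sup>2)" by simp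
  then show ?thesis unfolding c_def[symmetric] by (simp add: real_sqrt_mult L2_norm_nonneg)
qed

lemma orthant_part_Dp_schwartz:
  assumes "f \<in> orthant_schwartz"
  shows "orthant_part (Dp p f) \<in> orthant_schwartz"
  using assms
proof (induction p arbitrary: f rule: multiindex_induct)
  case zero
  have "orthant_part f = f" using schwartz_zero[OF zero] by (auto simp: orthant_part_def)
  then show ?case using zero by (simp add: Dp_zero)
next
  case (add p l)
  have "orthant_part (Dp (p + axis l 1) f) = orthant_part (Dp p (pd l f))"
    using Dp_add_axis[OF add.prems] by (auto simp: orthant_part_def)
  then show ?case using add.IH[OF schwartz_pd[OF add.prems]] by simp
qed

lemma Dp_hankel:
  fixes f :: "real ^ 'n \<Rightarrow> complex"
  assumes r: "\<And>l. 0 < r $ l" and \<mu>: "\<And>l. 0 \<le> \<mu> $ l" and f: "f \<in> orthant_schwartz" and t: "t \<in> pos_orthant"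
  shows "Dp k (hankel r \<mu> f) t = of_real (\<Prod>l\<in>UNIV. (- r $ l) ^ (k $ l)) * hankel r (\<mu> + real_vec k) f t"
  using \<mu>
proof (induction k arbitrary: \<mu> rule: multiindex_induct)
  case zero
  have "\<mu> + real_vec 0 = \<mu>" by (simp add: vec_eq_iff)
  then show ?case by (simp add: Dp_zero)
next
  case (add k l)
  have S: "hankel r (\<mu> + axis l 1) f \<in> orthant_schwartz"
    by (rule schwartz_hankel[OF r f nonneg_add_axis[OF add.prems]])
  have "Dp (k + axis l 1) (hankel r \<mu> f) t = Dp k (\<lambda>t. - of_real (r $ l) * hankel r (\<mu> + axis l 1) f t + 0 * hankel r (\<mu> + axis l 1) f t) t"
    unfolding Dp_add_axis[OF schwartz_hankel[OF r f add.prems] t] pd_hankel[OF r f add.prems] by simp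
  also have "\<dots> = - of_real (r $ l) * (of_real (\<Prod>i\<in>UNIV. (- r $ i) ^ (k $ i)) * hankel r (\<mu> + axis l 1 + real_vec k) f t)"
    unfolding Dp_lincomb[OF S S t] by (simp add: add.IH[OF nonneg_add_axis[OF add.prems]])
  also have "\<mu> + axis l 1 + real_vec k = \<mu> + real_vec (k + axis l 1)"
    unfolding real_vec_add_axis by (simp add: add_ac)
  also have "- of_real (r $ l) * (of_real (\<Prod>i\<in>UNIV. (- r $ i) ^ (k $ i)) * hankel r (\<mu> + real_vec (k + axis l 1)) f t)
    = of_real (\<Prod>i\<in>UNIV. (- r $ i) ^ ((k + axis l 1) $ i)) * hankel r (\<mu> + real_vec (k + axis l 1)) f t"
  proof -
    have "(\<Prod>i\<in>UNIV. (- r $ i) ^ ((k + axis l 1) $ i)) = (\<Prod>i\<in>UNIV. (if i = l then - r $ l else 1) * (- r $ i) ^ (k $ i))"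
      by (intro prod.cong refl) (simp add: axis_def)
    also have "\<dots> = - r $ l * (\<Prod>i\<in>UNIV. (- r $ i) ^ (k $ i))"
      by (simp only: prod.distrib) simp
    finally show ?thesis by simp
  qed
  finally show ?case .
qed

lemma hankel_Dp:
  fixes f :: "real ^ 'n \<Rightarrow> complex"
  assumes r: "\<And>l. 0 < r $ l" and \<mu>: "\<And>l. 0 \<le> \<mu> $ l" and f: "f \<in> orthant_schwartz"
  shows "hankel r (\<mu> + real_vec p) (orthant_part (Dp p f)) = (\<lambda>t. (- 1) ^ (\<Sum>l\<in>UNIV. p $ l) * hankel r \<mu> f t)"
  using \<mu> f
proof (induction p arbitrary: \<mu> f rule: multiindex_induct)
  case zero
  have "\<mu> + real_vec 0 = \<mu>" by (simp add: vec_eq_iff)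
  moreover have "orthant_part f = f" using schwartz_zero[OF zero(2)] by (auto simp: orthant_part_def)
  ultimately show ?case by (simp add: Dp_zero)
next
  case (add p l)
  have e1: "orthant_part (Dp (p + axis l 1) f) = orthant_part (Dp p (pd l f))"
    using Dp_add_axis[OF add.prems(2)] by (auto simp: orthant_part_def)
  have e2: "\<mu> + real_vec (p + axis l 1) = \<mu> + axis l 1 + real_vec p"
    unfolding real_vec_add_axis by (simp add: add_ac)
  have e3: "(\<Sum>i\<in>UNIV. (p + axis l 1) $ i) = Suc (\<Sum>i\<in>UNIV. p $ i)"
    by (simp add: sum.distrib) (simp add: axis_def)
  show ?case
    unfolding e1 e2 e3 add.IH[OF nonneg_add_axis[OF add.prems(1)] schwartz_pd[OF add.prems(2)]]
      hankel_pd[OF r add.prems(2,1)] by simp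
qed

lemma weighted_derivative_norm:
  fixes F h :: "real ^ 'n \<Rightarrow> complex"
  assumes F: "F \<in> orthant_schwartz" and \<nu>: "\<And>l. 0 \<le> \<nu> $ l"
    and h: "\<And>t. t \<in> pos_orthant \<Longrightarrow> h t = F t" and \<sigma>: "\<sigma> + \<sigma> = \<nu>"
  shows "(\<lambda>t. of_real (monomial t \<sigma>) * h t) \<in> L2_space (lebesgue_on pos_orthant)"
    and "L2_norm (lebesgue_on pos_orthant) (\<lambda>t. of_real (monomial t \<sigma>) * h t) = L2_norm (weighted_measure \<nu>) F"
proof -
  note [measurable] = schwartz_borel_measurable[OF F]
  let ?W = "\<lambda>t. of_real (monomial t \<sigma>) * F t"
  let ?N = "lebesgue_on (pos_orthant :: (real ^ 'n) set)"
  have sq: "(cmod (?W t))\<^sup>2 = monomial t \<nu> * (cmod (F t))\<^sup>2" for t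
    using monomial_add[of t \<sigma> \<sigma>] monomial_nonneg[of t \<sigma>] unfolding \<sigma>
    by (simp add: norm_mult power2_eq_square mult_ac)
  have W: "?W \<in> borel_measurable borel" by measurable
  have W2: "(\<lambda>t. (cmod (?W t))\<^sup>2) \<in> borel_measurable borel" by measurable
  have z: "(cmod (?W t))\<^sup>2 = 0" if "t \<notin> pos_orthant" for t using schwartz_zero[OF F that] by simp
  have "?W \<in> L2_space ?N"
    unfolding L2_space_def
  proof (intro CollectI conjI)
    show "?W \<in> borel_measurable ?N" by (rule borel_imp_lebesgue_on[OF W])
    show "integrable ?N (\<lambda>t. (cmod (?W t))\<^sup>2)"
      using schwartz_weighted_square_integrable[OF F \<nu>]
      by (subst lebesgue_on_orthant_integral(1)[OF W2]) (erule z, simp only: sq)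
  qed
  moreover have "(\<lambda>t. of_real (monomial t \<sigma>) * h t) \<in> L2_space ?N \<longleftrightarrow> ?W \<in> L2_space ?N"
  proof -
    have "(\<lambda>t. of_real (monomial t \<sigma>) * h t) \<in> borel_measurable ?N \<longleftrightarrow> ?W \<in> borel_measurable ?N"
      by (rule measurable_cong) (simp add: h)
    moreover have "integrable ?N (\<lambda>t. (cmod (of_real (monomial t \<sigma>) * h t))\<^sup>2) \<longleftrightarrow> integrable ?N (\<lambda>t. (cmod (?W t))\<^sup>2)"
      by (rule Bochner_Integration.integrable_cong[OF refl]) (simp add: h)
    ultimately show ?thesis by (simp only: L2_space_def mem_Collect_eq)
  qed
  ultimately show "(\<lambda>t. of_real (monomial t \<sigma>) * h t) \<in> L2_space ?N" by simp
  have "L2_norm ?N (\<lambda>t. of_real (monomial t \<sigma>) * h t) = L2_norm ?N ?W"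
    unfolding L2_norm_def using h by (auto intro!: Bochner_Integration.integral_cong)
  also have "\<dots> = sqrt (LINT t|lborel. monomial t \<nu> * (cmod (F t))\<^sup>2)"
    unfolding L2_norm_def by (subst lebesgue_on_orthant_integral(2)[OF W2]) (erule z, simp only: sq)
  also have "\<dots> = L2_norm (weighted_measure \<nu>) F"
    unfolding schwartz_L2(2)[OF F \<nu>, symmetric] by (simp add: L2_norm_nonneg)
  finally show "L2_norm ?N (\<lambda>t. of_real (monomial t \<sigma>) * h t) = L2_norm (weighted_measure \<nu>) F" .
qed

text \<open>
  Apart from the sign, the derivative is $r^k$ times the transform of order $\mu+k$ of \<open>f\<close>, and this is
  the transform of order \<open>\<nu>\<close> of \<open>Dp p f\<close>, to which Parseval's identity applies.
\<close>
lemma L2_norm_Dp_hankel: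
  fixes f :: "real ^ 'n \<Rightarrow> complex"
  assumes r: "\<And>l. 0 < r $ l" and \<mu>: "\<And>l. 0 \<le> \<mu> $ l" and f: "f \<in> orthant_schwartz"
    and \<nu>: "\<nu> = \<mu> + real_vec k + real_vec p"
  shows "L2_norm (weighted_measure \<nu>) (orthant_part (Dp k (hankel r \<mu> f)))
    = (\<Prod>l\<in>UNIV. r $ l ^ (k $ l)) * sqrt (\<Prod>l\<in>UNIV. r $ l powr (- \<nu> $ l - 1))
      * L2_norm (weighted_measure \<nu>) (orthant_part (Dp p f))"
proof -
  let ?W = "weighted_measure \<nu>"
  have \<mu>k: "0 \<le> (\<mu> + real_vec k) $ l" and \<nu>0: "0 \<le> \<nu> $ l" for l using \<mu>[of l] by (auto simp: \<nu>)
  define c where "c = (\<Prod>l\<in>UNIV. (- r $ l) ^ (k $ l))"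
  have absc: "\<bar>c\<bar> = (\<Prod>l\<in>UNIV. r $ l ^ (k $ l))"
    unfolding c_def abs_prod using r by (simp add: power_abs less_imp_le)
  have "orthant_part (Dp k (hankel r \<mu> f)) = (\<lambda>t. of_real c * hankel r (\<mu> + real_vec k) f t)"
    using Dp_hankel[OF r \<mu> f] by (auto simp: orthant_part_def c_def hankel_outside)
  then have "L2_norm ?W (orthant_part (Dp k (hankel r \<mu> f))) = \<bar>c\<bar> * L2_norm ?W (hankel r (\<mu> + real_vec k) f)"
    by (simp add: L2_norm_cmult)
  also have "L2_norm ?W (hankel r (\<mu> + real_vec k) f) = L2_norm ?W (hankel r \<nu> (orthant_part (Dp p f)))"
    unfolding \<nu> hankel_Dp[OF r \<mu>k f] L2_norm_cmult by (simp add: norm_power)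
  also have "\<dots> = sqrt (\<Prod>l\<in>UNIV. r $ l powr (- \<nu> $ l - 1)) * L2_norm ?W (orthant_part (Dp p f))"
    by (rule hankel_parseval[OF r \<nu>0 orthant_part_Dp_schwartz[OF f]])
  finally show ?thesis unfolding absc by simp
qed

section \<open>The fractional powers\<close>

text \<open>
  What remains of the prefactor and of all branches of powers in one coordinate once the dependence on
  \<open>x\<close> and \<open>t\<close> has been split off.
\<close>
definition phase :: "complex \<Rightarrow> real \<Rightarrow> complex" where
  "phase z \<gamma> = z powr of_real (- \<gamma> / 2) * (csqrt z / (1 - z)) powr of_real \<gamma> * inverse (1 - z)"

lemma csqrt_of_real_mult:
  assumes "0 < a"
  shows "csqrt (of_real a * z) = of_real (sqrt a) * csqrt z"
proof (rule csqrt_unique)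
  show "(of_real (sqrt a) * csqrt z)\<^sup>2 = of_real a * z"
    using assms by (simp add: power_mult_distrib flip: of_real_power)
  show "0 < Re (of_real (sqrt a) * csqrt z) \<or>
      Re (of_real (sqrt a) * csqrt z) = 0 \<and> 0 \<le> Im (of_real (sqrt a) * csqrt z)"
    using csqrt_principal[of z] assms by (auto simp del: csqrt.simps)
qed

text \<open>
  On the unit circle $|1-z|^2 = (1-z)(1-1/z) = -(1-z)^2/z$.
\<close>
lemma csqrt_quotient_square:
  assumes "cmod z = 1" "z \<noteq> 1"
  shows "(csqrt z / (1 - z))\<^sup>2 = - of_real (inverse ((cmod (1 - z))\<^sup>2))"
proof -
  have zz: "z * cnj z = 1" using assms(1) complex_norm_square[of z] by simp
  have "of_real ((cmod (1 - z))\<^sup>2) * z = - (1 - z)\<^sup>2"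
    unfolding complex_norm_square using zz by (simp add: power2_eq_square algebra_simps)
  moreover have "(cmod (1 - z))\<^sup>2 \<noteq> 0" "1 - z \<noteq> 0" using assms(2) by auto
  ultimately show ?thesis by (simp add: power_divide field_simps)
qed

text \<open>
  The positive factor $x t$ can be pulled out of the principal branches, and its powers in the two
  places where it occurs cancel.  The argument of the Bessel series is then $-|1-z|^{-2}\, x t$.
\<close>
lemma hankel_clifford_factor_eq:
  assumes z: "cmod z = 1" "z \<noteq> 1" and \<gamma>: "0 \<le> \<gamma>" and x: "0 < x" and t: "0 < t"
  shows "inverse (1 - z) * hankel_clifford_factor z \<gamma> x t
    = phase z \<gamma> * of_real (x powr \<gamma> * clifford \<gamma> (inverse ((cmod (1 - z))\<^sup>2) * (x * t)))"
proof -
  define a where "a = x * t"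
  define r where "r = inverse ((cmod (1 - z))\<^sup>2)"
  define v where "v = csqrt z / (1 - z)"
  have a: "0 < a" using x t by (simp add: a_def)
  have w: "2 * csqrt (of_real a * z) / (1 - z) / 2 = of_real (sqrt a) * v"
  proof -
    have "2 * u / d / 2 = u / d" for u d :: complex by simp
    then show ?thesis unfolding csqrt_of_real_mult[OF a] v_def times_divide_eq_right .
  qed
  have "(of_real (sqrt a) * v)\<^sup>2 = of_real (- (r * a))"
    unfolding power_mult_distrib v_def csqrt_quotient_square[OF z] r_def using a
    by (simp flip: of_real_power)
  then have sq: "(of_real (sqrt a) * v) ^ (2 * m) = of_real ((- (r * a)) ^ m)" for m
    by (simp only: power_mult of_real_power)
  have "summable (\<lambda>m. clifford_coeff \<gamma> m * (r * a) ^ m)" by (rule summable_clifford[OF \<gamma>])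
  also have "(\<lambda>m. clifford_coeff \<gamma> m * (r * a) ^ m) = (\<lambda>m. (- (r * a)) ^ m / (fact m * Gamma (real m + \<gamma> + 1)))"
    by (rule ext) (simp add: clifford_coeff_def power_minus')
  finally have sum: "summable (\<lambda>m. (- (r * a)) ^ m / (fact m * Gamma (real m + \<gamma> + 1)))" .
  have "bessel_I \<gamma> (2 * csqrt (of_real a * z) / (1 - z))
      = (of_real (sqrt a) * v) powr of_real \<gamma> * of_real (clifford \<gamma> (r * a))"
    unfolding bessel_I_def w sq clifford_def suminf_of_real[OF sum] by simp
  moreover have "(of_real (sqrt a) * v) powr of_real \<gamma> = of_real (a powr (\<gamma> / 2)) * v powr of_real \<gamma>"
    using a by (subst powr_times_real_left) (simp_all add: powr_of_real powr_half_sqrt[symmetric] powr_powr)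
  moreover have "(of_real a * z) powr of_real (- \<gamma> / 2) = of_real (a powr (- \<gamma> / 2)) * z powr of_real (- \<gamma> / 2)"
    using a by (subst powr_times_real_left) (simp_all only: powr_of_real less_imp_le Reals_of_real Re_complex_of_real)
  moreover have "complex_of_real (a powr (- \<gamma> / 2)) * of_real (a powr (\<gamma> / 2)) = 1"
    unfolding of_real_mult[symmetric] powr_add[symmetric] using a by simp
  ultimately show ?thesis
    unfolding hankel_clifford_factor_def phase_def a_def[symmetric] r_def[symmetric] v_def[symmetric]
    by (simp only: of_real_mult) (simp add: mult_ac)
qed

lemma norm_phase:
  assumes "cmod z = 1" "z \<noteq> 1"
  shows "(cmod (phase z \<gamma>))\<^sup>2 = inverse ((cmod (1 - z))\<^sup>2) powr (\<gamma> + 1)"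
proof -
  have p: "0 < cmod (1 - z)" using assms(2) by simp
  have "cmod (phase z \<gamma>) = inverse (cmod (1 - z)) powr \<gamma> * inverse (cmod (1 - z)) powr 1"
  proof -
    have "cmod (z powr of_real (- \<gamma> / 2)) = 1"
      by (simp only: norm_powr_real_powr'[OF Reals_of_real] Re_complex_of_real assms(1) powr_one_eq_one)
    moreover have "cmod ((csqrt z / (1 - z)) powr of_real \<gamma>) = inverse (cmod (1 - z)) powr \<gamma>"
      by (simp only: norm_powr_real_powr'[OF Reals_of_real] Re_complex_of_real norm_divide norm_csqrt
          assms(1) real_sqrt_one inverse_eq_divide)
    moreover have "cmod (inverse (1 - z)) = inverse (cmod (1 - z)) powr 1"
      using p by (simp add: norm_inverse)
    ultimately show ?thesis unfolding phase_def norm_mult by simp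
  qed
  also have "\<dots> = inverse (cmod (1 - z)) powr (\<gamma> + 1)" by (simp add: powr_add)
  finally show ?thesis
    using p by (simp add: power2_eq_square powr_mult[symmetric])
qed

text \<open>
  Away from $z = -1$ the branches commute with conjugation, so the product is the square of the modulus.  The
  point $z = -1$ lies on the branch cut; there the phase is computed and found to be real.
\<close>
lemma phase_cnj:
  assumes z: "cmod z = 1" "z \<noteq> 1"
  shows "phase (cnj z) \<gamma> * phase z \<gamma> = of_real (inverse ((cmod (1 - z))\<^sup>2) powr (\<gamma> + 1))"
proof -
  have "phase (cnj z) \<gamma> = cnj (phase z \<gamma>)"
  proof (cases "Im z = 0")
    case False
    have Re: "0 < Re (csqrt z)"
      using csqrt_principal[of z] power2_csqrt[of z] False
      by (metis complex_eq_iff mult_zero_left add_0 power2_eq_square times_complex.simps(2) mult_zero_right)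
    have "csqrt (cnj z) = cnj (csqrt z)"
      by (rule csqrt_unique) (use Re in \<open>auto simp del: csqrt.simps simp flip: complex_cnj_power\<close>)
    moreover have "cnj ((csqrt z / (1 - z)) powr of_real \<gamma>) = cnj (csqrt z / (1 - z)) powr of_real \<gamma>"
    proof (subst cnj_powr)
      assume im: "Im (csqrt z / (1 - z)) = 0"
      define v where "v = csqrt z / (1 - z)"
      have "v\<^sup>2 = of_real ((Re v)\<^sup>2)" using im unfolding v_def[symmetric]
        by (simp add: complex_eq_iff power2_eq_square)
      then have "(Re v)\<^sup>2 = - inverse ((cmod (1 - z))\<^sup>2)"
        using csqrt_quotient_square[OF z] unfolding v_def[symmetric]
        by (metis of_real_eq_iff of_real_minus)
      moreover have "0 < inverse ((cmod (1 - z))\<^sup>2)" using z(2) by simp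
      ultimately show "0 \<le> Re (csqrt z / (1 - z))" using zero_le_power2[of "Re v"] by linarith
    qed simp
    moreover have "cnj (z powr of_real (- \<gamma> / 2)) = cnj z powr of_real (- \<gamma> / 2)"
      by (subst cnj_powr) (use False in auto)
    ultimately show ?thesis
      unfolding phase_def complex_cnj_mult complex_cnj_inverse complex_cnj_diff complex_cnj_one complex_cnj_divide
      by simp
  next
    case True
    then have "z = of_real (Re z)" "(Re z)\<^sup>2 = 1"
      using z(1) cmod_power2[of z] by (auto simp: complex_eq_iff)
    then have z1: "z = - 1" using z(2) by (auto simp: power2_eq_1_iff)
    have "phase z \<gamma> = exp (of_real (- \<gamma> / 2) * (\<i> * of_real pi)) * ((of_real (1 / 2) * \<i>) powr of_real \<gamma>) * inverse 2"
      unfolding z1 phase_def by (simp add: powr_def Ln_minus1)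
    also have "(of_real (1 / 2) * \<i>) powr of_real \<gamma> = of_real ((1 / 2) powr \<gamma>) * exp (of_real \<gamma> * (\<i> * of_real pi / 2))"
      by (subst powr_times_real_left) (simp_all only: powr_of_real, simp_all add: powr_def Ln_ii)
    also have "exp (of_real (- \<gamma> / 2) * (\<i> * of_real pi)) * (of_real ((1 / 2) powr \<gamma>) * exp (of_real \<gamma> * (\<i> * of_real pi / 2))) * inverse 2
        = of_real ((1 / 2) powr \<gamma>) * exp (of_real (- \<gamma> / 2) * (\<i> * of_real pi) + of_real \<gamma> * (\<i> * of_real pi / 2)) * inverse 2"
      by (simp only: exp_add mult_ac)
    also have "of_real (- \<gamma> / 2) * (\<i> * of_real pi) + of_real \<gamma> * (\<i> * of_real pi / 2) = 0" by simp
    finally have "phase z \<gamma> = of_real ((1 / 2) powr \<gamma> * inverse 2)"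
      by (simp only: exp_zero mult_1_right of_real_mult of_real_inverse of_real_numeral)
    then have "cnj (phase z \<gamma>) = phase z \<gamma>" by (metis complex_cnj_complex_of_real)
    then show ?thesis by (simp add: z1)
  qed
  then show ?thesis
    unfolding norm_phase[OF z, symmetric] complex_norm_square by (simp add: mult.commute)
qed

text \<open>
  The numbers $r_l$ by which the product of the variables is scaled in the Bessel factors.
\<close>
definition kernel_scale :: "complex ^ 'n \<Rightarrow> real ^ 'n" where
  "kernel_scale z = (\<chi> l. inverse ((cmod (1 - z $ l))\<^sup>2))"

lemma torusD:
  assumes "z \<in> punctured_torus"
  shows "cmod (z $ l) = 1" "z $ l \<noteq> 1" "0 < kernel_scale z $ l"
  using assms by (auto simp: punctured_torus_def kernel_scale_def)

lemma cnj_vec_torus: "z \<in> punctured_torus \<Longrightarrow> cnj_vec z \<in> punctured_torus"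
  by (auto simp: punctured_torus_def cnj_vec_def)

lemma cnj_vec_cnj_vec [simp]: "cnj_vec (cnj_vec z) = z"
  by (simp add: cnj_vec_def vec_eq_iff)

lemma kernel_scale_cnj_vec [simp]: "kernel_scale (cnj_vec z) = kernel_scale z"
proof -
  have "cmod (1 - cnj w) = cmod (1 - w)" for w by (metis complex_cnj_diff complex_cnj_one complex_mod_cnj)
  then show ?thesis by (simp add: kernel_scale_def cnj_vec_def)
qed

lemma modified_power_hankel:
  fixes f :: "real ^ 'n \<Rightarrow> complex"
  assumes z: "z \<in> punctured_torus" and \<gamma>: "\<And>l. 0 \<le> \<gamma> $ l" and f: "f \<in> orthant_schwartz"
  shows "modified_power z \<gamma> f = (\<lambda>t. (\<Prod>l\<in>UNIV. phase (z $ l) (\<gamma> $ l)) * hankel (kernel_scale z) \<gamma> f t)"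
proof
  fix t
  show "modified_power z \<gamma> f t = (\<Prod>l\<in>UNIV. phase (z $ l) (\<gamma> $ l)) * hankel (kernel_scale z) \<gamma> f t"
  proof (cases "t \<in> pos_orthant")
    case True
    define C where "C = (\<Prod>l\<in>UNIV. phase (z $ l) (\<gamma> $ l))"
    define h where "h x = C * (f x * of_real (kern (kernel_scale z) \<gamma> \<gamma> x t))" for x
    have hm: "h \<in> borel_measurable borel"
    proof -
      note [measurable] = schwartz_borel_measurable[OF f] borel_measurable_kern(1)[OF \<gamma>]
      show ?thesis unfolding h_def by measurable
    qed
    have eq: "(\<Prod>l\<in>UNIV. inverse (1 - z $ l)) * (f x * (\<Prod>l\<in>UNIV. hankel_clifford_factor (z $ l) (\<gamma> $ l) (x $ l) (t $ l))) = h x"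
      if x: "x \<in> pos_orthant" for x
    proof -
      have "(\<Prod>l\<in>UNIV. inverse (1 - z $ l)) * (\<Prod>l\<in>UNIV. hankel_clifford_factor (z $ l) (\<gamma> $ l) (x $ l) (t $ l))
        = C * of_real (kern (kernel_scale z) \<gamma> \<gamma> x t)"
        unfolding prod.distrib[symmetric] C_def kern_def of_real_prod
        by (intro prod.cong refl) (simp add: hankel_clifford_factor_eq torusD[OF z] \<gamma> pos_orthantD[OF x] pos_orthantD[OF True] kernel_scale_def)
      then show ?thesis by (simp add: h_def mult_ac)
    qed
    have "modified_power z \<gamma> f t = (LINT x|lebesgue_on pos_orthant.
        (\<Prod>l\<in>UNIV. inverse (1 - z $ l)) * (f x * (\<Prod>l\<in>UNIV. hankel_clifford_factor (z $ l) (\<gamma> $ l) (x $ l) (t $ l))))"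
      using True unfolding modified_power_def by simp
    also have "\<dots> = integral\<^sup>L (lebesgue_on pos_orthant) h"
      by (rule Bochner_Integration.integral_cong[OF refl]) (simp add: eq)
    also have "\<dots> = integral\<^sup>L lborel h"
      by (rule lebesgue_on_orthant_integral(2)[OF hm]) (simp add: h_def schwartz_zero[OF f])
    also have "\<dots> = C * hankel (kernel_scale z) \<gamma> f t"
      unfolding h_def hankel_apply[OF True] hankel_integral_def by (rule integral_mult_right_zero)
    finally show ?thesis unfolding C_def .
  qed (simp add: modified_power_def hankel_outside)
qed

definition chirp_rate :: "complex ^ 'n \<Rightarrow> complex ^ 'n" where
  "chirp_rate z = (\<chi> l. - (1 / 2) * ((1 + z $ l) / (1 - z $ l)))"

lemma Re_chirp_rate:
  assumes z: "z \<in> punctured_torus"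
  shows "Re (chirp_rate z $ l) = 0"
proof -
  define w where "w = z $ l"
  have "(Re w)\<^sup>2 + (Im w)\<^sup>2 = 1" using torusD(1)[OF z, of l] cmod_power2[of w] by (simp add: w_def)
  then have "Re ((1 + w) / (1 - w)) = 0"
    by (simp add: Re_divide power2_eq_square algebra_simps)
  moreover have "chirp_rate z $ l = of_real (- (1 / 2)) * ((1 + w) / (1 - w))"
    by (simp add: chirp_rate_def w_def)
  moreover have "Re (of_real c * v) = c * Re v" for c v by simp
  ultimately show ?thesis by (simp only: mult_zero_right)
qed

lemma chirp_rate_cnj_vec:
  assumes z: "z \<in> punctured_torus"
  shows "chirp_rate (cnj_vec z) = - chirp_rate z"
proof -
  have "chirp_rate (cnj_vec z) $ l = - chirp_rate z $ l" for l
  proof -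
    have "chirp_rate (cnj_vec z) $ l = cnj (chirp_rate z $ l)"
      by (simp add: chirp_rate_def cnj_vec_def)
    also have "\<dots> = - chirp_rate z $ l" using Re_chirp_rate[OF z, of l] by (simp add: complex_eq_iff)
    finally show ?thesis .
  qed
  then show ?thesis by (simp add: vec_eq_iff)
qed

lemma chirp_inverse: "chirp (- c) x * (chirp c x * w) = w"
  by (simp add: chirp_def sum_negf exp_minus)

lemma fractional_power_eq:
  fixes f :: "real ^ 'n \<Rightarrow> complex"
  shows "fractional_power z \<gamma> f = (\<lambda>t. chirp (chirp_rate z) t * modified_power z \<gamma> (\<lambda>x. chirp (chirp_rate z) x * f x) t)"
proof
  fix t
  have ch: "chirp (chirp_rate z) x = (\<Prod>l\<in>UNIV. exp (- (1 / 2) * ((1 + z $ l) / (1 - z $ l)) * of_real (x $ l)))" for x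
    by (simp add: chirp_def chirp_rate_def exp_sum)
  show "fractional_power z \<gamma> f t = chirp (chirp_rate z) t * modified_power z \<gamma> (\<lambda>x. chirp (chirp_rate z) x * f x) t"
    unfolding fractional_power_def modified_power_def ch prod.distrib by (simp add: mult_ac)
qed

lemma continuous_op_cong:
  assumes T': "continuous_op T'" and eq: "\<And>f. f \<in> orthant_schwartz \<Longrightarrow> T f = T' f"
  shows "continuous_op T"
  unfolding continuous_op_def
proof (intro conjI ballI allI)
  show "T f \<in> orthant_schwartz" if "f \<in> orthant_schwartz" for f
    using T' that unfolding continuous_op_def eq[OF that] by blast
  fix k p
  have "seminorm_bounded (\<lambda>f. schwartz_seminorm k p (T' f))" using T' unfolding continuous_op_def by blast
  then show "seminorm_bounded (\<lambda>f. schwartz_seminorm k p (T f))"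
    by (rule seminorm_bounded_mono) (simp add: eq)
qed

lemma modified_power_properties:
  fixes \<gamma> :: "real ^ 'n"
  assumes z: "z \<in> punctured_torus" and \<gamma>: "\<And>l. 0 \<le> \<gamma> $ l"
  shows modified_power_continuous: "continuous_op (modified_power z \<gamma>)"
    and modified_power_linear: "linear_on_functions orthant_schwartz (modified_power z \<gamma>)"
    and modified_power_isometric: "f \<in> orthant_schwartz \<Longrightarrow>
      L2_norm (weighted_measure \<gamma>) (modified_power z \<gamma> f) = L2_norm (weighted_measure \<gamma>) f"
    and modified_power_inverse: "f \<in> orthant_schwartz \<Longrightarrow>
      modified_power (cnj_vec z) \<gamma> (modified_power z \<gamma> f) = f"
proof -
  define r where "r = kernel_scale z"
  have r: "\<And>l. 0 < r $ l" using torusD(3)[OF z] by (simp add: r_def)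
  define C where "C z = (\<Prod>l\<in>UNIV. phase (z $ l) (\<gamma> $ l))" for z :: "complex ^ 'n"
  have eq: "modified_power z \<gamma> f = (\<lambda>t. C z * hankel r \<gamma> f t)" if "f \<in> orthant_schwartz" for f
    unfolding modified_power_hankel[OF z \<gamma> that] r_def C_def ..
  have eq': "modified_power (cnj_vec z) \<gamma> f = (\<lambda>t. C (cnj_vec z) * hankel r \<gamma> f t)" if "f \<in> orthant_schwartz" for f
    unfolding modified_power_hankel[OF cnj_vec_torus[OF z] \<gamma> that] kernel_scale_cnj_vec r_def C_def ..
  have rr: "(\<Prod>l\<in>UNIV. r $ l powr (\<gamma> $ l + 1)) * (\<Prod>l\<in>UNIV. r $ l powr (- \<gamma> $ l - 1)) = 1"
    unfolding prod.distrib[symmetric] powr_add[symmetric] using r by (simp add: less_imp_neq[symmetric])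
  show "continuous_op (modified_power z \<gamma>)"
    by (rule continuous_op_cong[OF continuous_op_cmult[OF continuous_op_hankel[OF r \<gamma>]] eq])
  show "linear_on_functions orthant_schwartz (modified_power z \<gamma>)"
    unfolding linear_on_functions_def
    by (simp add: eq schwartz_lincomb(1) hankel_lincomb[OF r _ _ \<gamma>] algebra_simps)
  show "L2_norm (weighted_measure \<gamma>) (modified_power z \<gamma> f) = L2_norm (weighted_measure \<gamma>) f"
    if f: "f \<in> orthant_schwartz"
  proof -
    have "(cmod (C z))\<^sup>2 = (\<Prod>l\<in>UNIV. r $ l powr (\<gamma> $ l + 1))"
      unfolding C_def prod_norm[symmetric] prod_power_distrib r_def kernel_scale_def
      using norm_phase torusD[OF z] by (intro prod.cong refl) simp
    then have "cmod (C z) = sqrt (\<Prod>l\<in>UNIV. r $ l powr (\<gamma> $ l + 1))"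
      by (metis norm_ge_zero real_sqrt_unique)
    then show ?thesis
      unfolding eq[OF f] L2_norm_cmult hankel_parseval[OF r \<gamma> f] mult.assoc[symmetric]
      by (simp only: real_sqrt_mult[symmetric] rr) simp
  qed
  show "modified_power (cnj_vec z) \<gamma> (modified_power z \<gamma> f) = f" if f: "f \<in> orthant_schwartz"
  proof -
    have Hf: "hankel r \<gamma> f \<in> orthant_schwartz" by (rule schwartz_hankel[OF r f \<gamma>])
    have "C (cnj_vec z) * C z = of_real (\<Prod>l\<in>UNIV. r $ l powr (\<gamma> $ l + 1))"
      unfolding C_def prod.distrib[symmetric] r_def kernel_scale_def of_real_prod cnj_vec_def
      using phase_cnj torusD[OF z] by (intro prod.cong refl) simp
    then have one: "C (cnj_vec z) * C z * of_real (\<Prod>l\<in>UNIV. r $ l powr (- \<gamma> $ l - 1)) = 1"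
      by (simp only: of_real_mult[symmetric] rr of_real_1)
    have "modified_power (cnj_vec z) \<gamma> (modified_power z \<gamma> f) = (\<lambda>t. C (cnj_vec z) * (C z * hankel r \<gamma> (hankel r \<gamma> f) t))"
      unfolding eq[OF f] eq'[OF schwartz_cmult[OF Hf Hf]]
      using hankel_lincomb[OF r Hf Hf \<gamma>, where a = "C z" and b = 0] by simp
    also have "\<dots> = (\<lambda>t. (C (cnj_vec z) * C z * of_real (\<Prod>l\<in>UNIV. r $ l powr (- \<gamma> $ l - 1))) * f t)"
      unfolding hankel_hankel[OF r \<gamma> f] by (simp only: mult.assoc)
    finally show ?thesis unfolding one by simp
  qed
qed

lemma fractional_power_properties:
  fixes \<gamma> :: "real ^ 'n"
  assumes z: "z \<in> punctured_torus" and \<gamma>: "\<And>l. 0 \<le> \<gamma> $ l"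
  shows fractional_power_continuous: "continuous_op (fractional_power z \<gamma>)"
    and fractional_power_linear: "linear_on_functions orthant_schwartz (fractional_power z \<gamma>)"
    and fractional_power_isometric: "f \<in> orthant_schwartz \<Longrightarrow>
      L2_norm (weighted_measure \<gamma>) (fractional_power z \<gamma> f) = L2_norm (weighted_measure \<gamma>) f"
    and fractional_power_inverse: "f \<in> orthant_schwartz \<Longrightarrow>
      fractional_power (cnj_vec z) \<gamma> (fractional_power z \<gamma> f) = f"
proof -
  define c where "c = chirp_rate z"
  note Re_c = Re_chirp_rate[OF z, folded c_def]
  have E: "(\<lambda>x. chirp c x * f x) \<in> orthant_schwartz" if "f \<in> orthant_schwartz" for f
    by (rule schwartz_chirp_mult[OF that Re_c])
  have norm_E: "L2_norm M (\<lambda>x. chirp c x * f x) = L2_norm M f" for M f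
    by (simp add: L2_norm_def norm_mult norm_chirp Re_c)
  have eq: "fractional_power z \<gamma> = (\<lambda>f t. chirp c t * modified_power z \<gamma> (\<lambda>x. chirp c x * f x) t)"
    by (rule ext) (simp add: fractional_power_eq c_def)
  have eq': "fractional_power (cnj_vec z) \<gamma> f = (\<lambda>t. chirp (- c) t * modified_power (cnj_vec z) \<gamma> (\<lambda>x. chirp (- c) x * f x) t)" for f
    by (simp add: fractional_power_eq chirp_rate_cnj_vec[OF z] c_def)
  show "continuous_op (fractional_power z \<gamma>)"
    unfolding eq
    by (intro continuous_op_compose[OF continuous_op_chirp[OF Re_c]]
        continuous_op_compose[OF modified_power_continuous[OF z \<gamma>] continuous_op_chirp[OF Re_c]])
  show "linear_on_functions orthant_schwartz (fractional_power z \<gamma>)"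
    unfolding linear_on_functions_def
  proof (intro ballI allI)
    fix f g :: "real ^ 'n \<Rightarrow> complex" and a b
    assume f: "f \<in> orthant_schwartz" and g: "g \<in> orthant_schwartz"
    have "modified_power z \<gamma> (\<lambda>x. a * (chirp c x * f x) + b * (chirp c x * g x))
        = (\<lambda>t. a * modified_power z \<gamma> (\<lambda>x. chirp c x * f x) t + b * modified_power z \<gamma> (\<lambda>x. chirp c x * g x) t)"
      by (rule modified_power_linear[OF z \<gamma>, unfolded linear_on_functions_def, rule_format, OF E[OF f] E[OF g]])
    then show "fractional_power z \<gamma> (\<lambda>x. a * f x + b * g x) = (\<lambda>x. a * fractional_power z \<gamma> f x + b * fractional_power z \<gamma> g x)"
      unfolding eq by (simp add: algebra_simps)
  qed
  show "L2_norm (weighted_measure \<gamma>) (fractional_power z \<gamma> f) = L2_norm (weighted_measure \<gamma>) f"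
    if f: "f \<in> orthant_schwartz"
    unfolding eq norm_E modified_power_isometric[OF z \<gamma> E[OF f]] ..
  show "fractional_power (cnj_vec z) \<gamma> (fractional_power z \<gamma> f) = f" if f: "f \<in> orthant_schwartz"
    unfolding eq' unfolding eq chirp_inverse modified_power_inverse[OF z \<gamma> E[OF f]] ..
qed

text \<open>
  In terms of $a_l = |1-z_l|$ one has $r_l = a_l^{-2}$, and the modulus of the constant in front of the
  Hankel transform is the product of the $a_l^{-\gamma_l-1}$; all powers of $a_l$ cancel except
  $a_l^{k_l-p_l}$.
\<close>
lemma derivative_norm_identity:
  fixes \<gamma> :: "real ^ 'n" and p k :: "nat ^ 'n"
  assumes z: "z \<in> punctured_torus" and \<gamma>: "\<And>l. 0 \<le> \<gamma> $ l" and f: "f \<in> orthant_schwartz"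
    and \<nu>: "\<nu> = \<gamma> + real_vec k + real_vec p"
  shows "L2_norm (weighted_measure \<nu>) (orthant_part (Dp p f))
    = (\<Prod>l\<in>UNIV. cmod (1 - z $ l) powi (int (k $ l) - int (p $ l))) *
      L2_norm (weighted_measure \<nu>) (orthant_part (Dp k (modified_power z \<gamma> f)))"
proof -
  define r where "r = kernel_scale z"
  have r: "\<And>l. 0 < r $ l" using torusD(3)[OF z] by (simp add: r_def)
  define C where "C = (\<Prod>l\<in>UNIV. phase (z $ l) (\<gamma> $ l))"
  have Hf: "hankel r \<gamma> f \<in> orthant_schwartz" by (rule schwartz_hankel[OF r f \<gamma>])
  have "orthant_part (Dp k (modified_power z \<gamma> f)) = (\<lambda>t. C * orthant_part (Dp k (hankel r \<gamma> f)) t)"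
    using Dp_lincomb[OF Hf Hf, where a = C and b = 0 and p = k]
    unfolding modified_power_hankel[OF z \<gamma> f] C_def[symmetric] r_def[symmetric]
    by (auto simp: orthant_part_def)
  then have norm: "L2_norm (weighted_measure \<nu>) (orthant_part (Dp k (modified_power z \<gamma> f)))
      = cmod C * ((\<Prod>l\<in>UNIV. r $ l ^ (k $ l)) * sqrt (\<Prod>l\<in>UNIV. r $ l powr (- \<nu> $ l - 1)))
        * L2_norm (weighted_measure \<nu>) (orthant_part (Dp p f))"
    by (simp only: L2_norm_cmult L2_norm_Dp_hankel[OF r \<gamma> f \<nu>] mult.assoc)
  define D where "D = (\<Prod>l\<in>UNIV. cmod (1 - z $ l) powi (int (k $ l) - int (p $ l)))"
  have one: "D * (cmod C * ((\<Prod>l\<in>UNIV. r $ l ^ (k $ l)) * sqrt (\<Prod>l\<in>UNIV. r $ l powr (- \<nu> $ l - 1)))) = 1"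
  proof (rule power2_eq_imp_eq)
    have "(D * (cmod C * ((\<Prod>l\<in>UNIV. r $ l ^ (k $ l)) * sqrt (\<Prod>l\<in>UNIV. r $ l powr (- \<nu> $ l - 1)))))\<^sup>2
      = D\<^sup>2 * ((cmod C)\<^sup>2 * ((\<Prod>l\<in>UNIV. r $ l ^ (k $ l))\<^sup>2 * (\<Prod>l\<in>UNIV. r $ l powr (- \<nu> $ l - 1))))"
      by (simp add: power_mult_distrib prod_nonneg)
    also have "\<dots> = (\<Prod>l\<in>UNIV. (cmod (1 - z $ l) powi (int (k $ l) - int (p $ l)))\<^sup>2 *
        ((cmod (phase (z $ l) (\<gamma> $ l)))\<^sup>2 * ((r $ l ^ (k $ l))\<^sup>2 * r $ l powr (- \<nu> $ l - 1))))"
      unfolding D_def C_def prod_norm[symmetric] prod_power_distrib prod.distrib ..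
    also have "\<dots> = (\<Prod>l\<in>(UNIV :: 'n set). 1)"
    proof (rule prod.cong[OF refl])
      fix l
      define a where "a = cmod (1 - z $ l)"
      have a: "0 < a" using torusD(2)[OF z, of l] by (simp add: a_def)
      have ra: "r $ l = a powr (- 2)" using a by (simp add: r_def kernel_scale_def a_def powr_minus powr_numeral)
      have "(a powi (int (k $ l) - int (p $ l)))\<^sup>2 = a powr (2 * (real (k $ l) - real (p $ l)))"
        using a by (simp add: power2_eq_square powr_real_of_int'[symmetric] powr_add[symmetric])
      moreover have "(cmod (phase (z $ l) (\<gamma> $ l)))\<^sup>2 = a powr (- 2 * (\<gamma> $ l + 1))"
        using norm_phase[OF torusD(1,2)[OF z], of l "\<gamma> $ l"] ra
        by (simp add: r_def kernel_scale_def powr_powr)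
      moreover have "(r $ l ^ (k $ l))\<^sup>2 = a powr (- 4 * real (k $ l))"
        using a unfolding ra by (simp add: powr_power power_mult[symmetric] mult.commute)
      moreover have "r $ l powr (- \<nu> $ l - 1) = a powr (2 * (\<gamma> $ l + real (k $ l) + real (p $ l) + 1))"
        unfolding ra powr_powr \<nu> by (simp add: algebra_simps)
      ultimately show "(cmod (1 - z $ l) powi (int (k $ l) - int (p $ l)))\<^sup>2 *
        ((cmod (phase (z $ l) (\<gamma> $ l)))\<^sup>2 * ((r $ l ^ (k $ l))\<^sup>2 * r $ l powr (- \<nu> $ l - 1))) = 1"
        using a unfolding a_def[symmetric] by (simp add: powr_add[symmetric])
    qed
    finally show "(D * (cmod C * ((\<Prod>l\<in>UNIV. r $ l ^ (k $ l)) * sqrt (\<Prod>l\<in>UNIV. r $ l powr (- \<nu> $ l - 1)))))\<^sup>2 = 1\<^sup>2"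
      by simp
  qed (auto intro!: mult_nonneg_nonneg prod_nonneg simp: D_def r less_imp_le)
  have cancel: "D * (X * n) = n" if "D * X = 1" for X n
    using that by (simp flip: mult.assoc)
  show ?thesis
    unfolding norm D_def[symmetric] by (rule cancel[OF one, symmetric])
qed

text \<open>
  The assertions about a single operator follow from estimates, isometry and inversion on the Schwartz
  space in the same way for both kinds of powers.
\<close>
lemma operator_extension:
  fixes \<gamma> :: "real ^ 'n"
  assumes \<gamma>: "\<And>l. 0 \<le> \<gamma> $ l" and z: "z \<in> punctured_torus"
    and cont: "\<And>z. z \<in> punctured_torus \<Longrightarrow> continuous_op (P z)"
    and lin: "\<And>z. z \<in> punctured_torus \<Longrightarrow> linear_on_functions orthant_schwartz (P z)"
    and isom: "\<And>z f. z \<in> punctured_torus \<Longrightarrow> f \<in> orthant_schwartz \<Longrightarrow>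
      L2_norm (weighted_measure \<gamma>) (P z f) = L2_norm (weighted_measure \<gamma>) f"
    and inv: "\<And>z f. z \<in> punctured_torus \<Longrightarrow> f \<in> orthant_schwartz \<Longrightarrow> P (cnj_vec z) (P z f) = f"
  shows "linear_on_functions orthant_schwartz (P z) \<and>
    homeomorphic_maps schwartz_topology schwartz_topology (P z) (P (cnj_vec z)) \<and>
    (\<exists>U V. extends_to_L2_isometry (weighted_measure \<gamma>) orthant_schwartz (P z) U \<and>
           extends_to_L2_isometry (weighted_measure \<gamma>) orthant_schwartz (P (cnj_vec z)) V \<and>
           L2_mutually_inverse (weighted_measure \<gamma>) U V)"
proof (intro conjI)
  note z' = cnj_vec_torus[OF z]
  have inv': "P z (P (cnj_vec z) f) = f" if "f \<in> orthant_schwartz" for f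
    using inv[OF z' that] by simp
  show "linear_on_functions orthant_schwartz (P z)" by (rule lin[OF z])
  show "homeomorphic_maps schwartz_topology schwartz_topology (P z) (P (cnj_vec z))"
    unfolding homeomorphic_maps_def topspace_schwartz
    using continuous_op_imp_continuous_map[OF cont[OF z] lin[OF z]]
      continuous_op_imp_continuous_map[OF cont[OF z'] lin[OF z']] inv[OF z] inv' by blast
  have dense: "L2_dense_isometry (weighted_measure \<gamma>) orthant_schwartz (P w) (P (cnj_vec w))"
    if w: "w \<in> punctured_torus" for w
  proof
    show "orthant_schwartz \<subseteq> L2_space (weighted_measure \<gamma>)" using schwartz_L2(1)[OF _ \<gamma>] by blast
    show "\<exists>g\<in>orthant_schwartz. L2_norm (weighted_measure \<gamma>) (\<lambda>x. g x - f x) < e"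
      if "f \<in> L2_space (weighted_measure \<gamma>)" "0 < e" for f and e :: real
      using expo_span_dense[OF \<gamma> that] expo_span_schwartz by blast
    show "P w f \<in> orthant_schwartz" if "f \<in> orthant_schwartz" for f
      using cont[OF w] that unfolding continuous_op_def by blast
  qed (use w lin isom inv schwartz_lincomb(1) in auto)
  show "\<exists>U V. extends_to_L2_isometry (weighted_measure \<gamma>) orthant_schwartz (P z) U \<and>
           extends_to_L2_isometry (weighted_measure \<gamma>) orthant_schwartz (P (cnj_vec z)) V \<and>
           L2_mutually_inverse (weighted_measure \<gamma>) U V"
    using L2_isometry_pair_extension[OF dense[OF z]] dense[OF z'] by simp
qed

theorem proposition4p2:
  fixes \<gamma> :: "real ^ 'n" and z :: "complex ^ 'n"
  assumes "\<forall>l. 0 \<le> \<gamma> $ l" and "z \<in> punctured_torus"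
  shows
    "(\<forall>P \<in> {fractional_power, modified_power}.
        linear_on_functions orthant_schwartz (P z \<gamma>) \<and>
        homeomorphic_maps schwartz_topology schwartz_topology (P z \<gamma>) (P (cnj_vec z) \<gamma>) \<and>
        (\<exists>U V. extends_to_L2_isometry (weighted_measure \<gamma>) orthant_schwartz (P z \<gamma>) U \<and>
               extends_to_L2_isometry (weighted_measure \<gamma>) orthant_schwartz (P (cnj_vec z) \<gamma>) V \<and>
               L2_mutually_inverse (weighted_measure \<gamma>) U V)) \<and>
     (\<forall>p k :: nat ^ 'n. \<forall>f \<in> orthant_schwartz.
        let w = (\<lambda>t. complex_of_real
                   (monomial t (\<chi> l. (real (p $ l) + real (k $ l) + \<gamma> $ l) / 2)));
            M = lebesgue_on pos_orthant;
            g = (\<lambda>t. w t * Dp p f t);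
            h = (\<lambda>t. w t * Dp k (modified_power z \<gamma> f) t)
        in g \<in> L2_space M \<and> h \<in> L2_space M \<and>
           L2_norm M g =
             (\<Prod>l\<in>UNIV. cmod (1 - z $ l) powi (int (k $ l) - int (p $ l))) * L2_norm M h)"
proof (rule conjI; intro ballI allI)
  have \<gamma>: "0 \<le> \<gamma> $ l" for l using assms(1) by blast
  note z = assms(2)
  fix P :: "complex ^ 'n \<Rightarrow> real ^ 'n \<Rightarrow> (real ^ 'n \<Rightarrow> complex) \<Rightarrow> real ^ 'n \<Rightarrow> complex"
  assume "P \<in> {fractional_power, modified_power}"
  then consider "P = fractional_power" | "P = modified_power" by blast
  then show "linear_on_functions orthant_schwartz (P z \<gamma>) \<and>
        homeomorphic_maps schwartz_topology schwartz_topology (P z \<gamma>) (P (cnj_vec z) \<gamma>) \<and>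
        (\<exists>U V. extends_to_L2_isometry (weighted_measure \<gamma>) orthant_schwartz (P z \<gamma>) U \<and>
               extends_to_L2_isometry (weighted_measure \<gamma>) orthant_schwartz (P (cnj_vec z) \<gamma>) V \<and>
               L2_mutually_inverse (weighted_measure \<gamma>) U V)"
  proof cases
    case 1
    show ?thesis unfolding 1
      by (rule operator_extension[OF \<gamma> z, where P = "\<lambda>z. fractional_power z \<gamma>"])
        (auto intro: fractional_power_continuous fractional_power_linear fractional_power_isometric
          fractional_power_inverse \<gamma>)
  next
    case 2
    show ?thesis unfolding 2
      by (rule operator_extension[OF \<gamma> z, where P = "\<lambda>z. modified_power z \<gamma>"])
        (auto intro: modified_power_continuous modified_power_linear modified_power_isometric
          modified_power_inverse \<gamma>)
  qed
next
  have \<gamma>: "0 \<le> \<gamma> $ l" for l using assms(1) by blast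
  note z = assms(2)
  fix p k :: "nat ^ 'n" and f :: "real ^ 'n \<Rightarrow> complex"
  assume f: "f \<in> orthant_schwartz"
  define \<sigma> where "\<sigma> = (\<chi> l. (real (p $ l) + real (k $ l) + \<gamma> $ l) / 2)"
  define \<nu> where "\<nu> = \<gamma> + real_vec k + real_vec p"
  have \<sigma>: "\<sigma> + \<sigma> = \<nu>" by (simp add: \<sigma>_def \<nu>_def vec_eq_iff)
  have \<nu>0: "0 \<le> \<nu> $ l" for l using \<gamma>[of l] by (simp add: \<nu>_def)
  have Jf: "modified_power z \<gamma> f \<in> orthant_schwartz"
    using modified_power_continuous[OF z \<gamma>] f unfolding continuous_op_def by blast
  have part: "Dp q g t = orthant_part (Dp q g) t" if "t \<in> pos_orthant" for q g t
    using that by (simp add: orthant_part_def)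
  have W: "(\<lambda>t. of_real (monomial t \<sigma>) * Dp q g t) \<in> L2_space (lebesgue_on pos_orthant)"
    "L2_norm (lebesgue_on pos_orthant) (\<lambda>t. of_real (monomial t \<sigma>) * Dp q g t)
      = L2_norm (weighted_measure \<nu>) (orthant_part (Dp q g))"
    if g: "g \<in> orthant_schwartz" for q g
    by (rule weighted_derivative_norm[OF orthant_part_Dp_schwartz[OF g] \<nu>0 _ \<sigma>]; erule part)+
  show "let w = (\<lambda>t. complex_of_real
                   (monomial t (\<chi> l. (real (p $ l) + real (k $ l) + \<gamma> $ l) / 2)));
            M = lebesgue_on pos_orthant;
            g = (\<lambda>t. w t * Dp p f t);
            h = (\<lambda>t. w t * Dp k (modified_power z \<gamma> f) t)
        in g \<in> L2_space M \<and> h \<in> L2_space M \<and>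
           L2_norm M g =
             (\<Prod>l\<in>UNIV. cmod (1 - z $ l) powi (int (k $ l) - int (p $ l))) * L2_norm M h"
    unfolding Let_def \<sigma>_def[symmetric] W(2)[OF f] W(2)[OF Jf]
    using W(1)[OF f] W(1)[OF Jf] derivative_norm_identity[OF z \<gamma> f \<nu>_def] by blast
qed

end
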